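(* Let $f:[0,\infty)\to\mathbb{R}$ be a nondecreasing $C^3$ function with $f(0)>1$, and let $B:[1,\infty)\to\mathbb{R}$ be locally bounded. Consider the diffusion process $X(t)$ corresponding to the generator $\frac12\frac{d^2}{dx^2}+B(x)\frac{d}{dx}$ in the time-dependent domain $(1,f(t))$, with reflection at both the fixed endpoint $1$ and the time-dependent endpoint $f(t)$. Let $\gamma\in(-1,1)$ and $b,c>0$. Assume that $$B(x)=bx^\gamma\ \text{ for all sufficiently large } x,\qquad f(t)=c(\log t)^{\frac1{1+\gamma}}\ \text{ for all sufficiently large } t,$$ where $$\frac{2bc^{1+\gamma}}{1+\gamma}>1.$$ Then $$\liminf_{t\to\infty}\frac{X(t)}{f(t)}=\Big(1-\frac{1+\gamma}{2bc^{1+\gamma}}\Big)^{\frac1{1+\gamma}}\quad\text{a.s.}$$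
   Context: The one-dimensional reflected process: started at time $s\ge0$ from $x\in[1,f(s)]$, it is a continuous process with $X(t)\in[1,f(t)]$ for $t\ge s$, satisfying $$X(t)=x+W(t)-W(s)+\int_s^tB(X(u))\,du+\mathcal{L}^{1}_t-\mathcal{L}^{f}_t,$$ where $W$ is a Brownian motion, and $\mathcal{L}^1,\mathcal{L}^f$ are continuous nondecreasing processes, zero at time $s$, with $\mathcal{L}^1$ increasing only when $X(u)=1$ and $\mathcal{L}^f$ increasing only when $X(u)=f(u)$ (boundary local times). For merely locally bounded (measurable) $B$ the process is defined via the Cameron–Martin–Girsanov change of measure (i.e. in the weak sense). "A.s." refers to the law of this process from any starting point. *)

theory Defs
  imports "HOL-Probability.Probability"
begin

text \<open>Derivatives are taken within \<open>S\<close>; at the endpoint of a half-line they are one-sided.\<close>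

definition C_k_on :: "nat \<Rightarrow> (real \<Rightarrow> real) \<Rightarrow> real set \<Rightarrow> bool" where
  "C_k_on k f S \<longleftrightarrow>
     (\<exists>D :: nat \<Rightarrow> real \<Rightarrow> real.
        D 0 = f \<and>
        (\<forall>j<k. \<forall>x\<in>S. (D j has_real_derivative D (Suc j) x) (at x within S)) \<and>
        continuous_on S (D k))"

definition locally_bounded_on :: "real set \<Rightarrow> (real \<Rightarrow> real) \<Rightarrow> bool" where
  "locally_bounded_on S g \<longleftrightarrow> (\<forall>x\<in>S. \<exists>U. open U \<and> x \<in> U \<and> bounded (g ` (U \<inter> S)))"

text \<open>
  Time is \<open>[0,\<infinity>)\<close>. The members of \<open>F\<close> with negative index carry no information,
  since any filtration on \<open>[0,\<infinity>)\<close> can be continued by \<open>F 0\<close>.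
\<close>

definition filtered_prob_space :: "'a measure \<Rightarrow> (real \<Rightarrow> 'a measure) \<Rightarrow> bool" where
  "filtered_prob_space M F \<longleftrightarrow>
     prob_space M \<and> filtration (space M) F \<and> (\<forall>t. subalgebra M (F t))"

definition adapted_from ::
  "real \<Rightarrow> (real \<Rightarrow> 'a measure) \<Rightarrow> (real \<Rightarrow> 'a \<Rightarrow> real) \<Rightarrow> bool" where
  "adapted_from s F Y \<longleftrightarrow> (\<forall>t\<ge>s. Y t \<in> borel_measurable (F t))"

definition brownian_motion ::
  "'a measure \<Rightarrow> (real \<Rightarrow> 'a measure) \<Rightarrow> (real \<Rightarrow> 'a \<Rightarrow> real) \<Rightarrow> bool" where
  "brownian_motion M F W \<longleftrightarrow>
     adapted_from 0 F W \<and>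
     (AE \<omega> in M. W 0 \<omega> = 0) \<and>
     (AE \<omega> in M. continuous_on {0..} (\<lambda>t. W t \<omega>)) \<and>
     (\<forall>r t. 0 \<le> r \<and> r < t \<longrightarrow>
        distributed M lborel (\<lambda>\<omega>. W t \<omega> - W r \<omega>) (normal_density 0 (sqrt (t - r))) \<and>
        prob_space.indep_set M (sets (F r))
          (sets (vimage_algebra (space M) (\<lambda>\<omega>. W t \<omega> - W r \<omega>) borel)))"

definition point_of_increase :: "real \<Rightarrow> (real \<Rightarrow> real) \<Rightarrow> real \<Rightarrow> bool" where
  "point_of_increase s l u \<longleftrightarrow>
     u \<ge> s \<and> (\<forall>\<epsilon>>0. \<exists>v w. s \<le> v \<and> u - \<epsilon> < v \<and> v < w \<and> w < u + \<epsilon> \<and> l v < l w)"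

text \<open>
  A path \<open>l\<close> of the local time of a path \<open>y\<close> at the moving boundary \<open>g\<close>, started at time \<open>s\<close>.
\<close>

definition boundary_local_time ::
  "real \<Rightarrow> (real \<Rightarrow> real) \<Rightarrow> (real \<Rightarrow> real) \<Rightarrow> (real \<Rightarrow> real) \<Rightarrow> bool" where
  "boundary_local_time s g y l \<longleftrightarrow>
     l s = 0 \<and> continuous_on {s..} l \<and> mono_on {s..} l \<and>
     (\<forall>u. point_of_increase s l u \<longrightarrow> y u = g u)"

text \<open>
  \<open>X\<close> is a weak solution on \<open>[s,\<infinity>)\<close>, with values in \<open>[1,f(t)]\<close>, of the reflected equation
  \<open>dX = dW + B(X) dt + dL1 - dLf\<close>, \<open>X(s) = x\<close>: the filtered space and the Brownian motion
  are part of the solution. Since only continuity of \<open>W\<close> and local boundedness of \<open>B\<close> are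
  involved, the equation is read pathwise. For locally bounded measurable \<open>B\<close> the law of \<open>X\<close>
  is the one obtained from the driftless reflected process by the Cameron-Martin-Girsanov
  change of measure.
\<close>

definition reflected_diffusion ::
  "(real \<Rightarrow> real) \<Rightarrow> (real \<Rightarrow> real) \<Rightarrow> real \<Rightarrow> real \<Rightarrow> 'a measure \<Rightarrow> (real \<Rightarrow> 'a measure) \<Rightarrow>
   (real \<Rightarrow> 'a \<Rightarrow> real) \<Rightarrow> (real \<Rightarrow> 'a \<Rightarrow> real) \<Rightarrow> (real \<Rightarrow> 'a \<Rightarrow> real) \<Rightarrow>
   (real \<Rightarrow> 'a \<Rightarrow> real) \<Rightarrow> bool" where
  "reflected_diffusion B f s x M F W L1 Lf X \<longleftrightarrow>
     filtered_prob_space M F \<and> brownian_motion M F W \<and>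
     adapted_from s F X \<and> adapted_from s F L1 \<and> adapted_from s F Lf \<and>
     (AE \<omega> in M.
        continuous_on {s..} (\<lambda>t. X t \<omega>) \<and>
        (\<forall>t\<ge>s. X t \<omega> \<in> {1..f t}) \<and>
        boundary_local_time s (\<lambda>_. 1) (\<lambda>t. X t \<omega>) (\<lambda>t. L1 t \<omega>) \<and>
        boundary_local_time s f (\<lambda>t. X t \<omega>) (\<lambda>t. Lf t \<omega>) \<and>
        (\<forall>t\<ge>s. X t \<omega> =
           x + W t \<omega> - W s \<omega> + (LINT u:{s..t}|lborel. B (X u \<omega>)) + L1 t \<omega> - Lf t \<omega>))"

end

theory Submission
  imports Defs "HOL-Real_Asymp.Real_Asymp"
begin

text \<open>
  The proof works path by path: the reflected process is compared with increments of the driving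
  Brownian path, whose Gaussian law is the only probabilistic input, and no stochastic calculus
  is used. Between two times \<open>p \<le> q\<close> the equation gives
  \<open>X q - X p \<le> W q - W p + \<integral> B(X)\<close> while \<open>X\<close> stays above \<open>1\<close>, and the reverse inequality while
  \<open>X\<close> stays below \<open>f\<close>, because a local time is constant off its boundary.

  Write \<open>R = f t\<close>. To push \<open>X\<close> from \<open>R\<close> down to \<open>a R\<close> against the drift, the Brownian path
  has to spend action \<open>\<integral> (dW)\<^sup>2 / (2 dt)\<close>. Along a path of \<open>X\<close> off the boundaries
  \<open>(dW)\<^sup>2 = (dX - B dt)\<^sup>2 \<ge> - 4 B dX dt\<close>, with equality when \<open>dX = - B dt\<close>, so the least action is
  \<open>\<integral> 2 B dx\<close> over \<open>[a R, R]\<close>, that is \<open>2 b / (1 + \<gamma>) (1 - a\<^bsup>1+\<gamma>\<^esup>) R\<^bsup>1+\<gamma>\<^esup> = Q (1 - a\<^bsup>1+\<gamma>\<^esup>) ln t\<close>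
  with \<open>Q = 2 b c\<^bsup>1+\<gamma>\<^esup> / (1 + \<gamma>)\<close>. A dip to \<open>a f\<close> near time \<open>t\<close> therefore has probability about
  \<open>t\<close> to the power \<open>- Q (1 - a\<^bsup>1+\<gamma>\<^esup>)\<close>, and takes a time of order \<open>R\<^bsup>1-\<gamma>\<^esup>\<close> only, a power of \<open>ln t\<close>.
  By the Borel-Cantelli lemmas dips recur or stop according to whether the exponent
  \<open>Q (1 - a\<^bsup>1+\<gamma>\<^esup>)\<close> is below or above \<open>1\<close>; it equals \<open>1\<close> at the asserted lower limit.

  For the recurrence of dips (\<open>frequently_below_level\<close>), a Brownian path that moves downwards
  at about the optimal speed \<open>2 B\<close>, in finitely many pushes, forces a dip whatever \<open>X\<close> did before.
  Such behaviour of \<open>W\<close> in disjoint time windows has conditional probabilities with a divergent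
  sum.

  For the absence of dips (\<open>eventually_above_level\<close>), consider the part of the path between the
  last visit of a level close to \<open>f\<close> and the first later visit of \<open>a f\<close>. On a fine time grid
  the discrete action of \<open>W\<close> over the window before the dip is at least almost the value above: if
  the descent fits into the window, by comparison with the potential whose slope is \<open>2 B\<close>; if it
  does not, because resisting the drift for so long costs even more. The discrete action has an
  exactly computable exponential moment, so the probabilities of such windows have a finite sum.
  This argument starts from a visit of \<open>f\<close>; there are arbitrarily late ones
  (\<open>frequently_at_boundary\<close>), since from any position a push of bounded size followed by
  fluctuations below \<open>K (1 + v)\<^bsup>\<theta>\<^esup>\<close>, for some \<open>\<theta> > 1/2\<close>, lets the drift carry
  \<open>X\<close> away faster than \<open>f\<close> grows, and this happens with a probability bounded from below.
\<close>

section \<open>Gaussian measures on the line\<close>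

lemma normal_density_shift_bound:
  assumes "0 \<le> d" "0 \<le> x" "0 < \<sigma>"
  shows "normal_density 0 \<sigma> (d + x) \<le> exp (- d\<^sup>2 / (2 * \<sigma>\<^sup>2)) * normal_density 0 \<sigma> x"
proof -
  have "- (d + x)\<^sup>2 / (2 * \<sigma>\<^sup>2) \<le> - d\<^sup>2 / (2 * \<sigma>\<^sup>2) + - x\<^sup>2 / (2 * \<sigma>\<^sup>2)"
    using assms by (simp add: power2_sum divide_simps)
  then have "exp (- (d + x)\<^sup>2 / (2 * \<sigma>\<^sup>2)) \<le> exp (- d\<^sup>2 / (2 * \<sigma>\<^sup>2)) * exp (- x\<^sup>2 / (2 * \<sigma>\<^sup>2))"
    by (metis exp_add exp_le_cancel_iff)
  then show ?thesis
    unfolding normal_density_def by (simp add: divide_right_mono)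
qed

definition gauss :: "real \<Rightarrow> real measure" where
  "gauss h = density lborel (normal_density 0 (sqrt h))"

lemma sets_gauss [measurable_cong, simp]: "sets (gauss h) = sets borel"
  by (simp add: gauss_def)

lemma space_gauss [simp]: "space (gauss h) = UNIV"
  by (simp add: gauss_def)

lemma prob_space_gauss: "0 < h \<Longrightarrow> prob_space (gauss h)"
  unfolding gauss_def by (rule prob_space_normal_density) simp

lemma gauss_uminus:
  assumes "0 < h" "S \<in> sets borel"
  shows "measure (gauss h) (uminus -` S) = measure (gauss h) S"
proof -
  have "distributed (gauss h) lborel (\<lambda>x. x) (normal_density 0 (sqrt h))"
    unfolding distributed_def gauss_def by (auto simp: distr_id2)
  then have "distributed (gauss h) lborel (\<lambda>x. 0 + (-1) * x) (normal_density (0 + (-1) * 0) (\<bar>-1\<bar> * sqrt h))"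
    using assms by (intro prob_space.normal_density_affine prob_space_gauss) auto
  then have "distr (gauss h) lborel uminus = gauss h"
    by (simp add: distributed_def gauss_def)
  then have "emeasure (gauss h) S = emeasure (distr (gauss h) lborel uminus) S" by simp
  also have "\<dots> = emeasure (gauss h) (uminus -` S)"
    using assms by (subst emeasure_distr) auto
  finally show ?thesis by (simp add: measure_def)
qed

lemma gauss_upper_tail:
  assumes "0 \<le> d" "0 < h"
  shows "measure (gauss h) {d<..} \<le> exp (- d\<^sup>2 / (2 * h))"
proof -
  let ?n = "normal_density 0 (sqrt h)"
  interpret G: prob_space "gauss h" using assms by (simp add: prob_space_gauss)
  have "emeasure (gauss h) {d<..} = (\<integral>\<^sup>+x. ennreal (?n x) * indicator {d<..} x \<partial>lborel)"
    unfolding gauss_def by (subst emeasure_density) auto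
  also have "\<dots> = (\<integral>\<^sup>+x. ennreal (?n (d + 1 * x)) * indicator {d<..} (d + 1 * x) \<partial>lborel)"
    by (subst nn_integral_real_affine[where c=1 and t=d]) auto
  also have "\<dots> \<le> (\<integral>\<^sup>+x. ennreal (exp (- d\<^sup>2 / (2 * h))) * ennreal (?n x) \<partial>lborel)"
  proof (rule nn_integral_mono)
    fix x :: real
    show "ennreal (?n (d + 1 * x)) * indicator {d<..} (d + 1 * x) \<le> ennreal (exp (- d\<^sup>2 / (2 * h))) * ennreal (?n x)"
      using normal_density_shift_bound[of d x "sqrt h"] assms
      by (auto simp: indicator_def ennreal_mult[symmetric] intro!: ennreal_leI)
  qed
  also have "\<dots> = ennreal (exp (- d\<^sup>2 / (2 * h))) * emeasure (gauss h) (space (gauss h))"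
    unfolding gauss_def by (subst emeasure_density) (auto simp: nn_integral_cmult)
  also have "\<dots> = ennreal (exp (- d\<^sup>2 / (2 * h)))" using G.emeasure_space_1 by simp
  finally show ?thesis by (simp add: G.emeasure_eq_measure)
qed

lemma gauss_nonneg_half:
  assumes "0 < h" shows "1 / 2 \<le> measure (gauss h) {0..}"
proof -
  interpret G: prob_space "gauss h" using assms by (simp add: prob_space_gauss)
  have "{0..} \<union> {..0::real} = space (gauss h)" by auto
  then have "1 = measure (gauss h) ({0..} \<union> {..0})" using G.prob_space by simp
  also have "\<dots> \<le> measure (gauss h) {0..} + measure (gauss h) {..0}"
    by (rule measure_Un_le) auto
  also have "measure (gauss h) {..0} = measure (gauss h) {0..}"
    using gauss_uminus[OF assms, of "{0..}"] by (simp add: vimage_def atMost_def atLeast_def)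
  finally show ?thesis by simp
qed

text \<open>
  The interval of length one standard deviation ending at \<open>-a\<close> already carries a mass of the right
  exponential order, by the smallest value of the density on it.
\<close>

lemma gauss_lower_tail:
  assumes "0 \<le> a" "0 < h"
  shows "exp (- (a / sqrt h + 1)\<^sup>2 / 2) / sqrt (2 * pi) \<le> measure (gauss h) {..-a}"
proof -
  let ?n = "normal_density 0 (sqrt h)"
  interpret G: prob_space "gauss h" using assms by (simp add: prob_space_gauss)
  let ?c = "exp (- (a / sqrt h + 1)\<^sup>2 / 2) / sqrt (2 * pi * h)"
  have "ennreal (?c * sqrt h) = (\<integral>\<^sup>+x. ennreal ?c * indicator {-a - sqrt h..-a} x \<partial>lborel)"
    using assms by (subst nn_integral_cmult) (auto simp: ennreal_mult[symmetric])
  also have "\<dots> \<le> (\<integral>\<^sup>+x. ennreal (?n x) * indicator {..-a} x \<partial>lborel)"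
  proof (rule nn_integral_mono)
    fix x :: real
    show "ennreal ?c * indicator {-a - sqrt h..-a} x \<le> ennreal (?n x) * indicator {..-a} x"
    proof (cases "x \<in> {-a - sqrt h..-a}")
      case True
      then have "\<bar>x\<bar> \<le> \<bar>a + sqrt h\<bar>" using assms by auto
      then have "x\<^sup>2 \<le> (a + sqrt h)\<^sup>2" by (simp add: abs_le_square_iff)
      also have "\<dots> = h * (a / sqrt h + 1)\<^sup>2"
        using assms by (simp add: power2_eq_square field_simps)
      finally have "x\<^sup>2 / (2 * h) \<le> (a / sqrt h + 1)\<^sup>2 / 2"
        using assms by (simp add: field_simps)
      then have "?c \<le> ?n x" using assms
        unfolding normal_density_def by (simp add: divide_right_mono)
      then show ?thesis using True by (auto intro!: ennreal_leI)
    qed simp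
  qed
  also have "\<dots> = emeasure (gauss h) {..-a}"
    unfolding gauss_def by (subst emeasure_density) auto
  finally have "?c * sqrt h \<le> measure (gauss h) {..-a}" by (simp add: G.emeasure_eq_measure)
  moreover have "?c * sqrt h = exp (- (a / sqrt h + 1)\<^sup>2 / 2) / sqrt (2 * pi)"
    using assms by (simp add: real_sqrt_mult)
  ultimately show ?thesis by simp
qed

text \<open>
  The exponential tilts the density into a multiple of the normal density of variance
  \<open>h / (1 - l)\<close>.
\<close>

lemma gauss_exp_square:
  assumes "0 < h" "0 < l" "l < 1"
  shows "(\<integral>\<^sup>+x. ennreal (exp (l * (x\<^sup>2 / (2 * h)))) \<partial>gauss h) = ennreal (1 / sqrt (1 - l))"
proof -
  let ?s = "sqrt (h / (1 - l))"
  have pos: "0 < ?s" "0 < sqrt (1 - l)" using assms by auto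
  have eq: "normal_density 0 (sqrt h) x * exp (l * (x\<^sup>2 / (2 * h))) = 1 / sqrt (1 - l) * normal_density 0 ?s x" for x
  proof -
    have e: "- x\<^sup>2 / (2 * h) + l * (x\<^sup>2 / (2 * h)) = - x\<^sup>2 / (2 * (h / (1 - l)))"
      using assms by (simp add: field_simps)
    have "exp (- x\<^sup>2 / (2 * h)) * exp (l * (x\<^sup>2 / (2 * h))) = exp (- x\<^sup>2 / (2 * (h / (1 - l))))"
      by (metis e exp_add)
    moreover have "sqrt (2 * pi * (h / (1 - l))) = sqrt (2 * pi * h) / sqrt (1 - l)"
      by (simp add: real_sqrt_divide)
    ultimately show ?thesis using assms pos unfolding normal_density_def
      by (simp add: field_simps)
  qed
  have "(\<integral>\<^sup>+x. ennreal (exp (l * (x\<^sup>2 / (2 * h)))) \<partial>gauss h)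
      = (\<integral>\<^sup>+x. ennreal (normal_density 0 (sqrt h) x) * ennreal (exp (l * (x\<^sup>2 / (2 * h)))) \<partial>lborel)"
    unfolding gauss_def by (subst nn_integral_density) auto
  also have "\<dots> = (\<integral>\<^sup>+x. ennreal (1 / sqrt (1 - l)) * ennreal (normal_density 0 ?s x) \<partial>lborel)"
    using assms by (intro nn_integral_cong) (simp add: ennreal_mult[symmetric] eq[simplified])
  also have "\<dots> = ennreal (1 / sqrt (1 - l)) * (\<integral>\<^sup>+x. ennreal (normal_density 0 ?s x) \<partial>lborel)"
    by (subst nn_integral_cmult) auto
  also have "(\<integral>\<^sup>+x. ennreal (normal_density 0 ?s x) \<partial>lborel) = 1"
    using prob_space.emeasure_space_1[OF prob_space_normal_density[OF pos(1), of 0]]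
    by (subst (asm) emeasure_density) auto
  finally show ?thesis by simp
qed

section \<open>Increments of Brownian motion\<close>

lemma Int_stable_preimages: "Int_stable {X -` A \<inter> \<Omega> |A. A \<in> sets S}"
proof (rule Int_stableI)
  fix a b assume "a \<in> {X -` A \<inter> \<Omega> |A. A \<in> sets S}" "b \<in> {X -` A \<inter> \<Omega> |A. A \<in> sets S}"
  then obtain A B where "a = X -` A \<inter> \<Omega>" "b = X -` B \<inter> \<Omega>" "A \<in> sets S" "B \<in> sets S" by auto
  then have "a \<inter> b = X -` (A \<inter> B) \<inter> \<Omega>" "A \<inter> B \<in> sets S" by auto
  then show "a \<inter> b \<in> {X -` A \<inter> \<Omega> |A. A \<in> sets S}" by blast
qed

locale brownian =
  fixes M :: "'a measure" and F :: "real \<Rightarrow> 'a measure" and W :: "real \<Rightarrow> 'a \<Rightarrow> real"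
  assumes filtered: "filtered_prob_space M F" and brownian: "brownian_motion M F W"
begin

sublocale prob_space M using filtered by (simp add: filtered_prob_space_def)

lemma space_F [simp]: "space (F t) = space M"
  using filtered by (simp add: filtered_prob_space_def subalgebra_def)

lemma F_into_M: "A \<in> sets (F t) \<Longrightarrow> A \<in> sets M"
  using filtered by (auto simp: filtered_prob_space_def subalgebra_def)

lemma F_mono: "A \<in> sets (F r) \<Longrightarrow> r \<le> t \<Longrightarrow> A \<in> sets (F t)"
  using filtered by (auto simp: filtered_prob_space_def filtration_def)

lemma measurable_F_mono:
  assumes "g \<in> measurable (F r) N" "r \<le> t" shows "g \<in> measurable (F t) N"
proof (rule measurableI)
  fix x assume "x \<in> space (F t)"
  then have "x \<in> space (F r)" unfolding space_F .
  then show "g x \<in> space N" by (rule measurable_space[OF assms(1)])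
next
  fix A assume "A \<in> sets N"
  then show "g -` A \<inter> space (F t) \<in> sets (F t)"
    using F_mono[OF measurable_sets[OF assms(1)] assms(2)] unfolding space_F by blast
qed

lemma measurable_F_M: "g \<in> measurable (F r) N \<Longrightarrow> g \<in> measurable M N"
  using filtered measurable_from_subalg unfolding filtered_prob_space_def by blast

lemma W_measurable: "0 \<le> r \<Longrightarrow> r \<le> t \<Longrightarrow> W r \<in> borel_measurable (F t)"
proof -
  assume "0 \<le> r" "r \<le> t"
  then have "W r \<in> borel_measurable (F r)"
    using brownian unfolding brownian_motion_def adapted_from_def by blast
  then show ?thesis using measurable_F_mono \<open>r \<le> t\<close> by blast
qed

lemma increment_measurable:
  "0 \<le> r \<Longrightarrow> r \<le> t \<Longrightarrow> t \<le> u \<Longrightarrow> (\<lambda>\<omega>. W t \<omega> - W r \<omega>) \<in> borel_measurable (F u)"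
  by (intro borel_measurable_diff W_measurable) auto

lemma increment_measurable_M:
  "0 \<le> r \<Longrightarrow> r \<le> t \<Longrightarrow> (\<lambda>\<omega>. W t \<omega> - W r \<omega>) \<in> borel_measurable M"
  using increment_measurable[of r t t] measurable_F_M by blast

lemma increment_event:
  "0 \<le> r \<Longrightarrow> r \<le> t \<Longrightarrow> t \<le> u \<Longrightarrow> S \<in> sets borel \<Longrightarrow> {\<omega>\<in>space M. W t \<omega> - W r \<omega> \<in> S} \<in> sets (F u)"
  using measurable_sets[OF increment_measurable, of r t u S] by (simp add: vimage_def Int_def conj_commute)

lemma distr_increment:
  "0 \<le> r \<Longrightarrow> r < t \<Longrightarrow> distr M lborel (\<lambda>\<omega>. W t \<omega> - W r \<omega>) = gauss (t - r)"
proof -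
  assume "0 \<le> r" "r < t"
  then have "distributed M lborel (\<lambda>\<omega>. W t \<omega> - W r \<omega>) (normal_density 0 (sqrt (t - r)))"
    using brownian unfolding brownian_motion_def by blast
  then show ?thesis unfolding distributed_def gauss_def by simp
qed

text \<open>
  Intersecting with an arbitrary event \<open>A\<close> of the past replaces conditioning: estimates of this form
  can be chained over successive time intervals.
\<close>

lemma prob_increment:
  assumes "0 \<le> r" "r < t" "A \<in> sets (F r)" "S \<in> sets borel"
  shows "prob (A \<inter> {\<omega>\<in>space M. W t \<omega> - W r \<omega> \<in> S}) = prob A * measure (gauss (t - r)) S"
proof -
  let ?Y = "\<lambda>\<omega>. W t \<omega> - W r \<omega>"
  have ind: "indep_set (sets (F r)) (sets (vimage_algebra (space M) ?Y borel))"
    using brownian assms(1,2) unfolding brownian_motion_def by blast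
  have eq: "?Y -` S \<inter> space M = {\<omega>\<in>space M. ?Y \<omega> \<in> S}" by auto
  have "{\<omega>\<in>space M. ?Y \<omega> \<in> S} \<in> sets (vimage_algebra (space M) ?Y borel)"
    using in_vimage_algebra[OF assms(4), of ?Y "space M"] by (simp add: eq)
  then have "prob (A \<inter> {\<omega>\<in>space M. ?Y \<omega> \<in> S}) = prob A * prob {\<omega>\<in>space M. ?Y \<omega> \<in> S}"
    using indep_setD[OF ind assms(3)] by auto
  also have "prob {\<omega>\<in>space M. ?Y \<omega> \<in> S} = measure (distr M lborel ?Y) S"
    using assms increment_measurable_M[of r t] by (subst measure_distr) (auto simp: eq)
  finally show ?thesis using distr_increment assms by simp
qed

lemma nn_integral_increment:
  fixes Z :: "'a \<Rightarrow> ennreal" and g :: "real \<Rightarrow> ennreal"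
  assumes "0 \<le> r" "r < t" and Z: "Z \<in> borel_measurable (F r)" and g: "g \<in> borel_measurable borel"
  shows "(\<integral>\<^sup>+\<omega>. Z \<omega> * g (W t \<omega> - W r \<omega>) \<partial>M) = (\<integral>\<^sup>+\<omega>. Z \<omega> \<partial>M) * (\<integral>\<^sup>+x. g x \<partial>gauss (t - r))"
proof -
  let ?Y = "\<lambda>\<omega>. W t \<omega> - W r \<omega>"
  have Y: "?Y \<in> borel_measurable M" using assms by (intro increment_measurable_M) auto
  have ZM: "Z \<in> borel_measurable M" using Z by (rule measurable_F_M)
  have gY: "(\<lambda>\<omega>. g (?Y \<omega>)) \<in> borel_measurable M" using Y g by measurable
  have *: "indep_var borel Z borel (\<lambda>\<omega>. g (?Y \<omega>))"
    unfolding indep_var_eq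
  proof (intro conjI ZM gY indep_set_sigma_sets)
    show "indep_set {Z -` A \<inter> space M |A. A \<in> sets borel} {(\<lambda>\<omega>. g (?Y \<omega>)) -` A \<inter> space M |A. A \<in> sets borel}"
    proof (safe intro!: indep_setI)
      fix A :: "ennreal set" assume "A \<in> sets borel"
      then show "Z -` A \<inter> space M \<in> events" "(\<lambda>\<omega>. g (?Y \<omega>)) -` A \<inter> space M \<in> events"
        using ZM gY by (auto intro: measurable_sets)
    next
      fix A B :: "ennreal set" assume A: "A \<in> sets borel" and B: "B \<in> sets borel"
      have ZA: "Z -` A \<inter> space M \<in> sets (F r)" using measurable_sets[OF Z A] by simp
      have gB: "g -` B \<in> sets borel" using measurable_sets[OF g B] by simp
      have e: "(\<lambda>\<omega>. g (?Y \<omega>)) -` B \<inter> space M = {\<omega>\<in>space M. ?Y \<omega> \<in> g -` B}" by auto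
      have sp: "space M \<in> sets (F r)" using sets.top[of "F r"] by simp
      have "prob {\<omega>\<in>space M. ?Y \<omega> \<in> g -` B} = measure (gauss (t - r)) (g -` B)"
        using prob_increment[OF assms(1,2) sp gB] by (simp add: prob_space Int_def)
      then show "prob (Z -` A \<inter> space M \<inter> ((\<lambda>\<omega>. g (?Y \<omega>)) -` B \<inter> space M)) =
          prob (Z -` A \<inter> space M) * prob ((\<lambda>\<omega>. g (?Y \<omega>)) -` B \<inter> space M)"
        unfolding e using prob_increment[OF assms(1,2) ZA gB] by simp
    qed
  qed (rule Int_stable_preimages)+
  have iv: "indep_vars (\<lambda>_. borel) (case_bool Z (\<lambda>\<omega>. g (?Y \<omega>))) UNIV"
  proof -
    have "case_bool borel borel = (\<lambda>_::bool. borel :: ennreal measure)" by (auto simp: fun_eq_iff split: bool.split)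
    with * show ?thesis unfolding indep_var_def by simp
  qed
  have "(\<integral>\<^sup>+\<omega>. (\<Prod>i\<in>UNIV. case_bool Z (\<lambda>\<omega>. g (?Y \<omega>)) i \<omega>) \<partial>M)
      = (\<Prod>i\<in>UNIV. \<integral>\<^sup>+\<omega>. case_bool Z (\<lambda>\<omega>. g (?Y \<omega>)) i \<omega> \<partial>M)"
    by (rule indep_vars_nn_integral[OF _ iv]) auto
  then have "(\<integral>\<^sup>+\<omega>. Z \<omega> * g (?Y \<omega>) \<partial>M) = (\<integral>\<^sup>+\<omega>. Z \<omega> \<partial>M) * (\<integral>\<^sup>+\<omega>. g (?Y \<omega>) \<partial>M)"
    by (simp add: UNIV_bool mult.commute)
  also have "(\<integral>\<^sup>+\<omega>. g (?Y \<omega>) \<partial>M) = (\<integral>\<^sup>+x. g x \<partial>distr M lborel ?Y)"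
    using Y g by (subst nn_integral_distr) auto
  finally show ?thesis using distr_increment[OF assms(1,2)] by simp
qed

end

section \<open>Oscillation, action and repeated trials\<close>

context brownian
begin

text \<open>
  Levy's maximal inequality, by induction on the earliest time \<open>b\<close> of the grid. On the event that the
  level is already exceeded at \<open>b\<close>, by symmetry the increment from \<open>b\<close> to \<open>T\<close> is nonnegative
  with probability at least one half, and then the level is exceeded at \<open>T\<close>; on the complement
  the induction hypothesis applies. The sign \<open>e\<close> covers maxima and minima at once.
\<close>

lemma levy_maximal_finite:
  assumes "finite Q" "0 \<le> r" "r \<le> r'" "r' \<le> T" "Q \<subseteq> {r'..T}" "A \<in> sets (F r')" "e = 1 \<or> e = - 1"
  shows "prob (A \<inter> {\<omega>\<in>space M. \<exists>u\<in>Q. d < e * (W u \<omega> - W r \<omega>)})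
    \<le> 2 * prob (A \<inter> {\<omega>\<in>space M. d < e * (W T \<omega> - W r \<omega>)})"
  using assms(1,3-6)
proof (induction Q arbitrary: A r' rule: finite_linorder_min_induct)
  case empty
  then show ?case by (simp add: measure_nonneg)
next
  case (insert b Q)
  have up: "{\<omega>\<in>space M. d < e * (W u \<omega> - W r \<omega>)} \<in> sets (F u)" if "r \<le> u" for u
    using increment_event[of r u u "{x. d < e * x}"] assms(2) that by simp
  have b: "r' \<le> b" "b \<le> T" "r \<le> b" "0 \<le> b" using insert.prems assms(2) by auto
  define A1 where "A1 = A \<inter> {\<omega>\<in>space M. d < e * (W b \<omega> - W r \<omega>)}"
  define A2 where "A2 = A - A1"
  define E where "E = {\<omega>\<in>space M. d < e * (W T \<omega> - W r \<omega>)}"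
  have Ab: "A \<in> sets (F b)" using F_mono insert.prems(4) b(1) by blast
  have A1: "A1 \<in> sets (F b)" unfolding A1_def using Ab up b by auto
  have A2: "A2 \<in> sets (F b)" unfolding A2_def using A1 Ab by auto
  have E: "E \<in> sets M" unfolding E_def using F_into_M[OF up[of T]] b by simp
  have Qb: "Q \<subseteq> {b..T}" using insert.prems(3) insert.hyps(2) by (fastforce simp: less_imp_le)
  have Q: "{\<omega>\<in>space M. \<exists>u\<in>Q. d < e * (W u \<omega> - W r \<omega>)} \<in> sets M"
  proof -
    have "(\<Union>u\<in>Q. {\<omega>\<in>space M. d < e * (W u \<omega> - W r \<omega>)}) \<in> sets M"
      using insert.hyps insert.prems(3) b F_into_M[OF up]
      by (intro sets.finite_UN) auto
    moreover have "(\<Union>u\<in>Q. {\<omega>\<in>space M. d < e * (W u \<omega> - W r \<omega>)}) = {\<omega>\<in>space M. \<exists>u\<in>Q. d < e * (W u \<omega> - W r \<omega>)}"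
      by auto
    ultimately show ?thesis by simp
  qed
  have "A \<inter> {\<omega>\<in>space M. \<exists>u\<in>insert b Q. d < e * (W u \<omega> - W r \<omega>)}
      = A1 \<union> A2 \<inter> {\<omega>\<in>space M. \<exists>u\<in>Q. d < e * (W u \<omega> - W r \<omega>)}"
    unfolding A2_def A1_def by blast
  then have "prob (A \<inter> {\<omega>\<in>space M. \<exists>u\<in>insert b Q. d < e * (W u \<omega> - W r \<omega>)})
      \<le> prob A1 + prob (A2 \<inter> {\<omega>\<in>space M. \<exists>u\<in>Q. d < e * (W u \<omega> - W r \<omega>)})"
    using F_into_M[OF A1] F_into_M[OF A2] Q by (simp only:) (intro measure_Un_le sets.Int)
  also have "prob (A2 \<inter> {\<omega>\<in>space M. \<exists>u\<in>Q. d < e * (W u \<omega> - W r \<omega>)}) \<le> 2 * prob (A2 \<inter> E)"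
    unfolding E_def by (rule insert.IH[OF b(3) b(2) Qb A2])
  also have "prob A1 \<le> 2 * prob (A1 \<inter> E)"
  proof -
    have "prob A1 \<le> 2 * prob (A1 \<inter> {\<omega>\<in>space M. W T \<omega> - W b \<omega> \<in> {x. 0 \<le> e * x}})"
    proof (cases "b < T")
      case True
      have half: "1 / 2 \<le> measure (gauss (T - b)) {x. 0 \<le> e * x}"
        using assms(7) gauss_nonneg_half[of "T - b"] gauss_uminus[of "T - b" "{0..}"] True
        by (auto simp: vimage_def atLeast_def)
      have "prob A1 * 1 \<le> prob A1 * (2 * measure (gauss (T - b)) {x. 0 \<le> e * x})"
        using half by (intro mult_left_mono) auto
      then show ?thesis using b True A1 by (subst prob_increment) auto
    next
      case False
      then have "T = b" using b by simp
      moreover have "A1 \<inter> space M = A1" using sets.sets_into_space[OF F_into_M[OF A1]] by auto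
      ultimately show ?thesis by (simp add: measure_nonneg)
    qed
    also have "prob (A1 \<inter> {\<omega>\<in>space M. W T \<omega> - W b \<omega> \<in> {x. 0 \<le> e * x}}) \<le> prob (A1 \<inter> E)"
      unfolding E_def A1_def using A1[THEN F_into_M] E
      by (intro finite_measure_mono) (auto simp: algebra_simps A1_def E_def)
    finally show ?thesis by simp
  qed
  also have "2 * prob (A1 \<inter> E) + 2 * prob (A2 \<inter> E) = 2 * prob (A \<inter> E)"
  proof -
    have "A \<inter> E = (A1 \<inter> E) \<union> (A2 \<inter> E)" unfolding A2_def A1_def by auto
    moreover have "(A1 \<inter> E) \<inter> (A2 \<inter> E) = {}" unfolding A2_def by auto
    ultimately show ?thesis
      using A1[THEN F_into_M] A2[THEN F_into_M] E by (simp add: finite_measure_Union sets.Int)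
  qed
  finally show ?case unfolding E_def by simp
qed

text \<open>
  Only rational positions in the interval are tested, so that this is an event; for continuous paths
  they determine the oscillation.
\<close>

definition osc :: "real \<Rightarrow> real \<Rightarrow> real \<Rightarrow> 'a set" where
  "osc r h d = {\<omega>\<in>space M. \<exists>q\<in>\<rat> \<inter> {0..1}. d < \<bar>W (r + q * h) \<omega> - W r \<omega>\<bar>}"

lemma osc_sets:
  assumes "0 \<le> r" "0 < h" "r + h \<le> t" shows "osc r h d \<in> sets (F t)"
proof -
  have each: "{\<omega>\<in>space M. W (r + q * h) \<omega> - W r \<omega> \<in> {x. d < \<bar>x\<bar>}} \<in> sets (F t)" if "q \<in> \<rat> \<inter> {0..1}" for q
  proof (rule increment_event)
    have "0 \<le> q * h" "q * h \<le> h" using that assms(2) by (simp_all add: mult_left_le_one_le)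
    then show "r \<le> r + q * h" "r + q * h \<le> t" using assms by linarith+
  qed (use assms in auto)
  have "(\<Union>q\<in>\<rat> \<inter> {0..1}. {\<omega>\<in>space M. W (r + q * h) \<omega> - W r \<omega> \<in> {x. d < \<bar>x\<bar>}}) \<in> sets (F t)"
    using each by (intro sets.countable_UN') (auto simp: countable_rat)
  also have "(\<Union>q\<in>\<rat> \<inter> {0..1}. {\<omega>\<in>space M. W (r + q * h) \<omega> - W r \<omega> \<in> {x. d < \<bar>x\<bar>}}) = osc r h d"
    unfolding osc_def by auto
  finally show ?thesis .
qed

lemma prob_osc:
  assumes "0 \<le> r" "0 < h" "0 \<le> d" and A: "A \<in> sets (F r)"
  shows "prob (A \<inter> osc r h d) \<le> 4 * exp (- d\<^sup>2 / (2 * h)) * prob A"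
proof -
  define q where "q = from_nat_into (\<rat> \<inter> {0..1::real})"
  define B where "B n = A \<inter> {\<omega>\<in>space M. \<exists>u\<in>(\<lambda>i. r + q i * h) ` {..n}. d < \<bar>W u \<omega> - W r \<omega>\<bar>}" for n :: nat
  have ne: "\<rat> \<inter> {0..1::real} \<noteq> {}" using Rats_0 by (metis IntI atLeastAtMost_iff empty_iff order_refl zero_le_one)
  have q: "range q = \<rat> \<inter> {0..1}"
    unfolding q_def by (rule range_from_nat_into[OF ne]) (simp add: countable_rat)
  have u: "u \<in> {r..r + h}" if uU: "u \<in> (\<lambda>i. r + q i * h) ` {..n}" for u n
  proof -
    obtain i where i: "u = r + q i * h" using uU by blast
    have "q i \<in> {0..1}" using q by (metis IntD2 rangeI)
    then have "0 \<le> q i * h" "q i * h \<le> h" using assms(2) by (simp_all add: mult_left_le_one_le)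
    then show ?thesis unfolding i atLeastAtMost_iff by linarith
  qed
  have ev: "{\<omega>\<in>space M. \<exists>u\<in>U. d < e * (W u \<omega> - W r \<omega>)} \<in> sets M" if "finite U" "U \<subseteq> {r..r + h}" for U e
  proof -
    have "(\<Union>u\<in>U. {\<omega>\<in>space M. W u \<omega> - W r \<omega> \<in> {x. d < e * x}}) \<in> sets M"
    proof (rule sets.finite_UN[OF that(1)])
      fix u assume "u \<in> U"
      then have "r \<le> u" "u \<le> r + h" using that(2) by auto
      then show "{\<omega>\<in>space M. W u \<omega> - W r \<omega> \<in> {x. d < e * x}} \<in> sets M"
        using assms(1) by (intro F_into_M[of _ "r + h"] increment_event) auto
    qed
    moreover have "(\<Union>u\<in>U. {\<omega>\<in>space M. W u \<omega> - W r \<omega> \<in> {x. d < e * x}}) = {\<omega>\<in>space M. \<exists>u\<in>U. d < e * (W u \<omega> - W r \<omega>)}" by auto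
    ultimately show ?thesis by simp
  qed
  have one: "prob (A \<inter> {\<omega>\<in>space M. \<exists>u\<in>U. d < e * (W u \<omega> - W r \<omega>)}) \<le> 2 * (prob A * exp (- d\<^sup>2 / (2 * h)))"
    if "finite U" "U \<subseteq> {r..r + h}" "e = 1 \<or> e = -1" for U e
  proof -
    have "prob (A \<inter> {\<omega>\<in>space M. \<exists>u\<in>U. d < e * (W u \<omega> - W r \<omega>)})
        \<le> 2 * prob (A \<inter> {\<omega>\<in>space M. W (r + h) \<omega> - W r \<omega> \<in> {x. d < e * x}})"
      using levy_maximal_finite[OF that(1) assms(1) order_refl _ that(2) A that(3)] assms(2) by simp
    also have "\<dots> = 2 * (prob A * measure (gauss h) {x. d < e * x})"
      using prob_increment[OF assms(1) _ A, of "r + h" "{x. d < e * x}"] assms(2) by simp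
    also have "measure (gauss h) {x. d < e * x} = measure (gauss h) {d<..}"
      using that(3) gauss_uminus[OF assms(2), of "{d<..}"] by (auto simp: vimage_def greaterThan_def)
    also have "2 * (prob A * measure (gauss h) {d<..}) \<le> 2 * (prob A * exp (- d\<^sup>2 / (2 * h)))"
      using gauss_upper_tail[OF assms(3,2)] by (intro mult_left_mono) auto
    finally show ?thesis .
  qed
  have AM: "A \<in> sets M" using A by (rule F_into_M)
  have Bsplit: "B n = (A \<inter> {\<omega>\<in>space M. \<exists>u\<in>(\<lambda>i. r + q i * h) ` {..n}. d < 1 * (W u \<omega> - W r \<omega>)})
      \<union> (A \<inter> {\<omega>\<in>space M. \<exists>u\<in>(\<lambda>i. r + q i * h) ` {..n}. d < - 1 * (W u \<omega> - W r \<omega>)})" for n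
  proof -
    have "d < \<bar>x\<bar> \<longleftrightarrow> d < 1 * x \<or> d < - 1 * x" for x by auto
    then show ?thesis unfolding B_def by blast
  qed
  have BM: "B n \<in> sets M" for n
    unfolding Bsplit by (intro sets.Un sets.Int AM ev[OF _ subsetI[OF u]] finite_imageI finite_atMost)
  have "prob (B n) \<le> 4 * exp (- d\<^sup>2 / (2 * h)) * prob A" for n
  proof -
    let ?U = "(\<lambda>i. r + q i * h) ` {..n}"
    have "prob (B n) \<le> prob (A \<inter> {\<omega>\<in>space M. \<exists>u\<in>?U. d < 1 * (W u \<omega> - W r \<omega>)})
        + prob (A \<inter> {\<omega>\<in>space M. \<exists>u\<in>?U. d < - 1 * (W u \<omega> - W r \<omega>)})"
      unfolding Bsplit by (intro measure_Un_le sets.Int AM ev[OF _ subsetI[OF u]] finite_imageI finite_atMost)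
    also have "\<dots> \<le> 2 * (prob A * exp (- d\<^sup>2 / (2 * h))) + 2 * (prob A * exp (- d\<^sup>2 / (2 * h)))"
      by (intro add_mono one subsetI[OF u] finite_imageI finite_atMost disjI1 disjI2 refl)
    finally show ?thesis by (simp add: mult_ac)
  qed
  moreover have "(\<lambda>n. prob (B n)) \<longlonglongrightarrow> prob (\<Union>n. B n)"
  proof (rule finite_Lim_measure_incseq)
    show "range B \<subseteq> sets M" using BM by auto
    show "incseq B"
    proof (rule incseq_SucI)
      fix n
      have "(\<lambda>i. r + q i * h) ` {..n} \<subseteq> (\<lambda>i. r + q i * h) ` {..Suc n}" by (intro image_mono) auto
      then show "B n \<subseteq> B (Suc n)" unfolding B_def by blast
    qed
  qed
  moreover have "(\<Union>n. B n) = A \<inter> osc r h d"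
    unfolding B_def osc_def q[symmetric] by blast
  ultimately show ?thesis by (metis LIMSEQ_le_const2)
qed

lemma abs_increment_le_outside_osc:
  assumes "continuous_on {0..} (\<lambda>t. W t \<omega>)" "\<omega> \<in> space M" "\<omega> \<notin> osc r h d" "0 \<le> r" "0 < h" "u \<in> {r..r + h}"
  shows "\<bar>W u \<omega> - W r \<omega>\<bar> \<le> d"
proof (rule ccontr)
  assume contr: "\<not> \<bar>W u \<omega> - W r \<omega>\<bar> \<le> d"
  define q where "q = (u - r) / h"
  have q: "q \<in> {0..1}" "u = r + q * h" using assms unfolding q_def by (auto simp: field_simps)
  let ?g = "\<lambda>q. \<bar>W (r + q * h) \<omega> - W r \<omega>\<bar>"
  have "continuous_on {0..1} ?g"
    by (intro continuous_intros continuous_on_compose2[OF assms(1)]) (use assms in auto)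
  moreover have "0 < ?g q - d" using contr q by auto
  ultimately obtain \<epsilon> where \<epsilon>: "\<epsilon> > 0" "\<forall>x\<in>{0..1}. dist x q < \<epsilon> \<longrightarrow> dist (?g x) (?g q) < ?g q - d"
    unfolding continuous_on_iff using q(1) by (metis (no_types, lifting))
  have "max 0 (q - \<epsilon>) < min 1 (q + \<epsilon>)" using q(1) \<epsilon>(1) by auto
  then obtain x where x: "x \<in> \<rat>" "max 0 (q - \<epsilon>) < x" "x < min 1 (q + \<epsilon>)"
    using Rats_dense_in_real by blast
  then have "dist (?g x) (?g q) < ?g q - d" using \<epsilon>(2) by (auto simp: dist_real_def)
  then have "d < ?g x" by (auto simp: dist_real_def)
  then show False using x assms(2,3) unfolding osc_def by auto
qed

text \<open>
  The discrete action: the kinetic energy of the polygon through the values of \<open>W\<close> on the grid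
  \<open>r + j h\<close>.
\<close>

definition action :: "real \<Rightarrow> real \<Rightarrow> nat \<Rightarrow> 'a \<Rightarrow> real" where
  "action r h K \<omega> = (\<Sum>j<K. (W (r + real (Suc j) * h) \<omega> - W (r + real j * h) \<omega>)\<^sup>2 / (2 * h))"

lemma action_measurable:
  assumes "0 \<le> r" "0 < h" shows "action r h K \<in> borel_measurable (F (r + real K * h))"
  unfolding action_def
proof (intro borel_measurable_sum borel_measurable_divide borel_measurable_power increment_measurable borel_measurable_const)
  fix j assume j: "j \<in> {..<K}"
  then have "real (Suc j) * h \<le> real K * h" using assms by (intro mult_right_mono) auto
  then show "r + real (Suc j) * h \<le> r + real K * h" by simp
qed (use assms in \<open>auto simp: algebra_simps\<close>)

lemma action_exp_moment:
  assumes "0 \<le> r" "0 < h" "0 < l" "l < 1"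
  shows "(\<integral>\<^sup>+\<omega>. ennreal (exp (l * action r h K \<omega>)) \<partial>M) = ennreal ((1 / sqrt (1 - l)) ^ K)"
proof (induction K)
  case 0
  then show ?case by (simp add: action_def emeasure_space_1)
next
  case (Suc K)
  let ?r = "r + real K * h" and ?t = "r + real (Suc K) * h"
  have r: "0 \<le> ?r" "?r < ?t" "?t - ?r = h" using assms by (auto simp: algebra_simps)
  have "(\<integral>\<^sup>+\<omega>. ennreal (exp (l * action r h (Suc K) \<omega>)) \<partial>M)
      = (\<integral>\<^sup>+\<omega>. ennreal (exp (l * action r h K \<omega>)) * ennreal (exp (l * ((W ?t \<omega> - W ?r \<omega>)\<^sup>2 / (2 * h)))) \<partial>M)"
    by (intro nn_integral_cong) (simp add: action_def ennreal_mult[symmetric] exp_add[symmetric] algebra_simps)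
  also have "\<dots> = (\<integral>\<^sup>+\<omega>. ennreal (exp (l * action r h K \<omega>)) \<partial>M) * (\<integral>\<^sup>+x. ennreal (exp (l * (x\<^sup>2 / (2 * h)))) \<partial>gauss (?t - ?r))"
  proof (rule nn_integral_increment[OF r(1,2)])
    note [measurable] = action_measurable[OF assms(1,2), of K]
    show "(\<lambda>\<omega>. ennreal (exp (l * action r h K \<omega>))) \<in> borel_measurable (F ?r)" by measurable
  qed measurable
  also have "\<dots> = ennreal ((1 / sqrt (1 - l)) ^ K) * ennreal (1 / sqrt (1 - l))"
    unfolding r(3) Suc gauss_exp_square[OF assms(2-4)] ..
  also have "\<dots> = ennreal ((1 / sqrt (1 - l)) ^ Suc K)"
    using assms by (simp add: ennreal_mult[symmetric] mult.commute)
  finally show ?case .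
qed

lemma prob_action_ge:
  assumes "0 \<le> r" "0 < h" "0 < l" "l < 1"
  shows "prob {\<omega>\<in>space M. a \<le> action r h K \<omega>} \<le> (1 / sqrt (1 - l)) ^ K * exp (- l * a)"
proof -
  have meas: "action r h K \<in> borel_measurable M" using action_measurable[OF assms(1,2)] by (rule measurable_F_M)
  then have S: "{\<omega>\<in>space M. a \<le> action r h K \<omega>} \<in> sets M" by measurable
  have "emeasure M {\<omega>\<in>space M. a \<le> action r h K \<omega>} = (\<integral>\<^sup>+\<omega>. indicator {\<omega>\<in>space M. a \<le> action r h K \<omega>} \<omega> \<partial>M)"
    using S by simp
  also have "\<dots> \<le> (\<integral>\<^sup>+\<omega>. ennreal (exp (- l * a)) * ennreal (exp (l * action r h K \<omega>)) \<partial>M)"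
    using assms by (intro nn_integral_mono)
      (auto simp: indicator_def ennreal_mult[symmetric] exp_add[symmetric] simp flip: ennreal_1 intro!: ennreal_leI)
  also have "\<dots> = ennreal (exp (- l * a)) * (\<integral>\<^sup>+\<omega>. ennreal (exp (l * action r h K \<omega>)) \<partial>M)"
    using meas by (intro nn_integral_cmult) measurable
  also have "\<dots> = ennreal ((1 / sqrt (1 - l)) ^ K * exp (- l * a))"
    unfolding action_exp_moment[OF assms] using assms by (simp add: ennreal_mult[symmetric] mult.commute)
  finally show ?thesis using assms by (simp add: emeasure_eq_measure)
qed

text \<open>
  The second Borel-Cantelli lemma for successive trials. Lower bounds for the conditional probabilities
  given the past replace independence: avoiding the trials from \<open>k\<close> up to \<open>n\<close> has probability at most the
  product of the factors \<open>1 - p i\<close>, hence at most \<open>exp (- \<Sum> p i)\<close>.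
\<close>

lemma infinitely_often_if_conditionally_likely:
  fixes t :: "nat \<Rightarrow> real"
  assumes t: "\<And>n. t n \<le> t (Suc n)"
    and G: "\<And>n. n0 \<le> n \<Longrightarrow> G n \<in> sets (F (t (Suc n)))"
    and p: "\<And>n A. n0 \<le> n \<Longrightarrow> A \<in> sets (F (t n)) \<Longrightarrow> p n * prob A \<le> prob (A \<inter> G n)"
    and div: "\<not> summable p" and nonneg: "\<And>n. 0 \<le> p n"
  shows "AE \<omega> in M. \<exists>\<^sub>\<infinity>n. \<omega> \<in> G n"
proof -
  have "AE \<omega> in M. \<exists>n\<ge>k. \<omega> \<in> G n" if k: "k = n0 + k0" for k0 k :: nat
  proof -
    define B where "B n = {\<omega>\<in>space M. \<forall>i\<in>{k..<n}. \<omega> \<notin> G i}" for n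
    have B: "B (k + m) \<in> sets (F (t (k + m))) \<and> prob (B (k + m)) \<le> exp (- (\<Sum>i<m. p (k + i)))" for m
    proof (induction m)
      case 0
      have "B k = space (F (t k))" unfolding B_def by simp
      then show ?case using sets.top[of "F (t k)"] by (simp add: prob_space)
    next
      case (Suc m)
      let ?n = "k + m"
      have Gn: "G ?n \<in> sets (F (t (Suc ?n)))" using G k by simp
      have Bn: "B ?n \<in> sets (F (t ?n))" using Suc by simp
      have Bn': "B ?n \<in> sets (F (t (Suc ?n)))" using F_mono[OF Bn] t by blast
      have split: "B (Suc ?n) = B ?n - B ?n \<inter> G ?n"
        unfolding B_def by (auto simp: less_Suc_eq)
      have "prob (B (Suc ?n)) = prob (B ?n) - prob (B ?n \<inter> G ?n)"
        unfolding split using F_into_M[OF Bn] F_into_M[OF Gn] by (intro finite_measure_Diff) auto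
      also have "\<dots> \<le> (1 - p ?n) * prob (B ?n)"
        using p[OF _ Bn] k by (simp add: algebra_simps)
      also have "\<dots> \<le> exp (- p ?n) * prob (B ?n)"
        using exp_ge_add_one_self[of "- p ?n"] by (intro mult_right_mono) auto
      also have "\<dots> \<le> exp (- p ?n) * exp (- (\<Sum>i<m. p (k + i)))"
        using Suc by (intro mult_left_mono) auto
      finally show ?case using Bn' Gn split by (simp add: exp_add[symmetric] sets.Diff sets.Int algebra_simps)
    qed
    define N where "N = (\<Inter>m. B (k + m))"
    have NM: "N \<in> sets M" unfolding N_def using B[THEN conjunct1, THEN F_into_M] by (intro sets.countable_INT) auto
    have small: "prob N \<le> e" if "0 < e" for e
    proof -
      have "\<not> summable (\<lambda>i. p (k + i))" using div summable_iff_shift[of p k] by (simp add: add.commute)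
      moreover have "summable (\<lambda>i. p (k + i))" if "\<And>m. (\<Sum>i<m. p (k + i)) \<le> - ln e"
        using nonneg that by (intro summableI_nonneg_bounded[where x="- ln e"]) auto
      ultimately obtain m where "- ln e < (\<Sum>i<m. p (k + i))" by (metis not_le)
      then have "exp (- (\<Sum>i<m. p (k + i))) < exp (ln e)" by (simp only: exp_less_cancel_iff)
      then have "exp (- (\<Sum>i<m. p (k + i))) \<le> e" using that by simp
      moreover have "prob N \<le> prob (B (k + m))"
      proof (rule finite_measure_mono)
        show "N \<subseteq> B (k + m)" unfolding N_def by blast
        show "B (k + m) \<in> sets M" using B[of m] F_into_M by blast
      qed
      ultimately show ?thesis using B[of m] by linarith
    qed
    have "prob N = 0"
    proof (rule ccontr)
      assume "prob N \<noteq> 0"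
      then have "0 < prob N" by (simp add: zero_less_measure_iff)
      then show False using small[of "prob N / 2"] by linarith
    qed
    then have "N \<in> null_sets M" using NM by (auto simp: null_sets_def emeasure_eq_measure)
    then have "AE \<omega> in M. \<omega> \<notin> N" by (rule AE_not_in)
    then show ?thesis using AE_space
    proof eventually_elim
      case (elim \<omega>)
      show ?case
      proof (rule ccontr)
        assume "\<not> (\<exists>n\<ge>k. \<omega> \<in> G n)"
        then have "\<omega> \<in> N" using elim(2) unfolding N_def B_def by simp
        then show False using elim(1) by blast
      qed
    qed
  qed
  then have "AE \<omega> in M. \<exists>n\<ge>n0 + k. \<omega> \<in> G n" for k by blast
  then have "AE \<omega> in M. \<forall>k. \<exists>n\<ge>n0 + k. \<omega> \<in> G n" by (simp add: AE_all_countable)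
  then show ?thesis
    by eventually_elim (auto simp: INFM_nat_le, meson add_leE)
qed

end

section \<open>Paths of the reflected equation\<close>

lemma first_zero:
  fixes \<phi> :: "real \<Rightarrow> real"
  assumes "continuous_on {a..b} \<phi>" "a \<le> b" "0 < \<phi> a" "\<phi> b \<le> 0"
  obtains c where "a < c" "c \<le> b" "\<phi> c = 0" "\<And>v. a \<le> v \<Longrightarrow> v < c \<Longrightarrow> 0 < \<phi> v"
proof -
  define S where "S = {v\<in>{a..b}. \<phi> v = 0}"
  have "S \<noteq> {}" unfolding S_def using IVT2'[of \<phi> b 0 a] assms by auto
  moreover have "closed S" unfolding S_def using assms(1)
    by (intro continuous_closed_preimage_constant) auto
  moreover have bdd: "bdd_below S" unfolding S_def by (intro bdd_belowI[of _ a]) auto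
  ultimately have c: "Inf S \<in> S" by (intro closed_contains_Inf)
  have pos: "0 < \<phi> v" if v: "a \<le> v" "v < Inf S" for v
  proof (rule ccontr)
    assume "\<not> 0 < \<phi> v"
    moreover have "continuous_on {a..v} \<phi>"
      by (rule continuous_on_subset[OF assms(1)]) (use c v in \<open>auto simp: S_def\<close>)
    ultimately obtain z where "a \<le> z" "z \<le> v" "\<phi> z = 0"
      using IVT2'[of \<phi> v 0 a] assms(3) v by auto
    then have "z \<in> S" unfolding S_def using v c by (auto simp: S_def)
    then have "Inf S \<le> z" by (rule cInf_lower[OF _ bdd])
    then show False using \<open>z \<le> v\<close> v by simp
  qed
  have "a \<noteq> Inf S" using c assms(3) unfolding S_def by auto
  then show thesis using that[of "Inf S"] c pos unfolding S_def by auto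
qed

text \<open>
  The mirror image of \<open>first_zero\<close> under reversal of time and sign.
\<close>

lemma last_zero:
  fixes \<phi> :: "real \<Rightarrow> real"
  assumes "continuous_on {a..b} \<phi>" "a \<le> b" "0 \<le> \<phi> a" "\<phi> b < 0"
  obtains c where "a \<le> c" "c < b" "\<phi> c = 0" "\<And>v. c < v \<Longrightarrow> v \<le> b \<Longrightarrow> \<phi> v < 0"
proof -
  have "continuous_on {-b..-a} (\<lambda>v. - \<phi> (- v))"
    by (intro continuous_intros continuous_on_compose2[OF assms(1)]) auto
  then obtain c where "-b < c" "c \<le> -a" "- \<phi> (- c) = 0" "\<And>v. -b \<le> v \<Longrightarrow> v < c \<Longrightarrow> 0 < - \<phi> (- v)"
    using first_zero[of "-b" "-a" "\<lambda>v. - \<phi> (- v)"] assms by (auto simp del: neg_less_0_iff_less)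
  then show thesis using that[of "- c"]
    by (metis add.inverse_inverse le_imp_neg_le minus_less_iff neg_0_equal_iff_equal neg_0_less_iff_less neg_le_iff_le)
qed

text \<open>
  If \<open>l\<close> increased between \<open>p\<close> and \<open>q\<close>, the last time at which it takes the mean of its two end values
  would be a point of increase in the interior.
\<close>

lemma local_time_constant:
  assumes "boundary_local_time s g y l" "s \<le> p" "p \<le> q" "\<And>u. p < u \<Longrightarrow> u \<le> q \<Longrightarrow> y u \<noteq> g u"
  shows "l q = l p"
proof (rule ccontr)
  assume "l q \<noteq> l p"
  have mono: "l u \<le> l v" if "s \<le> u" "u \<le> v" for u v
    using assms(1) that unfolding boundary_local_time_def mono_on_def by auto
  have cont: "continuous_on {s..} l" using assms(1) unfolding boundary_local_time_def by auto
  have lt: "l p < l q" using \<open>l q \<noteq> l p\<close> mono[of p q] assms by simp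
  define r where "r = (l p + l q) / 2"
  have "continuous_on {p..q} (\<lambda>v. r - l v)"
    by (intro continuous_intros continuous_on_subset[OF cont]) (use assms in auto)
  then obtain u where u: "p \<le> u" "u < q" "r - l u = 0" "\<And>v. u < v \<Longrightarrow> v \<le> q \<Longrightarrow> r - l v < 0"
    using last_zero[of p q "\<lambda>v. r - l v"] lt assms(3) unfolding r_def by (auto simp: field_simps)
  have "p < u" using u lt unfolding r_def by (cases "p = u") auto
  have "point_of_increase s l u" unfolding point_of_increase_def
  proof (intro conjI allI impI)
    show "s \<le> u" using u assms by simp
    fix \<epsilon> :: real assume "0 < \<epsilon>"
    then show "\<exists>v w. s \<le> v \<and> u - \<epsilon> < v \<and> v < w \<and> w < u + \<epsilon> \<and> l v < l w"
      using u assms(2) \<open>p < u\<close> by (intro exI[of _ u] exI[of _ "min q (u + \<epsilon> / 2)"]) (auto simp: min_def)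
  qed
  then have "y u = g u" using assms(1) unfolding boundary_local_time_def by auto
  then show False using assms(4) \<open>p < u\<close> u by auto
qed

lemma locally_bounded_on_compact:
  assumes "locally_bounded_on S g" "compact C" "C \<subseteq> S"
  shows "bounded (g ` C)"
proof -
  define T where "T = {U. open U \<and> bounded (g ` (U \<inter> S))}"
  have "C \<subseteq> \<Union>T" using assms unfolding T_def locally_bounded_on_def by blast
  then obtain T' where T': "T' \<subseteq> T" "finite T'" "C \<subseteq> \<Union>T'"
    using compactE[OF assms(2)] unfolding T_def by (metis (no_types, lifting) mem_Collect_eq)
  have "bounded (\<Union>U\<in>T'. g ` (U \<inter> S))" using T' unfolding T_def by (intro bounded_UN) auto
  moreover have "g ` C \<subseteq> (\<Union>U\<in>T'. g ` (U \<inter> S))" using T' assms(3) by blast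
  ultimately show ?thesis by (rule bounded_subset)
qed

text \<open>
  The pathwise content of the reflected equation, for one fixed path.
\<close>

locale reflected_path =
  fixes B f :: "real \<Rightarrow> real" and s x :: real and w y l1 lf :: "real \<Rightarrow> real"
  assumes s_nonneg: "0 \<le> s"
    and f_mono: "mono_on {0..} f"
    and B_measurable: "B \<in> borel_measurable (restrict_space borel {1..})"
    and B_bounded: "locally_bounded_on {1..} B"
    and y_cont: "continuous_on {s..} y"
    and y_in: "\<And>t. s \<le> t \<Longrightarrow> y t \<in> {1..f t}"
    and local_time_1: "boundary_local_time s (\<lambda>_. 1) y l1"
    and local_time_f: "boundary_local_time s f y lf"
    and equation: "\<And>t. s \<le> t \<Longrightarrow> y t = x + w t - w s + (LINT u:{s..t}|lborel. B (y u)) + l1 t - lf t"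
begin

lemma drift_integrable:
  assumes "s \<le> p" "S \<in> sets borel" "S \<subseteq> {p..q}" shows "set_integrable lborel S (\<lambda>u. B (y u))"
proof -
  have "bounded (B ` {1..f (max p q)})"
    by (rule locally_bounded_on_compact[OF B_bounded]) auto
  then obtain K where "\<forall>v\<in>B ` {1..f (max p q)}. norm v \<le> K" unfolding bounded_iff by blast
  then have K: "\<bar>B v\<bar> \<le> K" if "v \<in> {1..f (max p q)}" for v using that by auto
  have "(\<lambda>u. B (y u)) \<in> borel_measurable (restrict_space borel S)"
  proof (rule measurable_compose[OF _ B_measurable])
    show "y \<in> restrict_space borel S \<rightarrow>\<^sub>M restrict_space borel {1..}"
    proof (rule measurable_restrict_space2)
      show "y \<in> space (restrict_space borel S) \<rightarrow> {1..}"
        using y_in assms by (auto simp: space_restrict_space)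
      show "y \<in> restrict_space borel S \<rightarrow>\<^sub>M borel"
        by (intro borel_measurable_continuous_on_restrict continuous_on_subset[OF y_cont]) (use assms in auto)
    qed
  qed
  then have meas: "(\<lambda>u. indicator S u *\<^sub>R B (y u)) \<in> borel_measurable lborel"
    using assms(2) by (subst (asm) borel_measurable_restrict_space_iff) auto
  have bd: "\<bar>B (y u)\<bar> \<le> K" if "u \<in> S" for u
  proof -
    have "u \<in> {p..q}" using that assms by auto
    then have "y u \<in> {1..f u}" "f u \<le> f (max p q)"
      using y_in[of u] assms s_nonneg mono_onD[OF f_mono, of u "max p q"] by auto
    then show ?thesis by (intro K) auto
  qed
  have "integrable lborel (\<lambda>u. indicator S u *\<^sub>R (indicator S u *\<^sub>R B (y u)))"
  proof (rule integrableI_bounded_set_indicator[OF _ meas, of _ K])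
    show "emeasure lborel S < \<infinity>"
      using emeasure_mono[OF assms(3), of lborel] by (simp add: le_less_trans[OF _ ennreal_less_top] emeasure_lborel_Icc_eq split: if_splits)
  qed (use bd assms in \<open>auto simp: indicator_def\<close>)
  then show ?thesis unfolding set_integrable_def by (simp flip: mult.assoc add: indicator_inter_arith[symmetric])
qed

definition drift :: "real \<Rightarrow> real \<Rightarrow> real" where
  "drift p q = (LINT u:{p<..q}|lborel. B (y u))"

lemma increment:
  assumes "s \<le> p" "p \<le> q"
  shows "y q - y p = w q - w p + drift p q + (l1 q - l1 p) - (lf q - lf p)"
proof -
  have "{s..q} = {s..p} \<union> {p<..q}" using assms by auto
  then have "(LINT u:{s..q}|lborel. B (y u)) = (LINT u:{s..p}|lborel. B (y u)) + drift p q"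
    unfolding drift_def using assms
    by (simp only:) (intro set_integral_Un drift_integrable[of s _ q], auto)
  then show ?thesis using equation[of p] equation[of q] assms by simp
qed

lemma drift_le:
  assumes "s \<le> p" "p \<le> q" "\<And>u. p < u \<Longrightarrow> u \<le> q \<Longrightarrow> B (y u) \<le> m"
  shows "drift p q \<le> m * (q - p)"
proof -
  have "drift p q \<le> (LINT u:{p<..q}|lborel. m)"
    unfolding drift_def using assms
    by (intro set_integral_mono drift_integrable[of p _ q]) (auto simp: set_integrable_def)
  also have "\<dots> = m * (q - p)" using assms by (simp add: set_lebesgue_integral_def)
  finally show ?thesis .
qed

lemma drift_ge:
  assumes "s \<le> p" "p \<le> q" "\<And>u. p < u \<Longrightarrow> u \<le> q \<Longrightarrow> m \<le> B (y u)"
  shows "m * (q - p) \<le> drift p q"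
proof -
  have "m * (q - p) = (LINT u:{p<..q}|lborel. m)" using assms by (simp add: set_lebesgue_integral_def)
  also have "\<dots> \<le> drift p q"
    unfolding drift_def using assms
    by (intro set_integral_mono drift_integrable[of p _ q]) (auto simp: set_integrable_def)
  finally show ?thesis .
qed

lemma increment_le:
  assumes "s \<le> p" "p \<le> q" "\<And>u. p < u \<Longrightarrow> u \<le> q \<Longrightarrow> 1 < y u"
  shows "y q - y p \<le> w q - w p + drift p q"
proof -
  have "l1 q = l1 p" using assms by (intro local_time_constant[OF local_time_1]) force+
  moreover have "lf p \<le> lf q"
    using local_time_f assms unfolding boundary_local_time_def mono_on_def by auto
  ultimately show ?thesis using increment[OF assms(1,2)] by simp
qed

lemma increment_ge:
  assumes "s \<le> p" "p \<le> q" "\<And>u. p < u \<Longrightarrow> u \<le> q \<Longrightarrow> y u < f u"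
  shows "w q - w p + drift p q \<le> y q - y p"
proof -
  have "lf q = lf p" using assms by (intro local_time_constant[OF local_time_f]) force+
  moreover have "l1 p \<le> l1 q"
    using local_time_1 assms unfolding boundary_local_time_def mono_on_def by auto
  ultimately show ?thesis using increment[OF assms(1,2)] by simp
qed

text \<open>
  One push of \<open>W\<close> by \<open>-2 d\<close>, in a time in which the drift near the level \<open>L\<close> raises the path by at most
  \<open>d\<close>, lowers the level by \<open>d\<close>. The fine bound \<open>M\<close> on the drift is available near \<open>L\<close> only. A path that
  leaves this neighbourhood can only leave it downwards, and then the crude bound \<open>M1\<close> is enough to keep
  it below \<open>L - d\<close>.
\<close>

lemma descent_step:
  assumes "s \<le> p" "p \<le> q" "y p \<le> L" "0 \<le> d" "0 \<le> k"
    and interior: "\<And>u. p \<le> u \<Longrightarrow> u \<le> q \<Longrightarrow> 1 < y u"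
    and crude: "\<And>u. p \<le> u \<Longrightarrow> u \<le> q \<Longrightarrow> B (y u) \<le> M1" "0 \<le> M1" "M1 * (q - p) \<le> k * d"
    and fine: "\<And>u. p \<le> u \<Longrightarrow> u \<le> q \<Longrightarrow> \<bar>y u - L\<bar> \<le> (k + 7) * d \<Longrightarrow> B (y u) \<le> M" "M * (q - p) \<le> d"
    and osc: "\<And>u. p \<le> u \<Longrightarrow> u \<le> q \<Longrightarrow> \<bar>w u - w p\<bar> \<le> 3 * d"
    and push: "w q - w p \<le> - 2 * d"
  shows "y q \<le> L - d"
proof (cases "\<exists>u\<in>{p..q}. y u < L - (k + 7) * d")
  case True
  then obtain u where u: "p \<le> u" "u \<le> q" "y u < L - (k + 7) * d" by auto
  have "y q - y u \<le> w q - w u + drift u q"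
    using u assms(1) interior by (intro increment_le) auto
  also have "drift u q \<le> M1 * (q - u)" using u assms(1) crude by (intro drift_le) auto
  also have "M1 * (q - u) \<le> k * d"
    using crude(2,3) u mult_left_mono[of "q - u" "q - p" M1] by auto
  also have "w q - w u \<le> d" using osc[of u] push u by (auto simp: abs_le_iff)
  finally have "y q < L - (k + 7) * d + (d + k * d)" using u by linarith
  also have "\<dots> \<le> L - d" using assms(4) by (simp add: algebra_simps)
  finally show ?thesis by simp
next
  case False
  have near: "\<bar>y u - L\<bar> \<le> (k + 7) * d" if u: "p \<le> u" "u \<le> q" for u
  proof -
    have "y u - y p \<le> w u - w p + drift p u"
      using u assms(1) interior by (intro increment_le) auto
    also have "drift p u \<le> M1 * (u - p)" using u assms(1) crude by (intro drift_le) auto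
    also have "M1 * (u - p) \<le> k * d"
      using crude(2,3) u mult_left_mono[of "u - p" "q - p" M1] by auto
    also have "w u - w p \<le> 3 * d" using osc[OF u] by (auto simp: abs_le_iff)
    finally have "y u \<le> L + (k + 7) * d" using assms(3,4) by (simp add: algebra_simps)
    moreover have "L - (k + 7) * d \<le> y u" using False u by (auto simp: not_less)
    ultimately show ?thesis by (simp add: abs_le_iff)
  qed
  have "y q - y p \<le> w q - w p + drift p q" using assms(1,2) interior by (intro increment_le) auto
  also have "drift p q \<le> M * (q - p)" using assms(1,2) near fine(1) by (intro drift_le) auto
  finally show ?thesis using fine(2) push assms(3) by simp
qed

text \<open>
  When the path descends, \<open>(dW)\<^sup>2 = (dX - D)\<^sup>2 \<ge> - 4 D dX\<close> for the accumulated drift \<open>D\<close>; when it ascends,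
  the potential difference is negative and nothing has to be paid.
\<close>

lemma action_step_potential:
  assumes "s \<le> p" "p < q"
    and inside: "\<And>u. p < u \<Longrightarrow> u \<le> q \<Longrightarrow> 1 < y u \<and> y u < f u \<and> m \<le> B (y u)"
    and "0 \<le> m"
    and up: "y p \<le> y q \<Longrightarrow> U (y p) \<le> U (y q)"
    and down: "y q < y p \<Longrightarrow> c * (U (y p) - U (y q)) \<le> 2 * (y p - y q) * m"
    and "0 \<le> c"
  shows "c * (U (y p) - U (y q)) \<le> (w q - w p)\<^sup>2 / (2 * (q - p))"
proof (cases "y p \<le> y q")
  case True
  then have "c * (U (y p) - U (y q)) \<le> 0" using up assms(7) by (simp add: mult_nonneg_nonpos)
  also have "0 \<le> (w q - w p)\<^sup>2 / (2 * (q - p))" using assms by simp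
  finally show ?thesis .
next
  case False
  let ?D = "drift p q"
  have D: "m * (q - p) \<le> ?D" using assms by (intro drift_ge) auto
  have "y q - y p \<le> w q - w p + ?D" using assms by (intro increment_le) auto
  moreover have "w q - w p + ?D \<le> y q - y p" using assms by (intro increment_ge) auto
  ultimately have e: "(w q - w p)\<^sup>2 = (y p - y q + ?D)\<^sup>2"
    by (metis (no_types, opaque_lifting) add_diff_cancel_right' antisym minus_diff_eq power2_minus diff_diff_eq2 diff_minus_eq_add add.commute)
  have "4 * (y p - y q) * (m * (q - p)) \<le> 4 * (y p - y q) * ?D"
    using False D by (intro mult_left_mono) auto
  also have "\<dots> \<le> (y p - y q + ?D)\<^sup>2"
    using zero_le_power2[of "y p - y q - ?D"] by (simp add: power2_eq_square algebra_simps)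
  finally have "2 * (y p - y q) * m * (2 * (q - p)) \<le> (w q - w p)\<^sup>2"
    unfolding e by (simp add: algebra_simps)
  then have "2 * (y p - y q) * m \<le> (w q - w p)\<^sup>2 / (2 * (q - p))"
    using assms(2) by (subst pos_le_divide_eq) auto
  then show ?thesis using down False by linarith
qed

text \<open>
  Resisting a drift of size \<open>m\<close> costs action \<open>m\<^sup>2 / 2\<close> per unit of time, up to a term that telescopes.
\<close>

lemma action_step_time:
  assumes "s \<le> p" "p < q"
    and inside: "\<And>u. p < u \<Longrightarrow> u \<le> q \<Longrightarrow> 1 < y u \<and> y u < f u \<and> m \<le> B (y u)"
    and "0 \<le> m"
  shows "m\<^sup>2 / 2 * (q - p) - m * (y q - y p) \<le> (w q - w p)\<^sup>2 / (2 * (q - p))"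
proof -
  let ?D = "drift p q"
  have D: "m * (q - p) \<le> ?D" using assms by (intro drift_ge) auto
  have "y q - y p \<le> w q - w p + ?D" using assms by (intro increment_le) auto
  moreover have "w q - w p + ?D \<le> y q - y p" using assms by (intro increment_ge) auto
  ultimately have e: "w q - w p = y q - y p - ?D" by simp
  have "0 \<le> (w q - w p + m * (q - p))\<^sup>2" by simp
  then have "(- m * (w q - w p) - m\<^sup>2 / 2 * (q - p)) * (2 * (q - p)) \<le> (w q - w p)\<^sup>2"
    by (simp add: power2_eq_square field_simps)
  then have "- m * (w q - w p) - m\<^sup>2 / 2 * (q - p) \<le> (w q - w p)\<^sup>2 / (2 * (q - p))"
    using assms(2) by (subst pos_le_divide_eq) auto
  moreover have "m * (m * (q - p)) \<le> m * ?D" using D assms(4) by (rule mult_left_mono)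
  moreover have "- m * (w q - w p) = m * ?D - m * (y q - y p)" unfolding e by (simp add: algebra_simps)
  moreover have "m * (m * (q - p)) = m\<^sup>2 / 2 * (q - p) + m\<^sup>2 / 2 * (q - p)" by (simp add: power2_eq_square)
  ultimately show ?thesis by linarith
qed

end

section \<open>Escape from the wall and the cost of a dip\<close>

context reflected_path
begin

text \<open>
  Outgrowing the fluctuations of \<open>W\<close>: from a high start, a drift of at least \<open>b z\<^bsup>-g\<^esup>\<close> keeps the
  path above \<open>C (1 + v)\<^bsup>\<theta>\<^esup>\<close>. Let \<open>v1\<close> be the first time at which this barrier is met, and \<open>v2\<close> the last earlier time on
  four times the barrier. If \<open>v2\<close> is comparable with \<open>v1\<close>, the fluctuations are too small for
  such a fall. Otherwise the path has been below \<open>4 C (1 + v1)\<^bsup>\<theta>\<^esup>\<close> for a time of order \<open>v1\<close>, and the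
  drift accumulated meanwhile has order \<open>(1 + v1)\<close> to the power \<open>1 - g \<theta>\<close>, which exceeds \<open>\<theta>\<close>
  because \<open>\<theta> (1 + g) < 1\<close>; this is the hypothesis \<open>grow\<close>.
\<close>

lemma escape_to_boundary:
  fixes p V K C V0 b g \<theta> :: real
  assumes "s \<le> p" and "0 \<le> \<theta>" "\<theta> \<le> 1" and "0 \<le> K" "2 * K < C" "1 \<le> V0" "0 \<le> g" "0 \<le> b"
    and w_bound: "\<And>v. 0 \<le> v \<Longrightarrow> v \<le> V \<Longrightarrow> \<bar>w (p + v) - w p\<bar> \<le> K * (1 + v) powr \<theta>"
    and below: "\<And>u. p < u \<Longrightarrow> u \<le> p + V \<Longrightarrow> y u < f u"
    and B_lower: "\<And>z. C \<le> z \<Longrightarrow> b * z powr (- g) \<le> B z"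
    and grow: "\<And>v. V0 \<le> 1 + v \<Longrightarrow> (C + 2 * K) * (1 + v) powr \<theta> \<le> b * (4 * C * (1 + v) powr \<theta>) powr (- g) * ((1 + v) / 2)"
    and start: "4 * C \<le> y p" "(K + C) * V0 < y p"
    and v: "0 \<le> v" "v \<le> V"
  shows "C * (1 + v) powr \<theta> \<le> y (p + v)"
proof (rule ccontr)
  have C: "0 < C" using assms by linarith
  assume neg: "\<not> C * (1 + v) powr \<theta> \<le> y (p + v)"
  have cont: "continuous_on {0..v} (\<lambda>v. y (p + v) - c * (1 + v) powr \<theta>)" for c v
    by (intro continuous_intros continuous_on_compose2[OF y_cont]) (use assms in auto)
  obtain v1 where v1: "0 < v1" "v1 \<le> v" "y (p + v1) - C * (1 + v1) powr \<theta> = 0"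
    "\<And>u. 0 \<le> u \<Longrightarrow> u < v1 \<Longrightarrow> 0 < y (p + u) - C * (1 + u) powr \<theta>"
    using first_zero[OF cont v(1), of C] neg start C by auto
  let ?u = "1 + v1"
  have y1: "y (p + v1) = C * ?u powr \<theta>" using v1(3) by simp
  have "1 \<le> ?u powr \<theta>" using v1(1) assms(2) by (simp add: ge_one_powr_ge_zero)
  have low: "C * (1 + u) powr \<theta> \<le> y (p + u)" if "0 \<le> u" "u \<le> v1" for u
    using v1(3) v1(4)[of u] that by (cases "u = v1") auto
  have lowC: "C \<le> y (p + u)" if "0 \<le> u" "u \<le> v1" for u
  proof -
    have "C * 1 \<le> C * (1 + u) powr \<theta>" using C that assms(2) by (intro mult_left_mono) (auto simp: ge_one_powr_ge_zero)
    then show ?thesis using low[OF that] by simp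
  qed
  obtain v2 where v2: "0 \<le> v2" "v2 < v1" "y (p + v2) - 4 * C * (1 + v2) powr \<theta> = 0"
    "\<And>u. v2 < u \<Longrightarrow> u \<le> v1 \<Longrightarrow> y (p + u) - 4 * C * (1 + u) powr \<theta> < 0"
  proof (rule last_zero[OF cont[of v1 "4 * C"]])
    show "y (p + v1) - 4 * C * (1 + v1) powr \<theta> < 0" using y1 C v1(1) by simp
  qed (use start v1 in auto)
  let ?m = "b * (4 * C * ?u powr \<theta>) powr (- g)"
  have m: "?m \<le> B (y u)" if "p + v2 < u" "u \<le> p + v1" for u
  proof -
    define a where "a = u - p"
    have a: "v2 < a" "a \<le> v1" "u = p + a" using that unfolding a_def by auto
    have yC: "C \<le> y (p + a)" using lowC a v2(1) by auto
    have "y (p + a) \<le> 4 * C * (1 + a) powr \<theta>" using v2(4)[OF a(1,2)] by simp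
    also have "\<dots> \<le> 4 * C * ?u powr \<theta>"
      using a v2(1) C assms(2) by (intro mult_left_mono powr_mono2) auto
    finally have "(4 * C * ?u powr \<theta>) powr (- g) \<le> y (p + a) powr (- g)"
      using yC C assms(7) by (intro powr_mono2') auto
    then have "?m \<le> b * y (p + a) powr (- g)" using assms(8) by (intro mult_left_mono) auto
    also have "\<dots> \<le> B (y (p + a))" by (rule B_lower[OF yC])
    finally show ?thesis unfolding a(3) .
  qed
  have m0: "0 \<le> ?m" using assms by simp
  have mono_w: "K * (1 + u) powr \<theta> \<le> K * ?u powr \<theta>" if "0 \<le> u" "u \<le> v1" for u
    using that assms by (intro mult_left_mono powr_mono2) auto
  have wb: "\<bar>w (p + u) - w p\<bar> \<le> K * ?u powr \<theta>" if "0 \<le> u" "u \<le> v1" for u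
    using w_bound[of u] mono_w[OF that] that v1 v by linarith
  have from0: "y p - K * ?u powr \<theta> \<le> y (p + v1)"
  proof -
    have "w (p + v1) - w p + drift p (p + v1) \<le> y (p + v1) - y p"
      using assms(1) v1 v below by (intro increment_ge) auto
    moreover have "0 * (p + v1 - p) \<le> drift p (p + v1)"
    proof (rule drift_ge)
      fix u assume u: "p < u" "u \<le> p + v1"
      have "C \<le> y u" using lowC[of "u - p"] u by auto
      then have "b * y u powr (- g) \<le> B (y u)" by (rule B_lower)
      then show "0 \<le> B (y u)" using assms(8) by (smt (verit) mult_nonneg_nonneg powr_ge_zero)
    qed (use assms v1 in auto)
    ultimately show ?thesis using wb[of v1] v1 by (simp add: abs_le_iff)
  qed
  have from2: "y (p + v2) - 2 * K * ?u powr \<theta> + ?m * (v1 - v2) \<le> y (p + v1)"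
  proof -
    have "w (p + v1) - w (p + v2) + drift (p + v2) (p + v1) \<le> y (p + v1) - y (p + v2)"
      using assms(1) v1 v2 v below by (intro increment_ge) auto
    moreover have "?m * (p + v1 - (p + v2)) \<le> drift (p + v2) (p + v1)"
      using m assms(1) v2 by (intro drift_ge) auto
    moreover have "?m * (p + v1 - (p + v2)) = ?m * (v1 - v2)" by simp
    ultimately show ?thesis using wb[of v1] wb[of v2] v1 v2 unfolding abs_le_iff by linarith
  qed
  have big: "V0 \<le> ?u"
  proof (rule ccontr)
    assume "\<not> V0 \<le> ?u"
    then have "?u powr \<theta> \<le> V0 powr 1"
      using v1 assms(2,3) by (intro order_trans[OF powr_mono[of \<theta> 1 ?u] powr_mono2]) auto
    then have "(K + C) * ?u powr \<theta> \<le> (K + C) * V0"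
      using assms(4,6) C by (intro mult_left_mono) auto
    then show False using from0 y1 start by (simp add: algebra_simps)
  qed
  have y2: "y (p + v2) = 4 * C * (1 + v2) powr \<theta>" using v2(3) by simp
  show False
  proof (cases "?u \<le> 2 * (1 + v2)")
    case True
    have "?u powr \<theta> \<le> (2 * (1 + v2)) powr \<theta>" using True v1 assms(2) by (intro powr_mono2) auto
    also have "\<dots> = 2 powr \<theta> * (1 + v2) powr \<theta>" by (rule powr_mult)
    also have "\<dots> \<le> 2 powr 1 * (1 + v2) powr \<theta>" using assms(3) by (intro mult_right_mono powr_mono) auto
    finally have "2 * C * ?u powr \<theta> \<le> 2 * C * (2 * (1 + v2) powr \<theta>)"
      using C by (intro mult_left_mono) auto
    then have "2 * C * ?u powr \<theta> \<le> y (p + v2)" unfolding y2 by simp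
    moreover have "0 \<le> ?m * (v1 - v2)" using m0 v2 by simp
    ultimately have "2 * C * ?u powr \<theta> - 2 * K * ?u powr \<theta> \<le> C * ?u powr \<theta>" using from2 y1 by linarith
    then have "(C - 2 * K) * ?u powr \<theta> \<le> 0" by (simp add: algebra_simps)
    then show False using \<open>1 \<le> ?u powr \<theta>\<close> assms(5) by (simp add: mult_le_0_iff)
  next
    case False
    then have "?m * (?u / 2) \<le> ?m * (v1 - v2)" using m0 by (intro mult_left_mono) auto
    then have "(C + 2 * K) * ?u powr \<theta> \<le> ?m * (v1 - v2)" using grow[OF big] by simp
    moreover have "0 < y (p + v2)" unfolding y2 using C v2(1) by simp
    ultimately show False using from2 y1 by (simp add: algebra_simps)
  qed
qed

text \<open>
  The cost of a dip at time \<open>\<tau>\<close> on the grid \<open>a + j h\<close>. If the descent starts at a time \<open>\<sigma>\<close> inside the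
  window, the steps of the grid between \<open>\<sigma>\<close> and \<open>\<tau>\<close> pay for the difference of the potential \<open>U\<close>, the two
  incomplete steps being absorbed by the oscillation bound \<open>\<delta>\<close>. If the path has been off the
  boundaries since the beginning of the window, the duration is paid for instead. The hypothesis
  \<open>local\<close> says that \<open>2 B\<close> is at least \<open>c\<close> times the slope of \<open>U\<close>, up to moving the argument by \<open>\<delta>\<close>
  a few times.
\<close>

lemma action_of_dip:
  fixes a h :: real and t :: "nat \<Rightarrow> real" and K :: nat
  defines "t \<equiv> \<lambda>j. a + real j * h"
  defines "S \<equiv> \<lambda>j. \<Sum>i<j. (w (t (Suc i)) - w (t i))\<^sup>2 / (2 * h)"
  assumes "s \<le> a" "0 < h" "s \<le> \<sigma>" "\<sigma> \<le> \<tau>" "a \<le> \<tau>" "\<tau> < t K"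
    and inside: "\<And>u. \<sigma> \<le> u \<Longrightarrow> u \<le> \<tau> \<Longrightarrow> 1 < y u \<and> lo \<le> y u \<and> y u \<le> hi"
    and below: "\<And>u. \<sigma> < u \<Longrightarrow> u \<le> \<tau> \<Longrightarrow> y u < f u"
    and drift_bounds: "\<And>z. lo \<le> z \<Longrightarrow> z \<le> hi \<Longrightarrow> m \<le> B z \<and> B z \<le> m'" "0 \<le> m" "0 \<le> m'" "m' * h \<le> \<delta>"
    and osc: "\<And>j u. j < K \<Longrightarrow> t j \<le> u \<Longrightarrow> u \<le> t (Suc j) \<Longrightarrow> \<bar>w u - w (t j)\<bar> \<le> \<delta>"
    and U: "mono_on {0..} U" "0 \<le> lo" "0 \<le> c"
    and local: "\<And>v v' z. v \<in> {lo..hi} \<Longrightarrow> v' \<in> {lo..hi} \<Longrightarrow> z \<in> {lo..hi} \<Longrightarrow> v' < v \<Longrightarrow>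
        \<bar>z - v\<bar> \<le> 2 * \<delta> \<Longrightarrow> \<bar>v' - v\<bar> \<le> 2 * \<delta> \<Longrightarrow> c * (U v - U v') \<le> 2 * (v - v') * B z"
    and from_upper: "a < \<sigma> \<Longrightarrow> upper + 2 * \<delta> \<le> y \<sigma>" and "y \<tau> + \<delta> \<le> lower" "lower < upper" "0 \<le> upper" "0 \<le> \<delta>"
    and A: "A \<le> c * (U upper - U lower)" "A \<le> m\<^sup>2 / 2 * (\<tau> - a - h) - m * hi" "0 \<le> hi"
  shows "A \<le> S K"
proof -
  have tS: "t (Suc j) = t j + h" for j unfolding t_def by (simp add: algebra_simps)
  have ta: "a \<le> t j" for j unfolding t_def using \<open>0 < h\<close> by simp
  have t0: "t 0 = a" unfolding t_def by simp
  have SS: "S (Suc j) = S j + (w (t (Suc j)) - w (t j))\<^sup>2 / (2 * h)" for j unfolding S_def by simp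
  have S_nonneg: "0 \<le> S j" for j unfolding S_def using \<open>0 < h\<close> by (intro sum_nonneg) auto
  have S_mono: "S i \<le> S j" if "i \<le> j" for i j
    unfolding S_def using that \<open>0 < h\<close> by (intro sum_mono2) auto
  have step: "c * (U (y (t j)) - U (y (t (Suc j)))) \<le> (w (t (Suc j)) - w (t j))\<^sup>2 / (2 * h)"
    if j: "j < K" "\<sigma> \<le> t j" "t (Suc j) \<le> \<tau>" for j
  proof -
    have near: "\<bar>y u - y (t j)\<bar> \<le> 2 * \<delta>" if u: "t j < u" "u \<le> t (Suc j)" for u
    proof -
      have s: "s \<le> t j" using j \<open>s \<le> \<sigma>\<close> by simp
      have "y u - y (t j) \<le> w u - w (t j) + drift (t j) u"
        using s u j inside by (intro increment_le) auto
      moreover have "w u - w (t j) + drift (t j) u \<le> y u - y (t j)"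
        using s u j below by (intro increment_ge) auto
      moreover have "drift (t j) u \<le> m' * (u - t j)"
        using s u j inside drift_bounds(1) by (intro drift_le) auto
      moreover have "m * (u - t j) \<le> drift (t j) u"
        using s u j inside drift_bounds(1) by (intro drift_ge) auto
      moreover have "m' * (u - t j) \<le> m' * h"
        using u tS drift_bounds(3) by (intro mult_left_mono) auto
      moreover have "0 \<le> m * (u - t j)" using drift_bounds(2) u by simp
      moreover have "\<bar>w u - w (t j)\<bar> \<le> \<delta>" using osc[OF j(1)] u by auto
      ultimately show ?thesis using drift_bounds(4) unfolding abs_le_iff by linarith
    qed
    have range: "y u \<in> {lo..hi}" if "t j \<le> u" "u \<le> t (Suc j)" for u using inside[of u] that j by auto
    show ?thesis
    proof (cases "y (t (Suc j)) < y (t j)")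
      case False
      have "U (y (t j)) \<le> U (y (t (Suc j)))"
        using False range[of "t j"] range[of "t (Suc j)"] U(2) \<open>0 < h\<close> tS
        by (intro mono_onD[OF U(1)]) auto
      then have "c * (U (y (t j)) - U (y (t (Suc j)))) \<le> 0" using U(3) by (simp add: mult_nonneg_nonpos)
      also have "0 \<le> (w (t (Suc j)) - w (t j))\<^sup>2 / (2 * h)" using \<open>0 < h\<close> by simp
      finally show ?thesis .
    next
      case True
      let ?V = "y (t j)" and ?V' = "y (t (Suc j))"
      (* The lower bound for the drift in this step that makes the comparison exact. *)
      let ?m = "c * (U ?V - U ?V') / (2 * (?V - ?V'))"
      have "U ?V' \<le> U ?V"
        using True range[of "t j"] range[of "t (Suc j)"] U(2) \<open>0 < h\<close> tS
        by (intro mono_onD[OF U(1)]) auto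
      then have m0: "0 \<le> ?m" using True U(3) by simp
      have mB: "?m \<le> B (y u)" if u: "t j < u" "u \<le> t (Suc j)" for u
      proof -
        have "c * (U ?V - U ?V') \<le> 2 * (?V - ?V') * B (y u)"
          using True near[OF u] near[of "t (Suc j)"] range[of u] range[of "t j"] range[of "t (Suc j)"] u \<open>0 < h\<close> tS
          by (intro local) auto
        then show ?thesis using True by (subst pos_divide_le_eq) (auto simp: mult_ac)
      qed
      have "c * (U ?V - U ?V') \<le> (w (t (Suc j)) - w (t j))\<^sup>2 / (2 * (t (Suc j) - t j))"
        using j \<open>s \<le> \<sigma>\<close> \<open>0 < h\<close> tS inside below m0 mB True U(3)
        by (intro action_step_potential[where m = ?m]) auto
      then show ?thesis using tS by simp
    qed
  qed
  have time_step: "m\<^sup>2 / 2 * h - m * (y (t (Suc j)) - y (t j)) \<le> (w (t (Suc j)) - w (t j))\<^sup>2 / (2 * h)"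
    if j: "j < K" "\<sigma> \<le> t j" "t (Suc j) \<le> \<tau>" for j
  proof -
    have "m\<^sup>2 / 2 * (t (Suc j) - t j) - m * (y (t (Suc j)) - y (t j)) \<le> (w (t (Suc j)) - w (t j))\<^sup>2 / (2 * (t (Suc j) - t j))"
      using j \<open>s \<le> \<sigma>\<close> \<open>0 < h\<close> tS inside below drift_bounds by (intro action_step_time) auto
    then show ?thesis using tS by simp
  qed
  obtain k where k: "k < K" "t k \<le> \<tau>" "\<tau> < t (Suc k)"
  proof -
    define k where "k = (LEAST k. \<tau> < t k)"
    have "\<tau> < t k" unfolding k_def using \<open>\<tau> < t K\<close> by (rule LeastI)
    moreover have "k \<le> K" unfolding k_def using \<open>\<tau> < t K\<close> by (rule Least_le)
    moreover have "k \<noteq> 0" using \<open>\<tau> < t k\<close> t0 \<open>a \<le> \<tau>\<close> by (cases k) auto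
    moreover have "\<not> \<tau> < t (k - 1)" using not_less_Least[of "k - 1" "\<lambda>k. \<tau> < t k"] \<open>k \<noteq> 0\<close> unfolding k_def by simp
    ultimately show thesis using that[of "k - 1"] by auto
  qed
  have partial: "y q - y p \<ge> w q - w p" if "\<sigma> \<le> p" "p \<le> q" "q \<le> \<tau>" for p q
  proof -
    have "w q - w p + drift p q \<le> y q - y p" using that \<open>s \<le> \<sigma>\<close> below by (intro increment_ge) auto
    moreover have "m * (q - p) \<le> drift p q" using that \<open>s \<le> \<sigma>\<close> inside drift_bounds(1) by (intro drift_ge) auto
    moreover have "0 \<le> m * (q - p)" using that drift_bounds(2) by simp
    ultimately show ?thesis by simp
  qed
  show ?thesis
  proof (cases "a < \<sigma>")
    case True
    have crossing: "upper \<le> y u" if "j < K" "t j < \<sigma>" "\<sigma> \<le> u" "u \<le> t (Suc j)" "u \<le> \<tau>" for j u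
    proof -
      have "w u - w \<sigma> \<le> y u - y \<sigma>" using partial[of \<sigma> u] that by simp
      moreover have "\<bar>w u - w (t j)\<bar> \<le> \<delta>" "\<bar>w \<sigma> - w (t j)\<bar> \<le> \<delta>" using osc[of j] that by auto
      ultimately show ?thesis using from_upper[OF True] unfolding abs_le_iff by linarith
    qed
    have main: "c * (U upper - U (y (t j))) \<le> S j" if "j \<le> k" "\<sigma> \<le> t j" for j
      using that
    proof (induction j)
      case 0
      then show ?case using True t0 by simp
    next
      case (Suc j)
      have j: "j < K" using Suc.prems k by simp
      have tk: "t (Suc j) \<le> t k" unfolding t_def using Suc.prems(1) \<open>0 < h\<close> by (auto intro!: mult_right_mono)
      show ?case
      proof (cases "\<sigma> \<le> t j")
        case True
        then have "c * (U upper - U (y (t j))) \<le> S j" using Suc by simp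
        moreover have "c * (U (y (t j)) - U (y (t (Suc j)))) \<le> (w (t (Suc j)) - w (t j))\<^sup>2 / (2 * h)"
          using step[OF j True] tk k by simp
        ultimately show ?thesis unfolding SS by (simp add: algebra_simps)
      next
        case False
        then have "upper \<le> y (t (Suc j))" using crossing[OF j, of "t (Suc j)"] Suc.prems tk k by simp
        then have "U upper \<le> U (y (t (Suc j)))" using \<open>0 \<le> upper\<close> by (intro mono_onD[OF U(1)]) auto
        then have "c * (U upper - U (y (t (Suc j)))) \<le> 0" using U(3) by (simp add: mult_nonneg_nonpos)
        then show ?thesis using S_nonneg[of "Suc j"] by linarith
      qed
    qed
    have "\<sigma> \<le> t k"
    proof (rule ccontr)
      assume "\<not> \<sigma> \<le> t k"
      then have "upper \<le> y \<tau>" using crossing[of k \<tau>] k \<open>\<sigma> \<le> \<tau>\<close> by simp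
      then show False using \<open>y \<tau> + \<delta> \<le> lower\<close> \<open>lower < upper\<close> \<open>0 \<le> \<delta>\<close> by simp
    qed
    have "w \<tau> - w (t k) \<le> y \<tau> - y (t k)" using partial[OF \<open>\<sigma> \<le> t k\<close>] k by simp
    moreover have "\<bar>w \<tau> - w (t k)\<bar> \<le> \<delta>" using osc[of k \<tau>] k by simp
    ultimately have yk: "y (t k) \<le> lower" using \<open>y \<tau> + \<delta> \<le> lower\<close> by linarith
    have "U (y (t k)) \<le> U lower"
      using yk inside[of "t k"] \<open>\<sigma> \<le> t k\<close> k U(2) by (intro mono_onD[OF U(1)]) auto
    then have "c * (U upper - U lower) \<le> c * (U upper - U (y (t k)))" using U(3) by (intro mult_left_mono) auto
    also have "\<dots> \<le> S k" using main \<open>\<sigma> \<le> t k\<close> by simp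
    also have "\<dots> \<le> S K" using k by (intro S_mono) simp
    finally show ?thesis using A by simp
  next
    case False
    have main: "m\<^sup>2 / 2 * (real j * h) - m * (y (t j) - y a) \<le> S j" if "j \<le> k" for j
      using that
    proof (induction j)
      case 0
      then show ?case using t0 by (simp add: S_def)
    next
      case (Suc j)
      have tk: "t (Suc j) \<le> t k" unfolding t_def using Suc.prems(1) \<open>0 < h\<close> by (auto intro!: mult_right_mono)
      have "m\<^sup>2 / 2 * h - m * (y (t (Suc j)) - y (t j)) \<le> (w (t (Suc j)) - w (t j))\<^sup>2 / (2 * h)"
        using time_step[of j] Suc.prems k tk ta[of j] False by simp
      moreover have "m\<^sup>2 / 2 * (real j * h) - m * (y (t j) - y a) \<le> S j" using Suc by simp
      moreover have "m\<^sup>2 / 2 * (real (Suc j) * h) = m\<^sup>2 / 2 * (real j * h) + m\<^sup>2 / 2 * h" by (simp add: algebra_simps)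
      moreover have "m * (y (t (Suc j)) - y a) = m * (y (t (Suc j)) - y (t j)) + m * (y (t j) - y a)" by (simp add: algebra_simps)
      ultimately show ?case unfolding SS by linarith
    qed
    have "\<tau> - a - h \<le> real k * h" using k unfolding t_def by (simp add: algebra_simps)
    then have "m\<^sup>2 / 2 * (\<tau> - a - h) \<le> m\<^sup>2 / 2 * (real k * h)" by (intro mult_left_mono) auto
    moreover have "m * (y (t k) - y a) \<le> m * hi"
      using inside[of "t k"] inside[of a] ta[of k] k False \<open>a \<le> \<tau>\<close> drift_bounds(2) U(2) by (intro mult_left_mono) auto
    moreover have "S k \<le> S K" using k by (intro S_mono) simp
    ultimately show ?thesis using main[of k] A(2) by linarith
  qed
qed

end

section \<open>Elementary estimates with powers and logarithms\<close>

text \<open>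
  A quantitative form of the slow variation of a power with exponent in \<open>[-1, 1]\<close>, for either sign of
  the exponent.
\<close>

lemma powr_le_ratio:
  fixes x y g \<rho> :: real
  assumes "0 < x" "0 < y" "x \<le> \<rho> * y" "y \<le> \<rho> * x" "\<bar>g\<bar> \<le> 1" "1 \<le> \<rho>"
  shows "x powr g \<le> \<rho> * y powr g"
proof -
  have "(x / y) powr g \<le> \<rho> powr \<bar>g\<bar>"
  proof (cases "0 \<le> g")
    case True
    have "x / y \<le> \<rho>" using assms by (simp add: field_simps)
    then show ?thesis using True assms by (simp add: powr_mono2)
  next
    case False
    have "(x / y) powr g = (y / x) powr (- g)" using assms by (simp add: powr_divide powr_minus field_simps)
    moreover have "y / x \<le> \<rho>" using assms by (simp add: field_simps)
    ultimately show ?thesis using False assms by (simp add: powr_mono2)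
  qed
  also have "\<dots> \<le> \<rho> powr 1" using assms by (intro powr_mono) auto
  finally have "(x / y) powr g \<le> \<rho>" using assms by simp
  then show ?thesis using assms by (simp add: powr_divide field_simps)
qed

lemma powr_le_max_endpoints:
  fixes u v x g :: real
  assumes "0 < u" "u \<le> x" "x \<le> v"
  shows "x powr g \<le> max (u powr g) (v powr g)"
proof (cases "0 \<le> g")
  case True
  then have "x powr g \<le> v powr g" using assms by (intro powr_mono2) auto
  then show ?thesis by simp
next
  case False
  then have "x powr g \<le> u powr g" using assms by (intro powr_mono2') auto
  then show ?thesis by simp
qed

text \<open>
  Upper Riemann sums for the integral of \<open>v\<^bsup>g\<^esup>\<close> over \<open>[a, 1]\<close>, robust enough for
  \<open>descent_step\<close>: the weight \<open>m j\<close> bounds the integrand on a neighbourhood of \<open>k\<close> mesh widths around the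
  \<open>j\<close>-th point, and up to the factor \<open>4 / a\<close> on the whole interval.
\<close>

lemma riemann_levels:
  fixes a g k \<epsilon> :: real
  assumes "0 < a" "a < 1" "- 1 < g" "g < 1" "0 \<le> k" "0 < \<epsilon>"
  obtains N :: nat and m :: "nat \<Rightarrow> real" where "0 < N"
    "\<And>j. j < N \<Longrightarrow> 0 < m j"
    "\<And>j v. j < N \<Longrightarrow> a \<le> v \<Longrightarrow> v \<le> 1 \<Longrightarrow> \<bar>v - (1 - real j * ((1 - a) / N))\<bar> \<le> k * ((1 - a) / N) \<Longrightarrow> v powr g \<le> m j"
    "\<And>j v. j < N \<Longrightarrow> a \<le> v \<Longrightarrow> v \<le> 1 \<Longrightarrow> v powr g \<le> 4 / a * m j"
    "(\<Sum>j<N. (1 - a) / N * m j) \<le> (1 + \<epsilon>) * ((1 - a powr (1 + g)) / (1 + g))"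
proof -
  have "(\<lambda>N. (1 - a) / real N) \<longlonglongrightarrow> 0" by real_asymp
  moreover have "0 < min (a * \<epsilon> / (2 * (k + 1))) (a / (2 * (k + 1)))" using assms by simp
  ultimately have "\<forall>\<^sub>F N in sequentially. (1 - a) / real N < min (a * \<epsilon> / (2 * (k + 1))) (a / (2 * (k + 1)))"
    by (rule order_tendstoD)
  then have "\<forall>\<^sub>F N in sequentially. 0 < N \<and> (1 - a) / real N < a * \<epsilon> / (2 * (k + 1)) \<and> (1 - a) / real N < a / (2 * (k + 1))"
    using eventually_gt_at_top[of 0] by eventually_elim simp
  then obtain N :: nat where N: "0 < N" "(1 - a) / real N < a * \<epsilon> / (2 * (k + 1))" "(1 - a) / real N < a / (2 * (k + 1))"
    using eventually_happens'[OF sequentially_bot] by blast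
  define w where "w = (1 - a) / real N"
  have w: "0 < w" "real N * w = 1 - a" using N(1) assms unfolding w_def by auto
  have kw: "(k + 1) * w < a / 2" "(k + 1) * w < a * \<epsilon> / 2"
    using N(2,3) assms unfolding w_def[symmetric] by (simp_all add: field_simps)
  define z where "z j = 1 - real j * w" for j
  have z: "a + w \<le> z j" "z j \<le> 1" if "j < N" for j
  proof -
    have "real (Suc j) * w \<le> real N * w" using that w by (intro mult_right_mono) auto
    then show "a + w \<le> z j" using w unfolding z_def by (simp add: algebra_simps)
  qed (use w in \<open>simp add: z_def\<close>)
  have kw': "k * w < a / 2" using kw w by (simp add: algebra_simps)
  define m where "m j = max ((z j - k * w) powr g) ((z j + k * w) powr g)" for j
  have ends: "a / 2 < z j - k * w" "z j - k * w \<le> z j + k * w" "z j + k * w < 2" if "j < N" for j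
    using z[OF that] w kw' assms by auto
  have m_ge: "v powr g \<le> m j" if "j < N" "a \<le> v" "v \<le> 1" "\<bar>v - z j\<bar> \<le> k * w" for j v
    unfolding m_def using ends[OF that(1)] assms that(4)
    by (intro powr_le_max_endpoints) (auto simp: abs_le_iff)
  have m_le: "m j \<le> \<rho> * v powr g" if "j < N" "1 \<le> \<rho>" "0 < v"
    "v \<le> \<rho> * (z j - k * w)" "z j + k * w \<le> \<rho> * v" for j v \<rho>
  proof -
    have e: "0 < z j - k * w" "z j - k * w \<le> z j + k * w" using ends[OF that(1)] assms by auto
    have "\<rho> * (z j - k * w) \<le> \<rho> * (z j + k * w)" using e that by (intro mult_left_mono) auto
    then have "v \<le> \<rho> * (z j + k * w)" "z j - k * w \<le> \<rho> * v" using that e by linarith+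
    then show ?thesis unfolding m_def using that assms e
      by (intro max.boundedI powr_le_ratio) auto
  qed
  have crude: "v powr g \<le> 4 / a * m j" if "j < N" "a \<le> v" "v \<le> 1" for j v
  proof -
    have e: "a / 2 < z j + k * w" "z j + k * w < 2" using ends[OF that(1)] by auto
    have "v \<le> 4 / a * (a / 2)" using assms that by simp
    also have "\<dots> \<le> 4 / a * (z j + k * w)" using e assms by (intro mult_left_mono) auto
    finally have "v \<le> 4 / a * (z j + k * w)" .
    moreover have "z j + k * w \<le> 4 / a * v"
    proof -
      have "z j + k * w \<le> 4 / a * a" using e assms by simp
      also have "\<dots> \<le> 4 / a * v" using that assms by (intro mult_left_mono) auto
      finally show ?thesis .
    qed
    ultimately have "v powr g \<le> 4 / a * (z j + k * w) powr g"
      using assms that e by (intro powr_le_ratio) auto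
    also have "\<dots> \<le> 4 / a * m j" unfolding m_def using assms by (intro mult_left_mono) auto
    finally show ?thesis .
  qed
  have cell: "w * m j \<le> (1 + \<epsilon>) * ((z j powr (1 + g) - z (Suc j) powr (1 + g)) / (1 + g))" if j: "j < N" for j
  proof -
    have zs: "z (Suc j) = z j - w" unfolding z_def by (simp add: algebra_simps)
    have pos: "0 < z (Suc j)" using z[OF j] assms zs by simp
    have "\<exists>\<xi>. z (Suc j) < \<xi> \<and> \<xi> < z j \<and> z j powr (1 + g) - z (Suc j) powr (1 + g) = (z j - z (Suc j)) * ((1 + g) * \<xi> powr g)"
    proof (rule MVT2)
      show "z (Suc j) < z j" using zs w by simp
      fix u assume "z (Suc j) \<le> u" "u \<le> z j"
      then show "((\<lambda>u. u powr (1 + g)) has_real_derivative (1 + g) * u powr g) (at u)"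
        using pos by (auto intro!: derivative_eq_intros)
    qed
    then obtain \<xi> where \<xi>: "z (Suc j) < \<xi>" "\<xi> < z j"
      "z j powr (1 + g) - z (Suc j) powr (1 + g) = (z j - z (Suc j)) * ((1 + g) * \<xi> powr g)" by blast
    have xa: "a < \<xi>" using \<xi>(1) zs z[OF j] by simp
    have kwe: "(k + 1) * w \<le> \<epsilon> * (z j - k * w)"
    proof -
      have "(k + 1) * w \<le> \<epsilon> * (a / 2)" using kw(2) by (simp add: mult.commute)
      also have "\<dots> \<le> \<epsilon> * (z j - k * w)" using ends[OF j] assms by (intro mult_left_mono) auto
      finally show ?thesis .
    qed
    have kwe': "(k + 1) * w \<le> \<epsilon> * \<xi>"
    proof -
      have "(k + 1) * w \<le> \<epsilon> * (a / 2)" using kw(2) by (simp add: mult.commute)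
      also have "\<dots> \<le> \<epsilon> * \<xi>" using xa assms by (intro mult_left_mono) auto
      finally show ?thesis .
    qed
    have "m j \<le> (1 + \<epsilon>) * \<xi> powr g"
      using assms xa \<xi>(1,2) kwe kwe' zs w by (intro m_le[OF j]) (auto simp: algebra_simps)
    then have "w * m j \<le> w * ((1 + \<epsilon>) * \<xi> powr g)" using w by (intro mult_left_mono) auto
    also have "\<dots> = (1 + \<epsilon>) * ((z j powr (1 + g) - z (Suc j) powr (1 + g)) / (1 + g))"
    proof -
      have "z j - z (Suc j) = w" using zs by simp
      then show ?thesis unfolding \<xi>(3) using assms by simp
    qed
    finally show ?thesis .
  qed
  have "(\<Sum>j<N. w * m j) \<le> (\<Sum>j<N. (1 + \<epsilon>) * ((z j powr (1 + g) - z (Suc j) powr (1 + g)) / (1 + g)))"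
    using cell by (intro sum_mono) auto
  also have "\<dots> = (1 + \<epsilon>) * ((\<Sum>j<N. z j powr (1 + g) - z (Suc j) powr (1 + g)) / (1 + g))"
    by (simp add: sum_distrib_left sum_divide_distrib)
  also have "(\<Sum>j<N. z j powr (1 + g) - z (Suc j) powr (1 + g)) = z 0 powr (1 + g) - z N powr (1 + g)"
    by (rule sum_lessThan_telescope')
  also have "\<dots> = 1 - a powr (1 + g)" using w unfolding z_def by simp
  finally have total: "(\<Sum>j<N. w * m j) \<le> (1 + \<epsilon>) * ((1 - a powr (1 + g)) / (1 + g))" .
  show thesis
  proof (rule that[of N m])
    show "0 < m j" if "j < N" for j
      unfolding m_def using ends[OF that] assms by (simp add: less_max_iff_disj)
  qed (use N(1) m_ge crude total in \<open>auto simp: z_def w_def\<close>)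
qed

text \<open>
  The first term is the probability of a push with action \<open>q\<close>, and the second one bounds the
  probability that the path oscillates by \<open>3/2\<close> of the push, an event with action \<open>9/4 q\<close>. The
  second is negligible and the prefactor costs an arbitrarily small proportion of the exponent.
\<close>

lemma gaussian_push_exponent:
  fixes \<epsilon> :: real
  assumes "0 < \<epsilon>" "\<epsilon> < 1"
  shows "\<forall>\<^sub>F q in at_top. exp (- (1 + \<epsilon>) * q) \<le> exp (- (sqrt (2 * q) + 1)\<^sup>2 / 2) / sqrt (2 * pi) - 4 * exp (- (9 / 4) * q)"
proof -
  let ?A = "1 / 2 + ln (8 * sqrt (2 * pi))"
  have "\<forall>\<^sub>F q in at_top. ?A + sqrt (2 * q) \<le> \<epsilon> * q"
    using assms by real_asymp
  moreover have "\<forall>\<^sub>F q in at_top. ?A + sqrt (2 * q) \<le> 5 / 4 * q"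
    by real_asymp
  ultimately show ?thesis using eventually_ge_at_top[of 0]
  proof eventually_elim
    case (elim q)
    define P where "P = sqrt (2 * pi)"
    have P: "0 < P" unfolding P_def by simp
    define E where "E = exp (- (sqrt (2 * q) + 1)\<^sup>2 / 2)"
    have E: "E = exp (- q - sqrt (2 * q) - 1 / 2)"
      unfolding E_def using elim(3) by (intro arg_cong[of _ _ exp]) (simp add: power2_sum field_simps)
    have *: "exp (- r) \<le> E / (8 * P)" if "?A + sqrt (2 * q) \<le> r - q" for r
    proof -
      have "E / (8 * P) = exp (- q - sqrt (2 * q) - 1 / 2 - ln (8 * P))"
        unfolding E exp_diff using P by simp
      then show ?thesis using that unfolding P_def by simp
    qed
    have "exp (- ((1 + \<epsilon>) * q)) \<le> E / (8 * P)" using elim(1) by (intro *) (simp add: algebra_simps)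
    moreover have "exp (- (9 / 4 * q)) \<le> E / (8 * P)" using elim(2) by (intro *) simp
    moreover have "E / P = 8 * (E / (8 * P))" using P by simp
    moreover have "0 \<le> E / (8 * P)" using P unfolding E_def by simp
    ultimately have "exp (- ((1 + \<epsilon>) * q)) \<le> E / P - 4 * exp (- (9 / 4 * q))" by linarith
    then show ?case unfolding E_def P_def by (simp only: mult_minus_left)
  qed
qed

lemma polylog_le_power_gap:
  fixes C p q c e :: real
  assumes "1 < p" "0 < C" "0 < q" "0 < c" "0 < e"
  shows "\<forall>\<^sub>F n in sequentially. C * (c * (ln (real (Suc n) powr p)) powr q) powr e \<le> real (Suc n) powr p - real n powr p"
proof -
  have "\<forall>\<^sub>F n in at_top. C * (c * (p * ln (n + 1)) powr q) powr e \<le> (n + 1) powr p - n powr p"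
    using assms by real_asymp
  then have "\<forall>\<^sub>F n in sequentially. C * (c * (p * ln (real n + 1)) powr q) powr e \<le> (real n + 1) powr p - real n powr p"
    using filterlim_real_sequentially unfolding filterlim_iff by blast
  then show ?thesis by eventually_elim (simp add: ln_powr add.commute)
qed

lemma log_power_shift_le:
  fixes a a' c p q :: real
  assumes "a < a'" "0 < a" "0 < c" "0 < p" "0 < q"
  shows "\<forall>\<^sub>F n in sequentially. a * (c * (ln (real (Suc n) powr p)) powr q) \<le> a' * (c * (ln (real n powr p)) powr q)"
proof -
  have "\<forall>\<^sub>F n in at_top. a * (c * (p * ln (n + 1)) powr q) \<le> a' * (c * (p * ln n) powr q)"
    using assms by real_asymp
  then have "\<forall>\<^sub>F n in sequentially. a * (c * (p * ln (real n + 1)) powr q) \<le> a' * (c * (p * ln (real n)) powr q)"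
    using filterlim_real_sequentially unfolding filterlim_iff by blast
  then show ?thesis using eventually_gt_at_top[of 0] by eventually_elim (simp add: ln_powr add.commute)
qed

section \<open>Driving the Brownian path downwards\<close>

context brownian
begin

text \<open>
  The estimate is conditional on an event \<open>A\<close> of the past, as \<open>infinitely_often_if_conditionally_likely\<close>
  requires.
\<close>

lemma prob_pushes:
  fixes r h e :: "nat \<Rightarrow> real"
  defines "E \<equiv> \<lambda>N d. {\<omega>\<in>space M. \<forall>j<N. W (r (Suc j)) \<omega> - W (r j) \<omega> \<le> - 2 * d \<and> \<omega> \<notin> osc (r j) (h j) (3 * d)}"
  assumes "0 \<le> r 0" "0 \<le> d" and h: "\<And>j. j < N \<Longrightarrow> 0 < h j" and r: "\<And>j. r (Suc j) = r j + h j"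
    and e: "\<And>j. j < N \<Longrightarrow> 0 \<le> e j"
      "\<And>j. j < N \<Longrightarrow> e j \<le> exp (- (2 * d / sqrt (h j) + 1)\<^sup>2 / 2) / sqrt (2 * pi) - 4 * exp (- (3 * d)\<^sup>2 / (2 * h j))"
    and A: "A \<in> sets (F (r 0))"
  shows "E N d \<in> sets (F (r N)) \<and> prob A * (\<Prod>j<N. e j) \<le> prob (A \<inter> E N d)"
proof -
  have "0 \<le> r j \<and> r 0 \<le> r j \<and> E j d \<in> sets (F (r j)) \<and> prob A * (\<Prod>i<j. e i) \<le> prob (A \<inter> E j d)" if "j \<le> N" for j
    using that
  proof (induction j)
    case 0
    have "A \<inter> space M = A" using sets.sets_into_space[OF F_into_M[OF A]] by auto
    moreover have "space M \<in> sets (F (r 0))" using sets.top[of "F (r 0)"] by simp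
    ultimately show ?case using assms(2) unfolding E_def by simp
  next
    case (Suc j)
    have j: "j < N" "0 < h j" using Suc.prems h by auto
    have IH: "0 \<le> r j" "r 0 \<le> r j" "E j d \<in> sets (F (r j))" "prob A * (\<Prod>i<j. e i) \<le> prob (A \<inter> E j d)"
      using Suc by auto
    let ?P = "{\<omega>\<in>space M. W (r (Suc j)) \<omega> - W (r j) \<omega> \<in> {..- (2 * d)}}"
    let ?O = "osc (r j) (h j) (3 * d)"
    have P: "?P \<in> sets (F (r (Suc j)))" using j IH r by (intro increment_event) auto
    have O: "?O \<in> sets (F (r (Suc j)))" using j IH r by (intro osc_sets) auto
    have Ej: "E j d \<in> sets (F (r (Suc j)))" using F_mono[OF IH(3)] j r by auto
    have split: "E (Suc j) d = E j d \<inter> ?P - ?O" unfolding E_def by (auto simp: less_Suc_eq)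
    have ES: "E (Suc j) d \<in> sets (F (r (Suc j)))" unfolding split using P O Ej by (intro sets.Diff sets.Int)
    have AE: "A \<inter> E j d \<in> sets (F (r j))" using F_mono[OF A IH(2)] IH(3) by (intro sets.Int)
    have AM: "A \<in> sets M" using A by (rule F_into_M)
    have s1: "e j * prob (A \<inter> E j d) \<le> (exp (- (2 * d / sqrt (h j) + 1)\<^sup>2 / 2) / sqrt (2 * pi)) * prob (A \<inter> E j d)
        - 4 * exp (- (3 * d)\<^sup>2 / (2 * h j)) * prob (A \<inter> E j d)"
      using mult_right_mono[OF e(2)[OF j(1)], of "prob (A \<inter> E j d)"] by (simp add: left_diff_distrib)
    have s2: "(exp (- (2 * d / sqrt (h j) + 1)\<^sup>2 / 2) / sqrt (2 * pi)) * prob (A \<inter> E j d) \<le> prob (A \<inter> E j d \<inter> ?P)"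
    proof -
      have "prob (A \<inter> E j d \<inter> ?P) = prob (A \<inter> E j d) * measure (gauss (r (Suc j) - r j)) {..- (2 * d)}"
        using IH(1) j r AE by (intro prob_increment) auto
      moreover have "exp (- (2 * d / sqrt (h j) + 1)\<^sup>2 / 2) / sqrt (2 * pi) \<le> measure (gauss (r (Suc j) - r j)) {..- (2 * d)}"
        using gauss_lower_tail[of "2 * d" "h j"] assms(3) j r by simp
      ultimately show ?thesis by (simp only: mult.commute[of _ "prob (A \<inter> E j d)"] mult_left_mono measure_nonneg)
    qed
    have s3: "prob (A \<inter> E j d \<inter> ?O) \<le> 4 * exp (- (3 * d)\<^sup>2 / (2 * h j)) * prob (A \<inter> E j d)"
      using IH(1) j assms(3) AE by (intro prob_osc) auto
    have s4: "prob (A \<inter> E j d \<inter> ?P) - prob (A \<inter> E j d \<inter> ?O) \<le> prob (A \<inter> E (Suc j) d)"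
    proof -
      have M: "A \<inter> E j d \<inter> ?P \<in> sets M" "A \<inter> E j d \<inter> ?O \<in> sets M" "A \<inter> E (Suc j) d \<in> sets M"
        using AM F_into_M[OF IH(3)] F_into_M[OF P] F_into_M[OF O] F_into_M[OF ES] by auto
      have "A \<inter> E j d \<inter> ?P \<subseteq> (A \<inter> E (Suc j) d) \<union> (A \<inter> E j d \<inter> ?O)" unfolding split by blast
      then have "prob (A \<inter> E j d \<inter> ?P) \<le> prob ((A \<inter> E (Suc j) d) \<union> (A \<inter> E j d \<inter> ?O))"
        using M by (intro finite_measure_mono) auto
      also have "\<dots> \<le> prob (A \<inter> E (Suc j) d) + prob (A \<inter> E j d \<inter> ?O)"
        using M by (intro measure_Un_le) auto
      finally show ?thesis by simp
    qed
    have "e j * prob (A \<inter> E j d) \<le> prob (A \<inter> E (Suc j) d)" using s1 s2 s3 s4 by linarith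
    moreover have "e j * (prob A * (\<Prod>i<j. e i)) \<le> e j * prob (A \<inter> E j d)"
      using IH(4) e(1)[OF j(1)] by (rule mult_left_mono)
    ultimately have "prob A * (\<Prod>i<Suc j. e i) \<le> prob (A \<inter> E (Suc j) d)"
      by (simp add: mult_ac)
    then show ?case using IH ES j r by simp
  qed
  then show ?thesis by simp
qed

end

section \<open>Reflected diffusions below a logarithmic boundary\<close>

locale reflected_bm = brownian M F W
  for M :: "'a measure" and F :: "real \<Rightarrow> 'a measure" and W :: "real \<Rightarrow> 'a \<Rightarrow> real" +
  fixes f B :: "real \<Rightarrow> real" and \<gamma> b c s x :: real and L1 Lf X :: "real \<Rightarrow> 'a \<Rightarrow> real"
  assumes gamma: "-1 < \<gamma>" "\<gamma> < 1" and b_pos: "0 < b" and c_pos: "0 < c" and s_nonneg: "0 \<le> s"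
    and f_mono: "mono_on {0..} f" and f_cont: "continuous_on {0..} f"
    and B_measurable: "B \<in> borel_measurable (restrict_space borel {1..})"
    and B_bounded: "locally_bounded_on {1..} B"
    and B_power: "eventually (\<lambda>y. B y = b * y powr \<gamma>) at_top"
    and f_log: "eventually (\<lambda>t. f t = c * (ln t) powr (1 / (1 + \<gamma>))) at_top"
    and diffusion: "AE \<omega> in M.
        continuous_on {s..} (\<lambda>t. X t \<omega>) \<and>
        (\<forall>t\<ge>s. X t \<omega> \<in> {1..f t}) \<and>
        boundary_local_time s (\<lambda>_. 1) (\<lambda>t. X t \<omega>) (\<lambda>t. L1 t \<omega>) \<and>
        boundary_local_time s f (\<lambda>t. X t \<omega>) (\<lambda>t. Lf t \<omega>) \<and>
        (\<forall>t\<ge>s. X t \<omega> =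
           x + W t \<omega> - W s \<omega> + (LINT u:{s..t}|lborel. B (X u \<omega>)) + L1 t \<omega> - Lf t \<omega>)"
begin

lemma AE_reflected_path:
  "AE \<omega> in M. \<omega> \<in> space M \<and> reflected_path B f s x (\<lambda>t. W t \<omega>) (\<lambda>t. X t \<omega>) (\<lambda>t. L1 t \<omega>) (\<lambda>t. Lf t \<omega>)
     \<and> continuous_on {0..} (\<lambda>t. W t \<omega>)"
proof -
  have "AE \<omega> in M. continuous_on {0..} (\<lambda>t. W t \<omega>)" using brownian unfolding brownian_motion_def by blast
  with diffusion AE_space show ?thesis
  proof eventually_elim
    case (elim \<omega>)
    then have "reflected_path B f s x (\<lambda>t. W t \<omega>) (\<lambda>t. X t \<omega>) (\<lambda>t. L1 t \<omega>) (\<lambda>t. Lf t \<omega>)"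
      using s_nonneg f_mono B_measurable B_bounded by unfold_locales blast+
    then show ?case using elim by blast
  qed
qed

text \<open>
  The potential \<open>2 b / (1 + \<gamma>) v\<^bsup>1+\<gamma>\<^esup>\<close> at \<open>v = f t\<close> is \<open>Q ln t\<close>.
\<close>

definition Q :: real where "Q = 2 * b * c powr (1 + \<gamma>) / (1 + \<gamma>)"

lemma Q_pos: "0 < Q" unfolding Q_def using b_pos c_pos gamma by simp

lemma B_power_from:
  obtains x0 where "1 < x0" "\<And>v. x0 \<le> v \<Longrightarrow> B v = b * v powr \<gamma>"
proof -
  obtain x1 where "\<And>v. x1 \<le> v \<Longrightarrow> B v = b * v powr \<gamma>" using B_power unfolding eventually_at_top_linorder by blast
  then show thesis using that[of "max x1 2"] by auto
qed

lemma f_powr: "eventually (\<lambda>t. f t powr (1 + \<gamma>) = c powr (1 + \<gamma>) * ln t) at_top"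
  using f_log eventually_gt_at_top[of 1]
proof eventually_elim
  case (elim t)
  have "f t powr (1 + \<gamma>) = c powr (1 + \<gamma>) * ((ln t) powr (1 / (1 + \<gamma>))) powr (1 + \<gamma>)"
    unfolding elim(1) by (rule powr_mult)
  also have "((ln t) powr (1 / (1 + \<gamma>))) powr (1 + \<gamma>) = ln t"
    using gamma elim(2) by (simp add: powr_powr)
  finally show ?case .
qed

lemma f_at_top: "filterlim f at_top at_top"
proof (subst filterlim_cong[OF refl refl f_log])
  have "0 < 1 / (1 + \<gamma>)" using gamma by simp
  then show "filterlim (\<lambda>t. c * ln t powr (1 / (1 + \<gamma>))) at_top at_top" using c_pos by real_asymp
qed

end

section \<open>Subcritical levels are reached infinitely often\<close>

context reflected_bm
begin

text \<open>
  All lengths are scaled by \<open>R\<close>. The duration \<open>h j\<close> of the \<open>j\<close>-th push is the time in which the drift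
  near the \<open>j\<close>-th level moves the path by one level distance, so a push moving \<open>W\<close> by two level distances
  realizes the optimal speed \<open>- B\<close>.
\<close>

lemma forced_descent:
  fixes m h r :: "nat \<Rightarrow> real" and N :: nat and a R \<omega>0 :: real
  defines "\<omega>0 \<equiv> (1 - a) / real N"
  assumes path: "reflected_path B f s x w y l1 lf"
    and a: "0 < a" "a < 1" and N: "0 < N" and R: "0 < R"
    and m: "\<And>j. j < N \<Longrightarrow> 0 < m j"
      "\<And>j v. j < N \<Longrightarrow> a \<le> v \<Longrightarrow> v \<le> 1 \<Longrightarrow> \<bar>v - (1 - real j * \<omega>0)\<bar> \<le> (4 / a + 7) * \<omega>0 \<Longrightarrow> v powr \<gamma> \<le> m j"
      "\<And>j v. j < N \<Longrightarrow> a \<le> v \<Longrightarrow> v \<le> 1 \<Longrightarrow> v powr \<gamma> \<le> 4 / a * m j"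
    and B: "\<And>v. a * R \<le> v \<Longrightarrow> B v = b * v powr \<gamma>" and "1 \<le> a * R"
    and h: "\<And>j. j < N \<Longrightarrow> h j = \<omega>0 * R powr (1 - \<gamma>) / (b * m j)"
    and r: "\<And>j. r (Suc j) = r j + h j" "s \<le> r 0" "r N \<le> T" "f T \<le> R"
    and push: "\<And>j. j < N \<Longrightarrow> w (r (Suc j)) - w (r j) \<le> - 2 * (\<omega>0 * R)"
    and osc: "\<And>j u. j < N \<Longrightarrow> r j \<le> u \<Longrightarrow> u \<le> r (Suc j) \<Longrightarrow> \<bar>w u - w (r j)\<bar> \<le> 3 * (\<omega>0 * R)"
  obtains u where "r 0 \<le> u" "u \<le> r N" "y u \<le> a * R"
proof -
  interpret P: reflected_path B f s x w y l1 lf by (rule path)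
  have w0: "0 < \<omega>0" "real N * \<omega>0 = 1 - a" unfolding \<omega>0_def using a N by auto
  have hpos: "0 < h j" if "j < N" for j using h[OF that] m(1)[OF that] w0 R b_pos by simp
  have rmono: "r i \<le> r j" if "i \<le> j" "j \<le> N" for i j
    using that(1,2)
  proof (induction rule: dec_induct)
    case (step k)
    then show ?case using hpos[of k] r(1)[of k] by simp
  qed simp
  show thesis
  proof (rule ccontr)
    assume "\<not> thesis"
    then have high: "a * R < y u" if "r 0 \<le> u" "u \<le> r N" for u
      using that \<open>\<And>u. r 0 \<le> u \<Longrightarrow> u \<le> r N \<Longrightarrow> y u \<le> a * R \<Longrightarrow> thesis\<close> by (meson not_le)
    have top: "y u \<le> R" if "r 0 \<le> u" "u \<le> r N" for u
    proof -
      have "f u \<le> f T" using that r P.s_nonneg by (intro mono_onD[OF f_mono]) auto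
      then show ?thesis using P.y_in[of u] that r by auto
    qed
    have "y (r j) \<le> (1 - real j * \<omega>0) * R" if "j \<le> N" for j
      using that
    proof (induction j)
      case 0
      then show ?case using top[of "r 0"] rmono[of 0 N] by simp
    next
      case (Suc j)
      then have j: "j < N" by simp
      have in_range: "r 0 \<le> u \<and> u \<le> r N" if "r j \<le> u" "u \<le> r (Suc j)" for u
        using that rmono[of 0 j] rmono[of "Suc j" N] j by auto
      let ?Mm = "b * m j * R powr \<gamma>"
      have v: "a \<le> y u / R" "y u / R \<le> 1" "B (y u) = b * R powr \<gamma> * (y u / R) powr \<gamma>" if "r j \<le> u" "u \<le> r (Suc j)" for u
      proof -
        have hu: "a * R < y u" "y u \<le> R" using in_range[OF that] high top by auto
        then show "a \<le> y u / R" "y u / R \<le> 1" using R by (auto simp: field_simps)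
        have "B (y u) = b * (R * (y u / R)) powr \<gamma>" using B[of "y u"] hu R by simp
        also have "\<dots> = b * R powr \<gamma> * (y u / R) powr \<gamma>" by (simp only: powr_mult mult.assoc)
        finally show "B (y u) = b * R powr \<gamma> * (y u / R) powr \<gamma>" .
      qed
      have Mh: "?Mm * h j = \<omega>0 * R"
      proof -
        have "?Mm * h j = \<omega>0 * (R powr \<gamma> * R powr (1 - \<gamma>))"
          using h[OF j] b_pos m(1)[OF j] by (simp add: field_simps)
        also have "R powr \<gamma> * R powr (1 - \<gamma>) = R" using R by (simp add: powr_add[symmetric])
        finally show ?thesis .
      qed
      have "y (r (Suc j)) \<le> (1 - real j * \<omega>0) * R - \<omega>0 * R"
      proof (rule P.descent_step[where p = "r j" and k = "4 / a" and ?M1.0 = "4 / a * ?Mm" and M = ?Mm])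
        show "s \<le> r j" using rmono[of 0 j] r(2) j by simp
        show "r j \<le> r (Suc j)" using rmono[of j "Suc j"] j by simp
        show "y (r j) \<le> (1 - real j * \<omega>0) * R" using Suc by simp
        show "0 \<le> \<omega>0 * R" "0 \<le> 4 / a" using w0 R a by auto
        show "0 \<le> 4 / a * ?Mm" using a b_pos m(1)[OF j] by simp
        show "4 / a * ?Mm * (r (Suc j) - r j) \<le> 4 / a * (\<omega>0 * R)"
        proof -
          have "4 / a * ?Mm * (r (Suc j) - r j) = 4 / a * (?Mm * h j)" using r(1) by (simp only: mult.assoc) simp
          also have "\<dots> = 4 / a * (\<omega>0 * R)" unfolding Mh ..
          finally show ?thesis by (rule eq_refl)
        qed
        show "?Mm * (r (Suc j) - r j) \<le> \<omega>0 * R" using Mh r(1) by simp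
        show "w (r (Suc j)) - w (r j) \<le> - 2 * (\<omega>0 * R)" by (rule push[OF j])
      next
        fix u assume u: "r j \<le> u" "u \<le> r (Suc j)"
        show "1 < y u" using high[of u] in_range[OF u] \<open>1 \<le> a * R\<close> by simp
        show "\<bar>w u - w (r j)\<bar> \<le> 3 * (\<omega>0 * R)" by (rule osc[OF j u])
        have "b * R powr \<gamma> * (y u / R) powr \<gamma> \<le> b * R powr \<gamma> * (4 / a * m j)"
          using m(3)[OF j v(1,2)[OF u]] b_pos by (intro mult_left_mono) auto
        then show "B (y u) \<le> 4 / a * ?Mm" unfolding v(3)[OF u] by (simp add: mult_ac)
      next
        fix u assume u: "r j \<le> u" "u \<le> r (Suc j)"
          and near: "\<bar>y u - (1 - real j * \<omega>0) * R\<bar> \<le> (4 / a + 7) * (\<omega>0 * R)"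
        have "y u / R - (1 - real j * \<omega>0) = (y u - (1 - real j * \<omega>0) * R) / R"
          using R by (simp add: field_simps)
        then have "\<bar>y u / R - (1 - real j * \<omega>0)\<bar> = \<bar>y u - (1 - real j * \<omega>0) * R\<bar> / R" using R by simp
        also have "\<dots> \<le> (4 / a + 7) * \<omega>0" using near R by (simp add: pos_divide_le_eq mult_ac)
        finally have "b * R powr \<gamma> * (y u / R) powr \<gamma> \<le> b * R powr \<gamma> * m j"
          using m(2)[OF j v(1,2)[OF u]] b_pos by (intro mult_left_mono) auto
        then show "B (y u) \<le> ?Mm" unfolding v(3)[OF u] by (simp add: mult_ac)
      qed
      then show ?case by (simp add: algebra_simps)
    qed
    from this[of N] have "y (r N) \<le> a * R" using w0 by simp
    then show False using high[of "r N"] rmono[of 0 N] by simp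
  qed
qed

lemma not_summable_inverse_Suc: "\<not> summable (\<lambda>n. 1 / real (Suc n))"
  using not_summable_harmonic[where 'a=real] summable_Suc_iff[of "\<lambda>n. 1 / real n"]
  by (simp only: inverse_eq_divide not_False_eq_True)

text \<open>
  In the window before time \<open>t\<close> the pushes of \<open>forced_descent\<close> have total action close to
  \<open>Q (1 - a\<^bsup>1+\<gamma>\<^esup>) ln t\<close>, so they occur with a probability of at least \<open>t\<^bsup>-\<theta>\<^esup>\<close> for some \<open>\<theta> < 1\<close>, whatever
  happened before. Along the times \<open>n\<^bsup>1/\<theta>\<^esup>\<close> these bounds are \<open>1 / n\<close>, with divergent sum, while the
  gaps grow like a power of \<open>n\<close> and leave room for windows of polylogarithmic length.
\<close>

lemma frequently_below_level:
  assumes a: "0 < a" "a < a'" "a < 1" and subcritical: "Q * (1 - a powr (1 + \<gamma>)) < 1"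
  shows "AE \<omega> in M. \<exists>\<^sub>F t in at_top. X t \<omega> \<le> a' * f t"
proof -
  define q0 where "q0 = Q * (1 - a powr (1 + \<gamma>))"
  have "a powr (1 + \<gamma>) < 1 powr (1 + \<gamma>)" using a gamma by (intro powr_less_mono2) auto
  then have q0: "0 < q0" "q0 < 1" unfolding q0_def using Q_pos subcritical by auto
  define \<theta> where "\<theta> = (1 + q0) / 2"
  have \<theta>: "q0 < \<theta>" "0 < \<theta>" "\<theta> < 1" unfolding \<theta>_def using q0 by auto
  define p where "p = 1 / \<theta>"
  have p: "1 < p" "0 < p" "p * \<theta> = 1" unfolding p_def using \<theta> by auto
  (* One factor 1 + \<epsilon> is lost to the Riemann sum, another one to the Gaussian prefactors. *)
  define \<epsilon> where "\<epsilon> = min (1 / 2) ((\<theta> / q0 - 1) / 3)"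
  have \<epsilon>: "0 < \<epsilon>" "\<epsilon> < 1" "(1 + \<epsilon>)\<^sup>2 * q0 \<le> \<theta>"
  proof -
    show e0: "0 < \<epsilon>" "\<epsilon> < 1" unfolding \<epsilon>_def using \<theta> q0 by auto
    have "(1 + \<epsilon>)\<^sup>2 = 1 + 2 * \<epsilon> + \<epsilon> * \<epsilon>" by (simp add: power2_eq_square algebra_simps)
    also have "\<epsilon> * \<epsilon> \<le> \<epsilon> * 1" using e0 by (intro mult_left_mono) auto
    also have "1 + 2 * \<epsilon> + \<epsilon> * 1 \<le> \<theta> / q0" unfolding \<epsilon>_def by (simp add: min_def field_simps)
    finally show "(1 + \<epsilon>)\<^sup>2 * q0 \<le> \<theta>" using q0 by (simp add: pos_le_divide_eq)
  qed
  obtain x0 where x0: "1 < x0" "\<And>v. x0 \<le> v \<Longrightarrow> B v = b * v powr \<gamma>" using B_power_from by blast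
  have "0 \<le> 4 / a + 7" using a by simp
  from riemann_levels[OF a(1,3) gamma this \<epsilon>(1)]
  obtain N :: nat and m :: "nat \<Rightarrow> real" where N: "0 < N" and mpos: "\<And>j. j < N \<Longrightarrow> 0 < m j"
    and m_near: "\<And>j v. j < N \<Longrightarrow> a \<le> v \<Longrightarrow> v \<le> 1 \<Longrightarrow> \<bar>v - (1 - real j * ((1 - a) / N))\<bar> \<le> (4 / a + 7) * ((1 - a) / N) \<Longrightarrow> v powr \<gamma> \<le> m j"
    and m_crude: "\<And>j v. j < N \<Longrightarrow> a \<le> v \<Longrightarrow> v \<le> 1 \<Longrightarrow> v powr \<gamma> \<le> 4 / a * m j"
    and m_sum: "(\<Sum>j<N. (1 - a) / N * m j) \<le> (1 + \<epsilon>) * ((1 - a powr (1 + \<gamma>)) / (1 + \<gamma>))"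
    by blast
  define \<omega>0 where "\<omega>0 = (1 - a) / real N"
  have w0: "0 < \<omega>0" unfolding \<omega>0_def using a N by simp
  (* The exponent 1 / \<theta> turns the bound t powr (- \<theta>) into 1 / n. *)
  define t where "t n = real n powr p" for n :: nat
  have t_mono: "t n \<le> t (Suc n)" for n unfolding t_def using p by (intro powr_mono2) auto
  have t_nonneg: "0 \<le> t n" for n unfolding t_def by simp
  have t_top: "filterlim t at_top sequentially" unfolding t_def using p by real_asymp
  then have tS_top: "filterlim (\<lambda>n. t (Suc n)) at_top sequentially" by (rule filterlim_compose) (rule filterlim_Suc)
  define R where "R n = f (t (Suc n))" for n
  have R_top: "filterlim R at_top sequentially" unfolding R_def by (rule filterlim_compose[OF f_at_top tS_top])
  define h where "h n j = \<omega>0 * R n powr (1 - \<gamma>) / (b * m j)" for n j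
  define r where "r n j = t n + (\<Sum>i<j. h n i)" for n j
  have r: "r n 0 = t n" "r n (Suc j) = r n j + h n j" for n j unfolding r_def by simp_all
  define E where "E n = {\<omega>\<in>space M. \<forall>j<N. W (r n (Suc j)) \<omega> - W (r n j) \<omega> \<le> - 2 * (\<omega>0 * R n) \<and> \<omega> \<notin> osc (r n j) (h n j) (3 * (\<omega>0 * R n))}" for n
  define q where "q n j = 2 * b * m j * \<omega>0 * R n powr (1 + \<gamma>)" for n j
  have "\<forall>\<^sub>F n in sequentially. \<forall>j\<in>{..<N}. exp (- (1 + \<epsilon>) * q n j) \<le> exp (- (sqrt (2 * q n j) + 1)\<^sup>2 / 2) / sqrt (2 * pi) - 4 * exp (- (9 / 4) * q n j)"
  proof (intro eventually_ball_finite ballI)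
    fix j assume j: "j \<in> {..<N}"
    have "filterlim (\<lambda>z. 2 * b * m j * \<omega>0 * z powr (1 + \<gamma>)) at_top at_top"
    proof -
      have "0 < 2 * b * m j * \<omega>0" "0 < 1 + \<gamma>" using b_pos mpos j w0 gamma by auto
      then show ?thesis by real_asymp
    qed
    then have "filterlim (\<lambda>n. q n j) at_top sequentially" unfolding q_def by (rule filterlim_compose[OF _ R_top])
    then show "\<forall>\<^sub>F n in sequentially. exp (- (1 + \<epsilon>) * q n j) \<le> exp (- (sqrt (2 * q n j) + 1)\<^sup>2 / 2) / sqrt (2 * pi) - 4 * exp (- (9 / 4) * q n j)"
      using gaussian_push_exponent[OF \<epsilon>(1,2)] unfolding filterlim_iff by blast
  qed simp
  moreover have "\<forall>\<^sub>F n in sequentially. R n = c * (ln (t (Suc n))) powr (1 / (1 + \<gamma>))"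
    unfolding R_def using f_log tS_top unfolding filterlim_iff by blast
  moreover have "\<forall>\<^sub>F n in sequentially. R n powr (1 + \<gamma>) = c powr (1 + \<gamma>) * ln (t (Suc n))"
    unfolding R_def using f_powr tS_top unfolding filterlim_iff by blast
  moreover have "\<forall>\<^sub>F n in sequentially. f (t n) = c * (ln (t n)) powr (1 / (1 + \<gamma>))"
    using f_log t_top unfolding filterlim_iff by blast
  moreover have "\<forall>\<^sub>F n in sequentially. a * (c * (ln (real (Suc n) powr p)) powr (1 / (1 + \<gamma>))) \<le> a' * (c * (ln (real n powr p)) powr (1 / (1 + \<gamma>)))"
    using a p c_pos gamma by (intro log_power_shift_le) auto
  moreover have "\<forall>\<^sub>F n in sequentially. (\<Sum>j<N. \<omega>0 / (b * m j)) * (c * (ln (real (Suc n) powr p)) powr (1 / (1 + \<gamma>))) powr (1 - \<gamma>) \<le> real (Suc n) powr p - real n powr p"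
  proof (rule polylog_le_power_gap)
    show "0 < (\<Sum>j<N. \<omega>0 / (b * m j))" using N w0 b_pos mpos by (intro sum_pos) auto
  qed (use p c_pos gamma in auto)
  moreover have "\<forall>\<^sub>F n in sequentially. x0 / a \<le> R n" using R_top unfolding filterlim_at_top by blast
  moreover have "\<forall>\<^sub>F n in sequentially. max s 1 \<le> t n" using t_top unfolding filterlim_at_top by blast
  moreover have "\<forall>\<^sub>F n in sequentially. 0 < (n::nat)" by (rule eventually_gt_at_top)
  ultimately have "\<forall>\<^sub>F n in sequentially.
      (\<forall>j<N. exp (- (1 + \<epsilon>) * q n j) \<le> exp (- (sqrt (2 * q n j) + 1)\<^sup>2 / 2) / sqrt (2 * pi) - 4 * exp (- (9 / 4) * q n j))
      \<and> R n powr (1 + \<gamma>) = c powr (1 + \<gamma>) * ln (t (Suc n)) \<and> a * R n \<le> a' * f (t n)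
      \<and> r n N \<le> t (Suc n) \<and> x0 \<le> a * R n \<and> 0 < R n \<and> s \<le> t n"
  proof eventually_elim
    case (elim n)
    have "(\<Sum>j<N. h n j) = (\<Sum>j<N. \<omega>0 / (b * m j)) * R n powr (1 - \<gamma>)"
      unfolding h_def sum_distrib_right by (intro sum.cong) auto
    then have "r n N \<le> t (Suc n)" using elim(2,6) unfolding r_def t_def by simp
    moreover have "0 < x0 / a" "x0 \<le> a * R n" using elim(7) x0 a by (auto simp: field_simps)
    moreover have "a * R n \<le> a' * f (t n)" using elim(2,4,5) unfolding t_def by simp
    ultimately show ?case using elim by auto
  qed
  then obtain n0 where n0: "\<And>n. n0 \<le> n \<Longrightarrow>
      (\<forall>j<N. exp (- (1 + \<epsilon>) * q n j) \<le> exp (- (sqrt (2 * q n j) + 1)\<^sup>2 / 2) / sqrt (2 * pi) - 4 * exp (- (9 / 4) * q n j))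
      \<and> R n powr (1 + \<gamma>) = c powr (1 + \<gamma>) * ln (t (Suc n)) \<and> a * R n \<le> a' * f (t n)
      \<and> r n N \<le> t (Suc n) \<and> x0 \<le> a * R n \<and> 0 < R n \<and> s \<le> t n"
    unfolding eventually_sequentially by blast
  have hpos: "0 < h n j" if "n0 \<le> n" "j < N" for n j
    using n0[OF that(1)] mpos[OF that(2)] w0 b_pos unfolding h_def by simp
  have likely: "E n \<in> sets (F (t (Suc n))) \<and> 1 / real (Suc n) * prob A \<le> prob (A \<inter> E n)"
    if n: "n0 \<le> n" and A: "A \<in> sets (F (t n))" for n A
  proof -
    note N0 = n0[OF n]
    have sq: "(2 * (\<omega>0 * R n))\<^sup>2 / h n j = 2 * q n j" if "j < N" for j
    proof -
      have "R n powr (1 - \<gamma>) * R n powr (1 + \<gamma>) = (R n)\<^sup>2"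
      proof -
        have "0 < R n" using N0 by blast
        then show ?thesis by (simp add: powr_add[symmetric] powr_numeral)
      qed
      then have "(2 * (\<omega>0 * R n))\<^sup>2 = 4 * \<omega>0\<^sup>2 * (R n powr (1 - \<gamma>) * R n powr (1 + \<gamma>))"
        by (simp add: power_mult_distrib)
      then show ?thesis using N0 w0 b_pos mpos[OF that] unfolding h_def q_def
        by (simp add: field_simps power2_eq_square)
    qed
    have base: "E n \<in> sets (F (r n N)) \<and> prob A * (\<Prod>j<N. exp (- (1 + \<epsilon>) * q n j)) \<le> prob (A \<inter> E n)"
      unfolding E_def
    proof (rule prob_pushes)
      show "0 \<le> r n 0" using r(1) t_nonneg by simp
      show "0 \<le> \<omega>0 * R n" using w0 N0 by simp
      show "A \<in> sets (F (r n 0))" using A r(1) by simp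
      fix j assume j: "j < N"
      have "2 * (\<omega>0 * R n) / sqrt (h n j) = sqrt ((2 * (\<omega>0 * R n))\<^sup>2 / h n j)"
      proof -
        have "0 \<le> 2 * (\<omega>0 * R n)" using w0 N0 by simp
        then show ?thesis by (simp only: real_sqrt_divide real_sqrt_abs abs_of_nonneg)
      qed
      then have e1: "2 * (\<omega>0 * R n) / sqrt (h n j) = sqrt (2 * q n j)" unfolding sq[OF j] .
      have "- (3 * (\<omega>0 * R n))\<^sup>2 / (2 * h n j) = - (9 / 8) * ((2 * (\<omega>0 * R n))\<^sup>2 / h n j)"
        by (simp add: power_mult_distrib)
      then have e2: "- (3 * (\<omega>0 * R n))\<^sup>2 / (2 * h n j) = - (9 / 4) * q n j" unfolding sq[OF j] by simp
      show "exp (- (1 + \<epsilon>) * q n j) \<le> exp (- (2 * (\<omega>0 * R n) / sqrt (h n j) + 1)\<^sup>2 / 2) / sqrt (2 * pi)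
          - 4 * exp (- (3 * (\<omega>0 * R n))\<^sup>2 / (2 * h n j))"
        unfolding e1 e2 using N0 j by blast
    qed (use hpos[OF n] r in auto)
    have lower: "1 / real (Suc n) \<le> (\<Prod>j<N. exp (- (1 + \<epsilon>) * q n j))"
    proof -
      have lnt: "ln (t (Suc n)) = p * ln (real (Suc n))" unfolding t_def by (simp add: ln_powr)
      have "(\<Sum>j<N. q n j) = 2 * b * R n powr (1 + \<gamma>) * (\<Sum>j<N. (1 - a) / N * m j)"
        unfolding q_def sum_distrib_left \<omega>0_def by (intro sum.cong) auto
      also have "\<dots> \<le> 2 * b * R n powr (1 + \<gamma>) * ((1 + \<epsilon>) * ((1 - a powr (1 + \<gamma>)) / (1 + \<gamma>)))"
        using m_sum b_pos by (intro mult_left_mono) auto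
      also have "\<dots> = (1 + \<epsilon>) * q0 * (p * ln (real (Suc n)))"
        using N0 lnt unfolding q0_def Q_def by simp
      finally have "(1 + \<epsilon>) * (\<Sum>j<N. q n j) \<le> (1 + \<epsilon>) * ((1 + \<epsilon>) * q0 * (p * ln (real (Suc n))))"
        using \<epsilon> by (intro mult_left_mono) auto
      also have "\<dots> = ((1 + \<epsilon>)\<^sup>2 * q0) * (p * ln (real (Suc n)))" by (simp add: power2_eq_square mult_ac)
      also have "\<dots> \<le> \<theta> * (p * ln (real (Suc n)))" using \<epsilon>(3) p by (intro mult_right_mono) auto
      also have "\<dots> = ln (real (Suc n))" using p(3) by (simp add: mult.assoc[symmetric] mult.commute)
      finally have "exp (- ln (real (Suc n))) \<le> exp (- ((1 + \<epsilon>) * (\<Sum>j<N. q n j)))" by simp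
      moreover have "(\<Prod>j<N. exp (- (1 + \<epsilon>) * q n j)) = exp (- ((1 + \<epsilon>) * (\<Sum>j<N. q n j)))"
        by (simp add: exp_sum[symmetric] sum_distrib_left sum_negf[symmetric] minus_mult_left del: sum_negf)
      ultimately show ?thesis by (simp add: exp_minus inverse_eq_divide)
    qed
    have "1 / real (Suc n) * prob A \<le> prob A * (\<Prod>j<N. exp (- (1 + \<epsilon>) * q n j))"
      using mult_left_mono[OF lower measure_nonneg[of M A]] by (simp only: mult.commute)
    then have "1 / real (Suc n) * prob A \<le> prob (A \<inter> E n)" using base by linarith
    then show ?thesis using F_mono[of "E n" "r n N" "t (Suc n)"] N0 base by blast
  qed
  have "AE \<omega> in M. \<exists>\<^sub>\<infinity>n. \<omega> \<in> E n"
  proof (rule infinitely_often_if_conditionally_likely[where t = t and ?n0.0 = n0])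
    show "E n \<in> sets (F (t (Suc n)))" if "n0 \<le> n" for n
      using likely[OF that sets.empty_sets] by blast
  qed (use t_mono likely not_summable_inverse_Suc in auto)
  then show ?thesis using AE_reflected_path
  proof eventually_elim
    case (elim \<omega>)
    show "\<exists>\<^sub>F t in at_top. X t \<omega> \<le> a' * f t"
      unfolding frequently_def eventually_at_top_linorder not_ex not_all not_imp not_not
    proof
      fix T0 :: real
      have "\<forall>\<^sub>F n in sequentially. T0 \<le> t n" using t_top unfolding filterlim_at_top by blast
      then obtain n1 where n1: "\<And>n. n1 \<le> n \<Longrightarrow> T0 \<le> t n" unfolding eventually_sequentially by blast
      obtain n where n: "max n0 n1 \<le> n" "\<omega> \<in> E n" using elim(1) unfolding INFM_nat_le by blast
      then have nn: "n0 \<le> n" "n1 \<le> n" by auto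
      note N0 = n0[OF nn(1)]
      have rj: "0 \<le> r n j" if "j \<le> N" for j
        using that hpos[OF nn(1)] t_nonneg[of n] unfolding r_def by (intro add_nonneg_nonneg sum_nonneg) (auto simp: less_imp_le)
      obtain u where u: "r n 0 \<le> u" "u \<le> r n N" "X u \<omega> \<le> a * R n"
      proof (rule forced_descent[where h = "h n" and m = m and N = N and r = "r n" and T = "t (Suc n)" and R = "R n" and a = a and w = "\<lambda>t. W t \<omega>" and y = "\<lambda>t. X t \<omega>"])
        show "reflected_path B f s x (\<lambda>t. W t \<omega>) (\<lambda>t. X t \<omega>) (\<lambda>t. L1 t \<omega>) (\<lambda>t. Lf t \<omega>)" using elim by blast
        fix j u assume j: "j < N" and u: "r n j \<le> u" "u \<le> r n (Suc j)"
        show "\<bar>W u \<omega> - W (r n j) \<omega>\<bar> \<le> 3 * ((1 - a) / real N * R n)"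
          unfolding \<omega>0_def[symmetric]
        proof (rule abs_increment_le_outside_osc)
          show "\<omega> \<notin> osc (r n j) (h n j) (3 * (\<omega>0 * R n))" using n(2) j unfolding E_def by blast
          show "0 \<le> r n j" using rj j by simp
        qed (use elim hpos[OF nn(1) j] u r in auto)
      next
        fix j assume "j < N"
        then show "W (r n (Suc j)) \<omega> - W (r n j) \<omega> \<le> - 2 * ((1 - a) / real N * R n)"
          using n(2) unfolding E_def \<omega>0_def by blast
      qed (use a N mpos m_near m_crude x0 N0 r in \<open>auto simp: h_def \<omega>0_def R_def\<close>)
      have "T0 \<le> u" using u(1) n1[OF nn(2)] r(1) by simp
      moreover have "X u \<omega> \<le> a' * f u"
      proof -
        have "f (t n) \<le> f u" using u r(1) t_nonneg[of n] by (intro mono_onD[OF f_mono]) auto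
        then have "a' * f (t n) \<le> a' * f u" using a by (intro mult_left_mono) auto
        then show ?thesis using N0 u(3) by linarith
      qed
      ultimately show "\<exists>u\<ge>T0. X u \<omega> \<le> a' * f u" by blast
    qed
  qed
qed

end

section \<open>The moving boundary is reached infinitely often\<close>

lemma fluctuation_series_small:
  fixes q :: real
  assumes "0 < q"
  obtains K :: real where "0 < K" "\<And>n. (\<Sum>k<n. 4 * exp (- K\<^sup>2 / 2 * real (Suc k) powr q)) \<le> 1 / 2"
proof -
  have "\<forall>\<^sub>F k in sequentially. norm (exp (- (real (Suc k) powr q) / 2)) \<le> 1 / real (Suc k) ^ 2"
  proof -
    have "\<forall>\<^sub>F x in at_top. exp (- (x powr q) / 2) \<le> 1 / x ^ 2" using assms by real_asymp
    moreover have "filterlim (\<lambda>k. real (Suc k)) at_top sequentially" by real_asymp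
    ultimately show ?thesis unfolding filterlim_iff by (metis (no_types, lifting) abs_of_nonneg exp_ge_zero real_norm_def eventually_mono)
  qed
  moreover have "summable (\<lambda>k. 1 / real (Suc k) ^ 2)"
    using inverse_power_summable[of 2, where 'a=real] summable_Suc_iff[of "\<lambda>n. 1 / real n ^ 2"]
    by (simp only: inverse_eq_divide order_refl)
  ultimately have sm: "summable (\<lambda>k. exp (- (real (Suc k) powr q) / 2))"
    by (rule summable_comparison_test_ev)
  define S where "S = (\<Sum>k. exp (- (real (Suc k) powr q) / 2))"
  have S0: "0 \<le> S" unfolding S_def by (intro suminf_nonneg sm) auto
  have "\<forall>\<^sub>F K in at_top. 4 * exp (- (K\<^sup>2 - 1) / 2) * S \<le> 1 / 2"
  proof -
    have "((\<lambda>K::real. 4 * exp (- (K\<^sup>2 - 1) / 2) * S) \<longlongrightarrow> 4 * 0 * S) at_top"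
      by (intro tendsto_mult tendsto_const) real_asymp
    then have "((\<lambda>K::real. 4 * exp (- (K\<^sup>2 - 1) / 2) * S) \<longlongrightarrow> 0) at_top" by simp
    from order_tendstoD(2)[OF this, of "1 / 2"] show ?thesis by (auto elim: eventually_mono)
  qed
  then have "\<forall>\<^sub>F K in at_top. 4 * exp (- (K\<^sup>2 - 1) / 2) * S \<le> 1 / 2 \<and> (1::real) < K"
    using eventually_gt_at_top[of "1::real"] by eventually_elim simp
  then obtain K :: real where K: "4 * exp (- (K\<^sup>2 - 1) / 2) * S \<le> 1 / 2" "1 < K"
    using eventually_happens'[OF trivial_limit_at_top_linorder] by blast
  have K2: "1 \<le> K\<^sup>2" using K(2) by (simp add: one_le_power)
  have "(\<Sum>k<n. 4 * exp (- K\<^sup>2 / 2 * real (Suc k) powr q)) \<le> 1 / 2" for n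
  proof -
    have "(\<Sum>k<n. 4 * exp (- K\<^sup>2 / 2 * real (Suc k) powr q))
        \<le> (\<Sum>k<n. 4 * exp (- (K\<^sup>2 - 1) / 2) * exp (- (real (Suc k) powr q) / 2))"
    proof (intro sum_mono)
      fix k
      have "1 \<le> real (Suc k) powr q" using assms by (intro ge_one_powr_ge_zero) auto
      then have "(K\<^sup>2 - 1) / 2 * 1 \<le> (K\<^sup>2 - 1) / 2 * real (Suc k) powr q" using K2 by (intro mult_left_mono) auto
      then have "- K\<^sup>2 / 2 * real (Suc k) powr q \<le> - (K\<^sup>2 - 1) / 2 + - (real (Suc k) powr q) / 2"
        by (simp add: field_simps)
      then have "exp (- K\<^sup>2 / 2 * real (Suc k) powr q) \<le> exp (- (K\<^sup>2 - 1) / 2) * exp (- (real (Suc k) powr q) / 2)"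
        by (metis exp_add exp_le_cancel_iff)
      then show "4 * exp (- K\<^sup>2 / 2 * real (Suc k) powr q) \<le> 4 * exp (- (K\<^sup>2 - 1) / 2) * exp (- (real (Suc k) powr q) / 2)"
        by simp
    qed
    also have "\<dots> = 4 * exp (- (K\<^sup>2 - 1) / 2) * (\<Sum>k<n. exp (- (real (Suc k) powr q) / 2))"
      by (simp add: sum_distrib_left)
    also have "\<dots> \<le> 4 * exp (- (K\<^sup>2 - 1) / 2) * S"
      unfolding S_def using sm by (intro mult_left_mono sum_le_suminf) auto
    finally show ?thesis using K(1) by simp
  qed
  then show thesis using that[of K] K(2) by simp
qed

context brownian
begin

text \<open>
  Unions over the unit intervals cut the barrier \<open>K (1 + v)\<^bsup>\<theta>\<^esup>\<close> into pieces, and the maximal inequality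
  bounds the probability of crossing the piece ending at \<open>k + 1\<close> by
  \<open>4 exp (- K\<^sup>2 (k + 1)\<^bsup>2\<theta>-1\<^esup> / 2)\<close>.
\<close>

lemma prob_push_then_stay:
  fixes K D \<theta> r :: real and n :: nat
  defines "E \<equiv> {\<omega>\<in>space M. W (r + 1) \<omega> - W r \<omega> \<in> {D..} \<and> (\<forall>k<n. \<omega> \<notin> osc (r + 1) (real (Suc k)) (K * real (Suc k) powr \<theta>))}"
  assumes "0 \<le> r" "0 \<le> D" "0 \<le> K" and A: "A \<in> sets (F r)"
    and K: "(\<Sum>k<n. 4 * exp (- K\<^sup>2 / 2 * real (Suc k) powr (2 * \<theta> - 1))) \<le> 1 / 2"
  shows "E \<in> sets (F (r + 1 + real n)) \<and> measure (gauss 1) {D..} / 2 * prob A \<le> prob (A \<inter> E)"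
proof -
  let ?P = "{\<omega>\<in>space M. W (r + 1) \<omega> - W r \<omega> \<in> {D..}}"
  let ?O = "\<lambda>k. osc (r + 1) (real (Suc k)) (K * real (Suc k) powr \<theta>)"
  have P: "?P \<in> sets (F (r + 1))" using assms by (intro increment_event) auto
  have P': "?P \<in> sets (F (r + 1 + real n))" by (rule F_mono[OF P]) simp
  have O: "?O k \<in> sets (F (r + 1 + real n))" if "k < n" for k
    using assms(2) that by (intro osc_sets) auto
  have UO: "(\<Union>k<n. ?O k) \<in> sets (F (r + 1 + real n))" using O by (intro sets.finite_UN) auto
  have E: "E = ?P - (\<Union>k<n. ?O k)" unfolding E_def by blast
  have ES: "E \<in> sets (F (r + 1 + real n))" unfolding E using P' UO by (rule sets.Diff)
  have A1: "A \<inter> ?P \<in> sets (F (r + 1))" using F_mono[OF A, of "r + 1"] P by (intro sets.Int) auto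
  have P1: "prob (A \<inter> ?P) = prob A * measure (gauss 1) {D..}"
    using prob_increment[OF assms(2) _ A, of "r + 1" "{D..}"] by simp
  have "prob (A \<inter> ?P \<inter> (\<Union>k<n. ?O k)) = prob (\<Union>k<n. A \<inter> ?P \<inter> ?O k)" by (simp only: Int_UN_distrib)
  also have "\<dots> \<le> (\<Sum>k<n. prob (A \<inter> ?P \<inter> ?O k))"
    using F_into_M[OF A1] F_into_M[OF O] by (intro finite_measure_subadditive_finite) auto
  also have "\<dots> \<le> (\<Sum>k<n. 4 * exp (- K\<^sup>2 / 2 * real (Suc k) powr (2 * \<theta> - 1)) * prob (A \<inter> ?P))"
  proof (rule sum_mono)
    fix k
    define u where "u = real (Suc k)"
    have u: "0 < u" unfolding u_def by simp
    have "(u powr \<theta>)\<^sup>2 = u powr (2 * \<theta>)" unfolding power2_eq_square powr_add[symmetric] by simp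
    then have "(u powr \<theta>)\<^sup>2 / u = u powr (2 * \<theta> - 1)" unfolding powr_diff using u by simp
    moreover have "- (K * u powr \<theta>)\<^sup>2 / (2 * u) = - K\<^sup>2 / 2 * ((u powr \<theta>)\<^sup>2 / u)"
      by (simp add: power_mult_distrib)
    ultimately have exponent: "- (K * real (Suc k) powr \<theta>)\<^sup>2 / (2 * real (Suc k)) = - K\<^sup>2 / 2 * real (Suc k) powr (2 * \<theta> - 1)"
      unfolding u_def by simp
    have "prob (A \<inter> ?P \<inter> ?O k)
        \<le> 4 * exp (- (K * real (Suc k) powr \<theta>)\<^sup>2 / (2 * real (Suc k))) * prob (A \<inter> ?P)"
      using assms(2,4) by (intro prob_osc A1) auto
    then show "prob (A \<inter> ?P \<inter> ?O k) \<le> 4 * exp (- K\<^sup>2 / 2 * real (Suc k) powr (2 * \<theta> - 1)) * prob (A \<inter> ?P)"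
      unfolding exponent .
  qed
  also have "\<dots> = (\<Sum>k<n. 4 * exp (- K\<^sup>2 / 2 * real (Suc k) powr (2 * \<theta> - 1))) * prob (A \<inter> ?P)"
    by (rule sum_distrib_right[symmetric])
  also have "\<dots> \<le> 1 / 2 * prob (A \<inter> ?P)" using K by (intro mult_right_mono) auto
  finally have "prob (A \<inter> ?P) / 2 \<le> prob (A \<inter> ?P) - prob (A \<inter> ?P \<inter> (\<Union>k<n. ?O k))" by simp
  also have "\<dots> = prob (A \<inter> ?P - A \<inter> ?P \<inter> (\<Union>k<n. ?O k))"
    using F_into_M[OF A1] F_into_M[OF UO] by (intro finite_measure_Diff[symmetric]) auto
  also have "A \<inter> ?P - A \<inter> ?P \<inter> (\<Union>k<n. ?O k) = A \<inter> E" unfolding E by blast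
  finally show ?thesis using ES P1 by (simp add: mult_ac)
qed

end

context reflected_bm
begin

text \<open>
  The trials of \<open>prob_push_then_stay\<close> in the windows between consecutive squares succeed infinitely
  often. A success lifts the path by \<open>D\<close>, enough to start \<open>escape_to_boundary\<close>, by which the path
  would exceed \<open>C (2 n)\<^bsup>\<theta>\<^esup>\<close> at the end of the window if it stayed below \<open>f\<close>. But \<open>f\<close> is only a power of a
  logarithm there.
\<close>

lemma frequently_at_boundary:
  "AE \<omega> in M. \<exists>\<^sub>F t in at_top. f t \<le> X t \<omega>"
proof -
  obtain x0 where x0: "1 < x0" "\<And>v. x0 \<le> v \<Longrightarrow> B v = b * v powr \<gamma>" using B_power_from by blast
  have "bounded (B ` {1..x0})" by (rule locally_bounded_on_compact[OF B_bounded]) auto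
  then obtain \<beta> where "\<forall>v\<in>B ` {1..x0}. norm v \<le> \<beta>" unfolding bounded_iff by blast
  then have \<beta>: "\<bar>B v\<bar> \<le> \<beta>" if "1 \<le> v" "v \<le> x0" for v using that by auto
  have \<beta>0: "0 \<le> \<beta>" using \<beta>[of 1] x0(1) by simp
  have B_ge: "- \<beta> \<le> B v" if "1 \<le> v" for v
  proof (cases "v \<le> x0")
    case True then show ?thesis using \<beta>[of v] that by (simp add: abs_le_iff)
  next
    case False then show ?thesis using x0(2)[of v] b_pos \<beta>0 by (smt (verit) mult_nonneg_nonneg powr_ge_zero)
  qed
  (* Far out the drift is at least b z powr (- g), a common lower bound for both signs of \<gamma>. *)
  define g where "g = max (- \<gamma>) 0"
  have g: "0 \<le> g" "g < 1" "- g \<le> \<gamma>" unfolding g_def using gamma by auto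
  (* Above 1/2, so that W respects the barrier; below 1 / (1 + g), so that the drift outgrows it. *)
  define \<theta> where "\<theta> = (1 / 2 + 1 / (1 + g)) / 2"
  have \<theta>: "1 / 2 < \<theta>" "\<theta> \<le> 1" "\<theta> * (1 + g) < 1"
  proof -
    define e where "e = 1 / (1 + g)"
    have e: "1 / 2 < e" "e \<le> 1" unfolding e_def using g by (simp_all add: field_simps)
    have \<theta>e: "\<theta> = (1 / 2 + e) / 2" unfolding \<theta>_def e_def ..
    show "1 / 2 < \<theta>" "\<theta> \<le> 1" unfolding \<theta>e using e by simp_all
    have "e * (1 + g) = 1" unfolding e_def using g by simp
    then have "\<theta> * (1 + g) = ((1 + g) / 2 + 1) / 2" unfolding \<theta>e by (simp add: algebra_simps add_divide_distrib)
    also have "\<dots> < 1" using g by simp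
    finally show "\<theta> * (1 + g) < 1" .
  qed
  have "0 < 2 * \<theta> - 1" using \<theta> by simp
  then obtain K where K: "0 < K" "\<And>n. (\<Sum>k<n. 4 * exp (- K\<^sup>2 / 2 * real (Suc k) powr (2 * \<theta> - 1))) \<le> 1 / 2"
    using fluctuation_series_small[of "2 * \<theta> - 1"] by metis
  define C where "C = 2 * K + x0"
  have C: "0 < C" "2 * K < C" "x0 \<le> C" unfolding C_def using K x0 by auto
  obtain V0 where V0: "1 \<le> V0"
    "\<And>u. V0 \<le> u \<Longrightarrow> (C + 2 * K) * u powr \<theta> \<le> b * (4 * C * u powr \<theta>) powr (- g) * (u / 2)"
  proof -
    define \<delta> where "\<delta> = 1 - \<theta> * (1 + g)"
    have \<delta>: "0 < \<delta>" unfolding \<delta>_def using \<theta> by simp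
    have "0 < b * (4 * C) powr (- g) / 2" using b_pos C by simp
    then have "filterlim (\<lambda>u. b * (4 * C) powr (- g) / 2 * u powr \<delta>) at_top at_top"
      using \<delta> by real_asymp
    then have "\<forall>\<^sub>F u in at_top. C + 2 * K \<le> b * (4 * C) powr (- g) / 2 * u powr \<delta>"
      unfolding filterlim_at_top by blast
    then obtain V where V: "\<And>u. V \<le> u \<Longrightarrow> C + 2 * K \<le> b * (4 * C) powr (- g) / 2 * u powr \<delta>"
      unfolding eventually_at_top_linorder by blast
    show thesis
    proof (rule that[of "max V 1"])
      fix u assume u: "max V 1 \<le> u"
      have "(C + 2 * K) * u powr \<theta> \<le> b * (4 * C) powr (- g) / 2 * u powr \<delta> * u powr \<theta>"
        using V[of u] u by (intro mult_right_mono) auto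
      also have "\<dots> = b * (4 * C) powr (- g) / 2 * u powr (1 + \<theta> * (- g))"
        unfolding \<delta>_def by (simp add: powr_add[symmetric] algebra_simps)
      also have "u powr (1 + \<theta> * (- g)) = u * (u powr \<theta>) powr (- g)"
      proof -
        have "u powr 1 = u" using u by simp
        then show ?thesis unfolding powr_add powr_powr by simp
      qed
      also have "b * (4 * C) powr (- g) / 2 * (u * (u powr \<theta>) powr (- g)) = b * (4 * C * u powr \<theta>) powr (- g) * (u / 2)"
        by (simp add: powr_mult[of "4 * C"])
      finally show "(C + 2 * K) * u powr \<theta> \<le> b * (4 * C * u powr \<theta>) powr (- g) * (u / 2)" .
    qed simp
  qed
  (* High enough to survive until the time V0 from which the drift dominates. *)
  define H where "H = 4 * C + (K + C) * V0 + 1"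
  have H: "4 * C \<le> H" "(K + C) * V0 < H" "0 < H"
    unfolding H_def using C K V0 by (auto simp: add_pos_pos)
  (* In the unit of time that the push takes, the drift can take away at most \<beta>. *)
  define D where "D = H + \<beta>"
  define t where "t n = (real n)\<^sup>2" for n
  have tS: "t (Suc n) = t n + 1 + real (2 * n)" for n unfolding t_def by (simp add: power2_eq_square algebra_simps)
  have t_top: "filterlim t at_top sequentially" unfolding t_def by real_asymp
  then have tS_top: "filterlim (\<lambda>n. t (Suc n)) at_top sequentially" by (rule filterlim_compose) (rule filterlim_Suc)
  define E where "E n = {\<omega>\<in>space M. W (t n + 1) \<omega> - W (t n) \<omega> \<in> {D..} \<and>
      (\<forall>k<2 * n. \<omega> \<notin> osc (t n + 1) (real (Suc k)) (K * real (Suc k) powr \<theta>))}" for n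
  have likely: "E n \<in> sets (F (t (Suc n))) \<and> measure (gauss 1) {D..} / 2 * prob A \<le> prob (A \<inter> E n)"
    if "A \<in> sets (F (t n))" for n A
    unfolding tS E_def using K H \<beta>0 that
    by (intro prob_push_then_stay) (auto simp: D_def t_def)
  have gpos: "0 < measure (gauss 1) {D..}"
  proof -
    have "uminus -` {D..} = {..- D}" by auto
    then have "measure (gauss 1) {D..} = measure (gauss 1) {..- D}" using gauss_uminus[of 1 "{D..}"] by simp
    moreover have "exp (- (D / sqrt 1 + 1)\<^sup>2 / 2) / sqrt (2 * pi) \<le> measure (gauss 1) {..- D}"
      using H \<beta>0 by (intro gauss_lower_tail) (auto simp: D_def)
    moreover have "0 < exp (- (D / sqrt 1 + 1)\<^sup>2 / 2) / sqrt (2 * pi)" by simp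
    ultimately show ?thesis by linarith
  qed
  have "AE \<omega> in M. \<exists>\<^sub>\<infinity>n. \<omega> \<in> E n"
  proof (rule infinitely_often_if_conditionally_likely[where t = t and ?n0.0 = 0 and p = "\<lambda>_. measure (gauss 1) {D..} / 2"])
    show "t n \<le> t (Suc n)" for n unfolding tS by simp
    show "\<not> summable (\<lambda>_::nat. measure (gauss 1) {D..} / 2)" unfolding summable_const_iff using gpos by simp
    show "E n \<in> sets (F (t (Suc n)))" for n using likely[OF sets.empty_sets] by blast
  qed (use likely in auto)
  then show ?thesis using AE_reflected_path
  proof eventually_elim
    case (elim \<omega>)
    interpret P: reflected_path B f s x "\<lambda>t. W t \<omega>" "\<lambda>t. X t \<omega>" "\<lambda>t. L1 t \<omega>" "\<lambda>t. Lf t \<omega>" using elim by blast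
    show "\<exists>\<^sub>F t in at_top. f t \<le> X t \<omega>"
      unfolding frequently_def eventually_at_top_linorder not_ex not_all not_imp not_not
    proof
      fix T0 :: real
      have "\<forall>\<^sub>F n in sequentially. max T0 s \<le> t n" using t_top unfolding filterlim_at_top by blast
      moreover have "\<forall>\<^sub>F n in sequentially. f (t (Suc n)) = c * (ln (t (Suc n))) powr (1 / (1 + \<gamma>))"
        using f_log tS_top unfolding filterlim_iff by blast
      moreover have "\<forall>\<^sub>F n in sequentially. c * (ln (t (Suc n))) powr (1 / (1 + \<gamma>)) < C * real (2 * n) powr \<theta>"
      proof -
        have "0 < 1 / (1 + \<gamma>)" "0 < \<theta>" using gamma \<theta> by auto
        then have "\<forall>\<^sub>F n in at_top. c * (ln ((n + 1)\<^sup>2)) powr (1 / (1 + \<gamma>)) < C * (2 * n) powr \<theta>"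
          using c_pos C(1) by real_asymp
        then have "\<forall>\<^sub>F n in sequentially. c * (ln ((real n + 1)\<^sup>2)) powr (1 / (1 + \<gamma>)) < C * (2 * real n) powr \<theta>"
          using filterlim_real_sequentially unfolding filterlim_iff by blast
        then show ?thesis unfolding t_def by eventually_elim (simp add: add.commute)
      qed
      ultimately have "\<forall>\<^sub>F n in sequentially. max T0 s \<le> t n \<and> f (t (Suc n)) < C * real (2 * n) powr \<theta> \<and> 0 < n"
        using eventually_gt_at_top[of 0] by eventually_elim simp
      then obtain n1 where n1: "\<And>n. n1 \<le> n \<Longrightarrow> max T0 s \<le> t n \<and> f (t (Suc n)) < C * real (2 * n) powr \<theta> \<and> 0 < n"
        unfolding eventually_sequentially by blast
      obtain n where n: "n1 \<le> n" "\<omega> \<in> E n" using elim(1) unfolding INFM_nat_le by blast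
      note N1 = n1[OF n(1)]
      show "\<exists>u\<ge>T0. f u \<le> X u \<omega>"
      proof (rule ccontr)
        assume "\<not> (\<exists>u\<ge>T0. f u \<le> X u \<omega>)"
        then have below: "X u \<omega> < f u" if "t n \<le> u" for u using that N1 by (meson le_max_iff_disj not_le order_trans max.bounded_iff)
        have s: "s \<le> t n" using N1 by simp
        have start: "H \<le> X (t n + 1) \<omega>"
        proof -
          have "W (t n + 1) \<omega> - W (t n) \<omega> + P.drift (t n) (t n + 1) \<le> X (t n + 1) \<omega> - X (t n) \<omega>"
            using s below by (intro P.increment_ge) auto
          moreover have "- \<beta> * (t n + 1 - t n) \<le> P.drift (t n) (t n + 1)"
            using s B_ge P.y_in by (intro P.drift_ge) auto
          moreover have "D \<le> W (t n + 1) \<omega> - W (t n) \<omega>" using n(2) unfolding E_def by simp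
          moreover have "1 \<le> X (t n) \<omega>" using P.y_in[OF s] by simp
          ultimately show ?thesis unfolding D_def by simp
        qed
        let ?V = "real (2 * n) - 1"
        have V: "0 \<le> ?V" using N1 by simp
        have "C * (1 + ?V) powr \<theta> \<le> X (t n + 1 + ?V) \<omega>"
        proof (rule P.escape_to_boundary[where K = K and ?V0.0 = V0 and b = b and g = g and V = ?V])
          fix v assume v: "0 \<le> v" "v \<le> ?V"
          define k where "k = nat \<lfloor>v\<rfloor>"
          have k: "real k \<le> v" "v \<le> real (Suc k)" unfolding k_def using v(1) by linarith+
          have k2: "k < 2 * n" using k(1) v(2) N1 by linarith
          have "\<bar>W (t n + 1 + v) \<omega> - W (t n + 1) \<omega>\<bar> \<le> K * real (Suc k) powr \<theta>"
          proof (rule abs_increment_le_outside_osc)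
            show "\<omega> \<notin> osc (t n + 1) (real (Suc k)) (K * real (Suc k) powr \<theta>)" using n(2) k2 unfolding E_def by blast
            show "0 \<le> t n + 1" unfolding t_def by simp
          qed (use elim k v in auto)
          also have "\<dots> \<le> K * (1 + v) powr \<theta>" using k K \<theta> by (intro mult_left_mono powr_mono2) auto
          finally show "\<bar>W (t n + 1 + v) \<omega> - W (t n + 1) \<omega>\<bar> \<le> K * (1 + v) powr \<theta>" .
        next
          fix z assume z: "C \<le> z"
          then have "z powr (- g) \<le> z powr \<gamma>" using g x0 C by (intro powr_mono) auto
          then show "b * z powr (- g) \<le> B z" using x0(2)[of z] z C b_pos by simp
        next
          show "(K + C) * V0 < X (t n + 1) \<omega>" "4 * C \<le> X (t n + 1) \<omega>" using H start by auto
          show "s \<le> t n + 1" using s by simp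
        qed (use \<theta> K C V0 g b_pos below V in auto)
        also have "X (t n + 1 + ?V) \<omega> \<le> f (t n + 1 + ?V)" using P.y_in[of "t n + 1 + ?V"] s V by simp
        also have "\<dots> \<le> f (t (Suc n))"
          using s s_nonneg V by (intro mono_onD[OF f_mono]) (auto simp: tS)
        finally show False using N1 by simp
      qed
    qed
  qed
qed

end

section \<open>Supercritical levels are eventually avoided\<close>

context brownian
begin

lemma AE_eventually_not_if_summable_bound:
  assumes "\<And>n. n0 \<le> n \<Longrightarrow> A n \<in> sets M" "\<And>n. n0 \<le> n \<Longrightarrow> prob (A n) \<le> p n" "summable p"
  shows "AE \<omega> in M. \<forall>\<^sub>F n in sequentially. \<omega> \<notin> A n"
proof -
  define A' where "A' n = (if n0 \<le> n then A n else {})" for n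
  have "AE \<omega> in M. \<forall>\<^sub>F n in sequentially. \<omega> \<in> space M - A' n"
  proof (rule borel_cantelli_AE1)
    show "A' n \<in> sets M" for n using assms(1) unfolding A'_def by simp
    show "emeasure M (A' n) < \<infinity>" for n by (simp add: less_top[symmetric])
    show "summable (\<lambda>n. measure M (A' n))"
    proof (rule summable_comparison_test_ev[OF _ assms(3)])
      show "\<forall>\<^sub>F n in sequentially. norm (measure M (A' n)) \<le> p n"
        using eventually_ge_at_top[of n0] by eventually_elim (simp add: A'_def assms(2))
    qed
  qed
  then show ?thesis
  proof eventually_elim
    case (elim \<omega>)
    then show ?case using eventually_ge_at_top[of n0] by eventually_elim (simp add: A'_def)
  qed
qed

text \<open>
  A window is bad if the action of \<open>W\<close> is large enough for a dip, or if the grid is too coarse to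
  control \<open>W\<close> between its points.
\<close>

definition bad_window :: "real \<Rightarrow> real \<Rightarrow> nat \<Rightarrow> real \<Rightarrow> real \<Rightarrow> 'a set" where
  "bad_window r h K \<alpha> d = {\<omega>\<in>space M. \<alpha> \<le> action r h K \<omega>} \<union> (\<Union>j<K. osc (r + real j * h) h d)"

lemma bad_window_sets: "0 \<le> r \<Longrightarrow> 0 < h \<Longrightarrow> bad_window r h K \<alpha> d \<in> sets M"
proof -
  assume rh: "0 \<le> r" "0 < h"
  have "action r h K \<in> borel_measurable M" using action_measurable[OF rh] by (rule measurable_F_M)
  then have "{\<omega>\<in>space M. \<alpha> \<le> action r h K \<omega>} \<in> sets M" by measurable
  moreover have "osc (r + real j * h) h d \<in> sets M" for j
    using rh by (intro F_into_M[OF osc_sets[of _ _ "r + real j * h + h"]]) auto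
  ultimately show ?thesis unfolding bad_window_def by auto
qed

lemma prob_bad_window:
  assumes "0 \<le> r" "0 < h" "0 < l" "l < 1" "0 \<le> d"
  shows "prob (bad_window r h K \<alpha> d) \<le> (1 / sqrt (1 - l)) ^ K * exp (- l * \<alpha>) + real K * (4 * exp (- d\<^sup>2 / (2 * h)))"
proof -
  have "action r h K \<in> borel_measurable M" using action_measurable[OF assms(1,2)] by (rule measurable_F_M)
  then have S: "{\<omega>\<in>space M. \<alpha> \<le> action r h K \<omega>} \<in> sets M" by measurable
  have O: "osc (r + real j * h) h d \<in> sets M" for j
    using assms by (intro F_into_M[OF osc_sets[of _ _ "r + real j * h + h"]]) auto
  have Oj: "prob (osc (r + real j * h) h d) \<le> 4 * exp (- d\<^sup>2 / (2 * h))" for j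
  proof -
    have "space M \<in> sets (F (r + real j * h))" using sets.top[of "F (r + real j * h)"] by simp
    from prob_osc[OF _ assms(2,5) this] have "prob (space M \<inter> osc (r + real j * h) h d) \<le> 4 * exp (- d\<^sup>2 / (2 * h)) * prob (space M)"
      using assms by simp
    moreover have "space M \<inter> osc (r + real j * h) h d = osc (r + real j * h) h d" unfolding osc_def by auto
    ultimately show ?thesis by (simp add: prob_space)
  qed
  have "prob (bad_window r h K \<alpha> d) \<le> prob {\<omega>\<in>space M. \<alpha> \<le> action r h K \<omega>} + prob (\<Union>j<K. osc (r + real j * h) h d)"
    unfolding bad_window_def using S O by (intro measure_Un_le) auto
  also have "prob (\<Union>j<K. osc (r + real j * h) h d) \<le> (\<Sum>j<K. prob (osc (r + real j * h) h d))"
    using O by (intro finite_measure_subadditive_finite) auto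
  also have "\<dots> \<le> (\<Sum>j<K. 4 * exp (- d\<^sup>2 / (2 * h)))" using Oj by (intro sum_mono)
  also have "prob {\<omega>\<in>space M. \<alpha> \<le> action r h K \<omega>} \<le> (1 / sqrt (1 - l)) ^ K * exp (- l * \<alpha>)"
    by (rule prob_action_ge[OF assms(1-4)])
  finally show ?thesis by simp
qed

end

context reflected_bm
begin

text \<open>
  The hypothesis \<open>local\<close> of \<open>action_of_dip\<close> for the potential with slope \<open>2 b v\<^bsup>\<gamma>\<^esup>\<close>.
\<close>

lemma potential_slope:
  fixes a d R l :: real
  assumes "0 < a" "0 \<le> d" "0 < R" "0 < l" "l * (1 + 8 * d / a) \<le> 1"
    and z: "a / 2 * R \<le> z" "a / 2 * R \<le> v'" "v' < v" and near: "\<bar>z - v\<bar> \<le> 2 * (d * R)" "\<bar>v' - v\<bar> \<le> 2 * (d * R)"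
  shows "l * (2 * b / (1 + \<gamma>) * v powr (1 + \<gamma>) - 2 * b / (1 + \<gamma>) * v' powr (1 + \<gamma>)) \<le> 2 * (v - v') * (b * z powr \<gamma>)"
proof -
  have pos: "0 < a / 2 * R" using assms by simp
  have "\<exists>\<xi>. v' < \<xi> \<and> \<xi> < v \<and> 2 * b / (1 + \<gamma>) * v powr (1 + \<gamma>) - 2 * b / (1 + \<gamma>) * v' powr (1 + \<gamma>) = (v - v') * (2 * b * \<xi> powr \<gamma>)"
  proof (rule MVT2[OF z(3)])
    fix u assume "v' \<le> u" "u \<le> v"
    then show "((\<lambda>u. 2 * b / (1 + \<gamma>) * u powr (1 + \<gamma>)) has_real_derivative 2 * b * u powr \<gamma>) (at u)"
      using pos z gamma by (auto intro!: derivative_eq_intros)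
  qed
  then obtain \<xi> where \<xi>: "v' < \<xi>" "\<xi> < v"
    "2 * b / (1 + \<gamma>) * v powr (1 + \<gamma>) - 2 * b / (1 + \<gamma>) * v' powr (1 + \<gamma>) = (v - v') * (2 * b * \<xi> powr \<gamma>)" by blast
  have pos': "0 < \<xi>" "0 < z" using pos z \<xi>(1) by linarith+
  have near': "\<bar>\<xi> - z\<bar> \<le> 4 * (d * R)" using near \<xi>(1,2) unfolding abs_le_iff by linarith
  have shift: "u + 4 * (d * R) \<le> (1 + 8 * d / a) * u" if "a / 2 * R \<le> u" for u
  proof -
    have "4 * (d * R) = 8 * d / a * (a / 2 * R)" using assms(1) by simp
    also have "\<dots> \<le> 8 * d / a * u" using that assms by (intro mult_left_mono) auto
    finally show ?thesis by (simp add: distrib_right)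
  qed
  have "\<xi> powr \<gamma> \<le> (1 + 8 * d / a) * z powr \<gamma>"
  proof (rule powr_le_ratio)
    show "\<xi> \<le> (1 + 8 * d / a) * z" using shift[OF z(1)] near' by (simp add: abs_le_iff)
    have "a / 2 * R \<le> \<xi>" using z \<xi> by simp
    from shift[OF this] show "z \<le> (1 + 8 * d / a) * \<xi>" using near' by (simp add: abs_le_iff)
  qed (use pos' assms(1,2) gamma in auto)
  then have "l * \<xi> powr \<gamma> \<le> l * ((1 + 8 * d / a) * z powr \<gamma>)" using assms(4) by (intro mult_left_mono) auto
  also have "\<dots> = (l * (1 + 8 * d / a)) * z powr \<gamma>" by simp
  also have "\<dots> \<le> 1 * z powr \<gamma>" using assms(5) by (intro mult_right_mono) auto
  finally have "2 * b * (v - v') * (l * \<xi> powr \<gamma>) \<le> 2 * b * (v - v') * z powr \<gamma>"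
    using b_pos z(3) by (intro mult_left_mono) auto
  then show ?thesis unfolding \<xi>(3) by (simp add: algebra_simps)
qed

lemma drift_bounds_scaled:
  assumes "0 < a" "0 < R" "a / 2 * R \<le> z" "z \<le> R"
  shows "b * min 1 ((a / 2) powr \<gamma>) * R powr \<gamma> \<le> b * z powr \<gamma>"
    and "b * z powr \<gamma> \<le> b * max 1 ((a / 2) powr \<gamma>) * R powr \<gamma>"
proof -
  have "0 < a / 2 * R" using assms by simp
  then have "0 < z" using assms(3) by linarith
  then have r: "a / 2 \<le> z / R" "z / R \<le> 1" "0 < z / R" using assms by (auto simp: field_simps)
  have z: "z powr \<gamma> = R powr \<gamma> * (z / R) powr \<gamma>" using assms(2) by (simp add: powr_mult[symmetric])
  have up: "(z / R) powr \<gamma> \<le> max 1 ((a / 2) powr \<gamma>)"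
    using powr_le_max_endpoints[of "a / 2" "z / R" 1 \<gamma>] r assms(1) by (simp add: max.commute)
  have lo: "min 1 ((a / 2) powr \<gamma>) \<le> (z / R) powr \<gamma>"
  proof (cases "0 \<le> \<gamma>")
    case True
    then have "(a / 2) powr \<gamma> \<le> (z / R) powr \<gamma>" using r assms(1) by (intro powr_mono2) auto
    then show ?thesis by simp
  next
    case False
    then have "1 powr \<gamma> \<le> (z / R) powr \<gamma>" using r by (intro powr_mono2') auto
    then show ?thesis by simp
  qed
  have "b * R powr \<gamma> * min 1 ((a / 2) powr \<gamma>) \<le> b * R powr \<gamma> * (z / R) powr \<gamma>"
    using lo b_pos by (intro mult_left_mono) auto
  then show "b * min 1 ((a / 2) powr \<gamma>) * R powr \<gamma> \<le> b * z powr \<gamma>" unfolding z by (simp add: mult_ac)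
  have "b * R powr \<gamma> * (z / R) powr \<gamma> \<le> b * R powr \<gamma> * max 1 ((a / 2) powr \<gamma>)"
    using up b_pos by (intro mult_left_mono) auto
  then show "b * z powr \<gamma> \<le> b * max 1 ((a / 2) powr \<gamma>) * R powr \<gamma>" unfolding z by (simp add: mult_ac)
qed

text \<open>
  Room for all approximations: the action between the slightly smaller range \<open>[a1, b1]\<close> of levels is
  still supercritical after two losses of a factor \<open>l\<close>, one in the comparison with the potential and
  one in the exponential moment.
\<close>

lemma supercritical_levels:
  assumes "0 < a" "a < 1" "1 < Q * (1 - a powr (1 + \<gamma>))"
  obtains a1 b1 l where "a < a1" "a1 < b1" "b1 < 1" "0 < l" "l < 1"
    "1 < l * (l * (Q * (b1 powr (1 + \<gamma>) - a1 powr (1 + \<gamma>))))"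
proof -
  let ?e = "1 / (1 + \<gamma>)"
  define A0 where "A0 = a powr (1 + \<gamma>)"
  have A0: "0 < A0" "A0 powr ?e = a" unfolding A0_def using assms gamma by (simp_all add: powr_powr)
  define G where "G = 1 - A0 - 1 / Q"
  have G: "0 < G" "G < 1 - A0" "Q * (1 - A0) = 1 + Q * G"
    using assms(3) Q_pos unfolding G_def A0_def by (simp_all add: field_simps)
  define a1 where "a1 = (A0 + G / 4) powr ?e"
  define b1 where "b1 = (1 - G / 4) powr ?e"
  have pw: "a1 powr (1 + \<gamma>) = A0 + G / 4" "b1 powr (1 + \<gamma>) = 1 - G / 4"
    unfolding a1_def b1_def using gamma A0 G by (simp_all add: powr_powr)
  have "A0 powr ?e < a1" unfolding a1_def using A0 G gamma by (intro powr_less_mono2) auto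
  moreover have "a1 < b1" unfolding a1_def b1_def using A0 G gamma by (intro powr_less_mono2) auto
  moreover have "b1 < 1 powr ?e" unfolding b1_def using A0 G gamma by (intro powr_less_mono2) auto
  moreover define l where "l = 1 / sqrt (1 + Q * G / 4)"
  have QG: "0 < Q * G" using Q_pos G by simp
  have "0 < l" "l < 1" unfolding l_def using QG by (simp_all add: real_less_rsqrt)
  moreover have "1 < l * (l * (Q * (b1 powr (1 + \<gamma>) - a1 powr (1 + \<gamma>))))"
  proof -
    have ll: "l * l = 1 / (1 + Q * G / 4)" unfolding l_def using QG by simp
    have "Q * (b1 powr (1 + \<gamma>) - a1 powr (1 + \<gamma>)) = 1 + Q * G / 2"
      unfolding pw using G(3) by (simp add: algebra_simps)
    then have "l * (l * (Q * (b1 powr (1 + \<gamma>) - a1 powr (1 + \<gamma>)))) = (1 + Q * G / 2) / (1 + Q * G / 4)"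
      using ll by (simp add: mult.assoc[symmetric])
    also have "1 < \<dots>" using QG by (simp add: mult.commute)
    finally show ?thesis .
  qed
  ultimately show thesis using that A0(2) by simp
qed

text \<open>
  The windows reach back from time \<open>n + 1\<close> by slightly more than \<open>T = C R\<^bsup>1-\<gamma>\<^esup>\<close>, where \<open>R = f (n + 1)\<close>, and are divided
  into a fixed number \<open>K\<close> of steps. By \<open>action_of_dip\<close> a first dip after a visit of \<open>f\<close> takes place
  in a bad window, and the probability of a bad window is at most a constant times
  \<open>n\<^bsup>-P\<^esup> + n\<^bsup>-2\<^esup>\<close> with \<open>P > 1\<close>.
\<close>

lemma eventually_above_level:
  assumes a: "0 < a" "a < 1" and supercritical: "1 < Q * (1 - a powr (1 + \<gamma>))"
  shows "AE \<omega> in M. (\<exists>\<^sub>F t in at_top. f t \<le> X t \<omega>) \<longrightarrow> (\<forall>\<^sub>F t in at_top. a * f t \<le> X t \<omega>)"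
proof -
  obtain a1 b1 l where lev: "a < a1" "a1 < b1" "b1 < 1" and l: "0 < l" "l < 1"
    and P1: "1 < l * (l * (Q * (b1 powr (1 + \<gamma>) - a1 powr (1 + \<gamma>))))"
    using supercritical_levels[OF a supercritical] by metis
  define P where "P = l * (l * (Q * (b1 powr (1 + \<gamma>) - a1 powr (1 + \<gamma>))))"
  have P: "1 < P" unfolding P_def by (rule P1)
  obtain x0 where x0: "1 < x0" "\<And>v. x0 \<le> v \<Longrightarrow> B v = b * v powr \<gamma>" using B_power_from by blast
  define \<kappa> where "\<kappa> = 2 * b / (1 + \<gamma>)"
  have \<kappa>: "0 < \<kappa>" unfolding \<kappa>_def using b_pos gamma by simp
  define U where "U v = \<kappa> * v powr (1 + \<gamma>)" for v
  have U_mono: "mono_on {0..} U" unfolding U_def using \<kappa> gamma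
    by (intro mono_onI mult_left_mono powr_mono2) auto
  define b2 where "b2 = (1 + b1) / 2"
  have b2: "b1 < b2" "b2 < 1" unfolding b2_def using lev by auto
  define m0 where "m0 = b * min 1 ((a / 2) powr \<gamma>)"
  define M0 where "M0 = b * max 1 ((a / 2) powr \<gamma>)"
  have m0: "0 < m0" "0 < M0" unfolding m0_def M0_def using b_pos a by (auto simp: less_max_iff_disj)
  (* The admissible oscillation, relative to R: it must not blur the levels b1 < b2 and a < a1, and the
     drift may vary by at most a factor l over a few multiples of it. *)
  define d where "d = min (min ((b2 - b1) / 3) (a1 - a)) (min (a * (1 / l - 1) / 8) (1 / 2))"
  have d: "0 < d" "3 * d \<le> b2 - b1" "d \<le> a1 - a" "l * (1 + 8 * d / a) \<le> 1" "d \<le> 1 / 2"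
  proof -
    have "1 < 1 / l" using l by simp
    then show "0 < d" unfolding d_def using b2 lev a by simp
    have "d \<le> a * (1 / l - 1) / 8" unfolding d_def by linarith
    then have "8 * d / a \<le> 1 / l - 1" using a by (subst pos_divide_le_eq) (auto simp: algebra_simps)
    then have "l * (1 + 8 * d / a) \<le> l * (1 / l)" using l by (intro mult_left_mono) auto
    then show "l * (1 + 8 * d / a) \<le> 1" using l by simp
    have "d \<le> (b2 - b1) / 3" unfolding d_def by linarith
    then show "3 * d \<le> b2 - b1" by simp
    show "d \<le> a1 - a" unfolding d_def by linarith
    show "d \<le> 1 / 2" unfolding d_def by linarith
  qed
  (* Resisting a drift m0 R powr \<gamma> for half of the time C R powr (1 - \<gamma>) costs the action
     (m0\<^sup>2 C / 4 - m0) R powr (1 + \<gamma>), and for this C that is the full potential \<kappa> R powr (1 + \<gamma>). *)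
  define C where "C = 4 * (\<kappa> + m0) / m0\<^sup>2"
  have C: "0 < C" "m0\<^sup>2 * C / 4 - m0 = \<kappa>" unfolding C_def using \<kappa> m0 by (auto simp: field_simps)
  have cc: "0 < c powr (1 + \<gamma>)" using c_pos by simp
  (* The second bound makes the drift move the path by at most d R in one step, the third one makes the
     oscillation bound fail with probability at most a multiple of n powr (- 2). *)
  obtain K :: nat where K0: "max 4 (max (2 * M0 * C / d) (8 * C / (d\<^sup>2 * c powr (1 + \<gamma>)))) \<le> real K"
    using real_arch_simple by blast
  have K: "4 \<le> real K" "2 * M0 * C \<le> d * real K" "8 * C \<le> d\<^sup>2 * c powr (1 + \<gamma>) * real K"
    using K0 d(1) cc by (simp_all add: field_simps)
  define R where "R n = f (real n + 1)" for n :: nat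
  define T where "T n = C * R n powr (1 - \<gamma>)" for n
  define h where "h n = (T n + 1) / real K" for n
  define r where "r n = real n - T n" for n
  define A where "A n = l * (U (b1 * R n) - U (a1 * R n))" for n
  define Bad where "Bad n = bad_window (r n) (h n) K (A n) (d * R n)" for n
  have n1_top: "filterlim (\<lambda>n. real n + 1) at_top sequentially" "filterlim (\<lambda>n. real n / 2) at_top sequentially"
    by real_asymp+
  have "\<forall>\<^sub>F n in sequentially. R n = c * (ln (real n + 1)) powr (1 / (1 + \<gamma>))"
    unfolding R_def using f_log n1_top(1) unfolding filterlim_iff by blast
  moreover have "\<forall>\<^sub>F n in sequentially. R n powr (1 + \<gamma>) = c powr (1 + \<gamma>) * ln (real n + 1)"
    unfolding R_def using f_powr n1_top(1) unfolding filterlim_iff by blast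
  moreover have "\<forall>\<^sub>F n in sequentially. f (real n / 2) = c * (ln (real n / 2)) powr (1 / (1 + \<gamma>))"
    using f_log n1_top(2) unfolding filterlim_iff by blast
  moreover have "\<forall>\<^sub>F n in sequentially. 1 \<le> C * (c * (ln (real n + 1)) powr (1 / (1 + \<gamma>))) powr (1 - \<gamma>)
      \<and> C * (c * (ln (real n + 1)) powr (1 / (1 + \<gamma>))) powr (1 - \<gamma>) \<le> real n / 2
      \<and> (1 - d) * (c * (ln (real n + 1)) powr (1 / (1 + \<gamma>))) \<le> c * (ln (real n / 2)) powr (1 / (1 + \<gamma>))
      \<and> 2 * x0 / a \<le> c * (ln (real n + 1)) powr (1 / (1 + \<gamma>))"
  proof -
    define e1 where "e1 = 1 / (1 + \<gamma>)"
    define e2 where "e2 = 1 - \<gamma>"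
    define X0 where "X0 = 2 * x0 / a"
    have e: "0 < e1" "0 < e2" "0 < X0" unfolding e1_def e2_def X0_def using gamma x0 a by auto
    have "\<forall>\<^sub>F n in at_top. 1 \<le> C * (c * (ln (n + 1)) powr e1) powr e2" using e C c_pos by real_asymp
    moreover have "\<forall>\<^sub>F n in at_top. C * (c * (ln (n + 1)) powr e1) powr e2 \<le> n / 2" using e C c_pos by real_asymp
    moreover have "\<forall>\<^sub>F n in at_top. (1 - d) * (c * (ln (n + 1)) powr e1) \<le> c * (ln (n / 2)) powr e1"
      using e d(1,5) c_pos by real_asymp
    moreover have "\<forall>\<^sub>F n in at_top. X0 \<le> c * (ln (n + 1)) powr e1" using e c_pos by real_asymp
    ultimately have "\<forall>\<^sub>F n in at_top. 1 \<le> C * (c * (ln (n + 1)) powr e1) powr e2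
      \<and> C * (c * (ln (n + 1)) powr e1) powr e2 \<le> n / 2
      \<and> (1 - d) * (c * (ln (n + 1)) powr e1) \<le> c * (ln (n / 2)) powr e1
      \<and> X0 \<le> c * (ln (n + 1)) powr e1" by eventually_elim simp
    then show ?thesis using filterlim_real_sequentially unfolding filterlim_iff e1_def e2_def X0_def by blast
  qed
  moreover have "\<forall>\<^sub>F n in sequentially. max s 1 \<le> real n / 2"
    using n1_top(2) unfolding filterlim_at_top by blast
  ultimately have "\<forall>\<^sub>F n in sequentially. R n powr (1 + \<gamma>) = c powr (1 + \<gamma>) * ln (real n + 1)
      \<and> 1 \<le> T n \<and> T n \<le> real n / 2 \<and> (1 - d) * R n \<le> f (real n / 2) \<and> x0 \<le> a / 2 * R n \<and> s \<le> real n / 2 \<and> 1 \<le> real n / 2"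
  proof eventually_elim
    case (elim n)
    have "2 * x0 / a \<le> R n" using elim by simp
    then have "x0 \<le> a / 2 * R n" using a by (simp add: field_simps)
    then show ?case using elim unfolding T_def by auto
  qed
  then obtain n0 where n0: "\<And>n. n0 \<le> n \<Longrightarrow> R n powr (1 + \<gamma>) = c powr (1 + \<gamma>) * ln (real n + 1)
      \<and> 1 \<le> T n \<and> T n \<le> real n / 2 \<and> (1 - d) * R n \<le> f (real n / 2) \<and> x0 \<le> a / 2 * R n \<and> s \<le> real n / 2 \<and> 1 \<le> real n / 2"
    unfolding eventually_sequentially by blast
  have Rpos: "0 < R n" if "n0 \<le> n" for n
  proof -
    have "0 < a / 2 * R n" using n0[OF that] x0(1) by linarith
    then show ?thesis using a by (simp add: zero_less_mult_iff)
  qed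
  have hb: "0 < h n" "h n \<le> T n / 2" "h n * real K \<le> 2 * T n" "h n * real K = T n + 1" if "n0 \<le> n" for n
  proof -
    have T1: "1 \<le> T n" using n0[OF that] by blast
    show "0 < h n" unfolding h_def using T1 K by simp
    show hK: "h n * real K = T n + 1" unfolding h_def using K by simp
    then show "h n * real K \<le> 2 * T n" using T1 by simp
    have "h n * 4 \<le> h n * real K" using K(1) \<open>0 < h n\<close> by (intro mult_left_mono) auto
    then show "h n \<le> T n / 2" using hK T1 by simp
  qed
  have A_eq: "A n = l * (\<kappa> * (b1 powr (1 + \<gamma>) - a1 powr (1 + \<gamma>))) * R n powr (1 + \<gamma>)" for n
    unfolding A_def U_def by (simp add: powr_mult algebra_simps)
  have RR: "R n powr (1 - \<gamma>) * R n powr (1 + \<gamma>) = (R n)\<^sup>2" "R n powr \<gamma> * R n powr (1 - \<gamma>) = R n"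
    "(R n powr \<gamma>)\<^sup>2 * R n powr (1 - \<gamma>) = R n powr (1 + \<gamma>)" "R n powr \<gamma> * R n = R n powr (1 + \<gamma>)"
    if "n0 \<le> n" for n
  proof -
    have Rn: "R n = R n powr 1" using Rpos[OF that] by simp
    show "R n powr (1 - \<gamma>) * R n powr (1 + \<gamma>) = (R n)\<^sup>2"
      using Rpos[OF that] by (simp add: powr_add[symmetric] powr_numeral)
    show R1: "R n powr \<gamma> * R n powr (1 - \<gamma>) = R n" using Rpos[OF that] by (simp add: powr_add[symmetric])
    show R2: "R n powr \<gamma> * R n = R n powr (1 + \<gamma>)" using Rpos[OF that] by (simp add: powr_add)
    show "(R n powr \<gamma>)\<^sup>2 * R n powr (1 - \<gamma>) = R n powr (1 + \<gamma>)"
      by (simp only: power2_eq_square mult.assoc R1 R2)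
  qed
  have r_nonneg: "0 \<le> r n" "s \<le> r n" "real n / 2 \<le> r n" if "n0 \<le> n" for n
    using n0[OF that] unfolding r_def by linarith+
  define pb where "pb n = (1 / sqrt (1 - l)) ^ K * (real (Suc n) powr (- P)) + real K * 4 * (real (Suc n) powr (- 2))" for n
  have "AE \<omega> in M. \<forall>\<^sub>F n in sequentially. \<omega> \<notin> Bad n"
  proof (rule AE_eventually_not_if_summable_bound[where ?n0.0 = n0 and p = pb])
    fix n assume n: "n0 \<le> n"
    show "Bad n \<in> sets M" unfolding Bad_def using r_nonneg[OF n] hb[OF n] by (intro bad_window_sets)
    note N0 = n0[OF n]
    have "prob (Bad n) \<le> (1 / sqrt (1 - l)) ^ K * exp (- l * A n) + real K * (4 * exp (- (d * R n)\<^sup>2 / (2 * h n)))"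
      unfolding Bad_def using r_nonneg[OF n] hb[OF n] l d Rpos[OF n] by (intro prob_bad_window) auto
    also have "exp (- l * A n) = real (Suc n) powr (- P)"
    proof -
      have "l * A n = P * ln (real n + 1)" unfolding A_eq P_def Q_def \<kappa>_def using N0 by simp
      then show ?thesis unfolding powr_def by (simp add: add.commute)
    qed
    also have "exp (- (d * R n)\<^sup>2 / (2 * h n)) \<le> real (Suc n) powr (- 2)"
    proof -
      have ln0: "0 \<le> ln (real n + 1)" by simp
      have "2 * ln (real n + 1) * (2 * h n) * real K = 4 * ln (real n + 1) * (h n * real K)" by simp
      also have "\<dots> \<le> 4 * ln (real n + 1) * (2 * T n)" using hb(3)[OF n] ln0 by (intro mult_left_mono) auto
      also have "\<dots> = 8 * C * (ln (real n + 1) * R n powr (1 - \<gamma>))" unfolding T_def by simp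
      also have "\<dots> \<le> d\<^sup>2 * c powr (1 + \<gamma>) * real K * (ln (real n + 1) * R n powr (1 - \<gamma>))"
        using K(3) ln0 by (intro mult_right_mono) auto
      also have "\<dots> = d\<^sup>2 * (R n powr (1 - \<gamma>) * R n powr (1 + \<gamma>)) * real K" using N0 by simp
      also have "\<dots> = (d * R n)\<^sup>2 * real K" unfolding RR(1)[OF n] by (simp add: power_mult_distrib)
      finally have "2 * ln (real n + 1) * (2 * h n) \<le> (d * R n)\<^sup>2" using K(1) by simp
      then have "2 * ln (real n + 1) \<le> (d * R n)\<^sup>2 / (2 * h n)" using hb(1)[OF n] by (subst pos_le_divide_eq) auto
      then show ?thesis unfolding powr_def by (simp add: add.commute)
    qed
    finally show "prob (Bad n) \<le> pb n" unfolding pb_def using K by (simp add: mult_ac)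
  next
    have sp: "summable (\<lambda>n. real (Suc n) powr (- q))" if "1 < q" for q
      using that summable_real_powr_iff[of "- q"] summable_Suc_iff[of "\<lambda>n. real n powr (- q)"] by simp
    show "summable pb" unfolding pb_def using sp[OF P] sp[of 2] by (intro summable_add summable_mult) auto
  qed
  then show ?thesis using AE_reflected_path
  proof eventually_elim
    case (elim \<omega>)
    interpret PP: reflected_path B f s x "\<lambda>t. W t \<omega>" "\<lambda>t. X t \<omega>" "\<lambda>t. L1 t \<omega>" "\<lambda>t. Lf t \<omega>" using elim by blast
    obtain n2 where n2: "\<And>n. n2 \<le> n \<Longrightarrow> \<omega> \<notin> Bad n" using elim(1) unfolding eventually_sequentially by blast
    define n3 where "n3 = max n0 n2"
    show ?case
    proof
      assume "\<exists>\<^sub>F t in at_top. f t \<le> X t \<omega>"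
      moreover have "\<forall>\<^sub>F t in at_top. max s (real n3 + 1) \<le> t" by (rule eventually_ge_at_top)
      ultimately have "\<exists>\<^sub>F t in at_top. f t \<le> X t \<omega> \<and> max s (real n3 + 1) \<le> t"
        by (rule frequently_eventually_frequently)
      then obtain \<sigma>0 where \<sigma>0: "f \<sigma>0 \<le> X \<sigma>0 \<omega>" "s \<le> \<sigma>0" "real n3 + 1 \<le> \<sigma>0" by (auto dest!: frequently_ex)
      have \<sigma>0': "0 \<le> \<sigma>0" using \<sigma>0 by linarith
      have fpos: "1 \<le> f t" if "s \<le> t" for t using PP.y_in[OF that] by simp
      have cont: "continuous_on {\<sigma>0..t} (\<lambda>v. X v \<omega> - k * f v)" for t k
        by (intro continuous_intros continuous_on_subset[OF PP.y_cont] continuous_on_subset[OF f_cont])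
          (use \<sigma>0 \<sigma>0' in auto)
      have "a * f t \<le> X t \<omega>" if t: "\<sigma>0 \<le> t" for t
      proof (rule ccontr)
        assume neg: "\<not> a * f t \<le> X t \<omega>"
        have "a * f \<sigma>0 < 1 * f \<sigma>0" using a fpos[of \<sigma>0] \<sigma>0 by (intro mult_strict_right_mono) auto
        then obtain \<tau> where \<tau>: "\<sigma>0 < \<tau>" "\<tau> \<le> t" "X \<tau> \<omega> - a * f \<tau> = 0"
          "\<And>v. \<sigma>0 \<le> v \<Longrightarrow> v < \<tau> \<Longrightarrow> 0 < X v \<omega> - a * f v"
          using first_zero[OF cont[of t a] t] neg \<sigma>0(1) by (smt (verit))
        have fm: "f u \<le> f v" if "\<sigma>0 \<le> u" "u \<le> v" for u v
          using that \<sigma>0' by (intro mono_onD[OF f_mono]) auto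
        have "b2 * f \<sigma>0 \<le> 1 * f \<sigma>0" using b2 fpos[of \<sigma>0] \<sigma>0 by (intro mult_right_mono) auto
        moreover have "a * f \<tau> < b2 * f \<tau>" using fpos[of \<tau>] \<tau>(1) \<sigma>0 lev b2 by (intro mult_strict_right_mono) auto
        ultimately obtain \<sigma> where \<sigma>: "\<sigma>0 \<le> \<sigma>" "\<sigma> < \<tau>" "X \<sigma> \<omega> - b2 * f \<sigma> = 0"
          "\<And>v. \<sigma> < v \<Longrightarrow> v \<le> \<tau> \<Longrightarrow> X v \<omega> - b2 * f v < 0"
          using last_zero[OF cont[of \<tau> b2]] \<tau>(1,3) \<sigma>0(1) by (smt (verit))
        define n where "n = nat \<lfloor>\<tau>\<rfloor>"
        have \<tau>n: "real n \<le> \<tau>" "\<tau> < real n + 1" unfolding n_def using \<tau>(1) \<sigma>0' by linarith+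
        have n: "n0 \<le> n" "n2 \<le> n" using \<tau>n \<tau>(1) \<sigma>0(3) unfolding n3_def by linarith+
        note N0 = n0[OF n(1)] and Rn = Rpos[OF n(1)] and Hb = hb[OF n(1)]
        (* If the last visit of the upper level precedes the window, only the duration inside it counts. *)
        let ?\<sigma> = "max \<sigma> (r n)"
        have T1: "1 \<le> T n" using N0 by blast
        have r\<tau>: "r n \<le> \<tau>" unfolding r_def using \<tau>n T1 by linarith
        have \<sigma>_le: "?\<sigma> \<le> \<tau>" using \<sigma>(2) r\<tau> by simp
        have last_point: "r n + real K * h n = real n + 1" unfolding r_def using Hb(4) by (simp add: mult.commute)
        have f_window: "(1 - d) * R n \<le> f u" "f u \<le> R n" if "r n \<le> u" "u \<le> \<tau>" for u
        proof -
          have "f (real n / 2) \<le> f u" using that r_nonneg[OF n(1)] by (intro mono_onD[OF f_mono]) auto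
          then show "(1 - d) * R n \<le> f u" using N0 by linarith
          show "f u \<le> R n" unfolding R_def using that r_nonneg[OF n(1)] \<tau>n by (intro mono_onD[OF f_mono]) auto
        qed
        have inside: "1 < X u \<omega>" "a / 2 * R n \<le> X u \<omega>" "X u \<omega> \<le> R n" if u: "?\<sigma> \<le> u" "u \<le> \<tau>" for u
        proof -
          have su: "\<sigma>0 \<le> u" "s \<le> u" "r n \<le> u" using u \<sigma>(1) \<sigma>0(2) by linarith+
          have "a * f u \<le> X u \<omega>" using \<tau>(3) \<tau>(4)[of u] su u(2) by (cases "u = \<tau>") auto
          moreover have "a * ((1 - d) * R n) \<le> a * f u" using f_window(1)[OF su(3) u(2)] a by (intro mult_left_mono) auto
          moreover have "a * (1 / 2 * R n) \<le> a * ((1 - d) * R n)"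
            using d(5) Rn a by (intro mult_left_mono mult_right_mono) auto
          ultimately show lo: "a / 2 * R n \<le> X u \<omega>" by simp
          then show "1 < X u \<omega>" using N0 x0(1) by linarith
          show "X u \<omega> \<le> R n" using PP.y_in[OF su(2)] f_window(2)[OF su(3) u(2)] by simp
        qed
        have Bz: "B z = b * z powr \<gamma>" if "a / 2 * R n \<le> z" for z using x0(2)[of z] that N0 by simp
        have "A n \<le> (\<Sum>i<K. (W (r n + real (Suc i) * h n) \<omega> - W (r n + real i * h n) \<omega>)\<^sup>2 / (2 * h n))"
        proof (rule PP.action_of_dip[where \<sigma> = ?\<sigma> and \<tau> = \<tau> and lo = "a / 2 * R n" and hi = "R n" and m = "m0 * R n powr \<gamma>"
              and m' = "M0 * R n powr \<gamma>" and \<delta> = "d * R n" and U = U and c = l and upper = "b1 * R n" and lower = "a1 * R n"])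
          show "s \<le> r n" by (rule r_nonneg[OF n(1)])
          show "0 < h n" by (rule Hb)
          show "s \<le> ?\<sigma>" using r_nonneg[OF n(1)] by simp
          show "?\<sigma> \<le> \<tau>" by (rule \<sigma>_le)
          show "r n \<le> \<tau>" by (rule r\<tau>)
          show "\<tau> < r n + real K * h n" unfolding last_point by (rule \<tau>n)
        next
          fix u assume u: "?\<sigma> \<le> u" "u \<le> \<tau>"
          show "1 < X u \<omega> \<and> a / 2 * R n \<le> X u \<omega> \<and> X u \<omega> \<le> R n" using inside[OF u] by blast
        next
          fix u assume u: "?\<sigma> < u" "u \<le> \<tau>"
          have su: "s \<le> u" using u \<sigma>(1) \<sigma>0(2) by linarith
          have "X u \<omega> < b2 * f u" using \<sigma>(4)[of u] u by simp
          also have "b2 * f u \<le> 1 * f u" using b2 fpos[OF su] by (intro mult_right_mono) auto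
          finally show "X u \<omega> < f u" by simp
        next
          fix z assume z: "a / 2 * R n \<le> z" "z \<le> R n"
          show "m0 * R n powr \<gamma> \<le> B z \<and> B z \<le> M0 * R n powr \<gamma>"
            unfolding Bz[OF z(1)] m0_def M0_def using drift_bounds_scaled[OF a(1) Rn z] by blast
        next
          show "0 \<le> m0 * R n powr \<gamma>" "0 \<le> M0 * R n powr \<gamma>" using m0 by simp_all
          have "M0 * R n powr \<gamma> * h n * real K = M0 * R n powr \<gamma> * (h n * real K)" by simp
          also have "\<dots> \<le> M0 * R n powr \<gamma> * (2 * T n)" using Hb(3) m0 by (intro mult_left_mono) auto
          also have "\<dots> = 2 * M0 * C * (R n powr \<gamma> * R n powr (1 - \<gamma>))" unfolding T_def by simp
          also have "\<dots> = 2 * M0 * C * R n" unfolding RR(2)[OF n(1)] ..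
          also have "\<dots> \<le> d * real K * R n" using K(2) Rn by (intro mult_right_mono) auto
          finally have "M0 * R n powr \<gamma> * h n * real K \<le> d * R n * real K" by (simp add: mult_ac)
          then show "M0 * R n powr \<gamma> * h n \<le> d * R n" using K(1) by (simp add: mult_le_cancel_right)
        next
          fix j u assume j: "j < K" and u: "r n + real j * h n \<le> u" "u \<le> r n + real (Suc j) * h n"
          show "\<bar>W u \<omega> - W (r n + real j * h n) \<omega>\<bar> \<le> d * R n"
          proof (rule abs_increment_le_outside_osc)
            show "\<omega> \<notin> osc (r n + real j * h n) (h n) (d * R n)" using n2[OF n(2)] j unfolding Bad_def bad_window_def by blast
            show "0 \<le> r n + real j * h n" using r_nonneg(1)[OF n(1)] Hb(1) by simp
            show "u \<in> {r n + real j * h n..r n + real j * h n + h n}" using u by (simp add: algebra_simps)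
          qed (use elim Hb in auto)
        next
          show "mono_on {0..} U" by (rule U_mono)
          show "0 \<le> a / 2 * R n" "0 \<le> l" "0 \<le> R n" "0 \<le> d * R n" using a Rn l d by simp_all
          show "0 \<le> b1 * R n" using lev a Rn by simp
          show "a1 * R n < b1 * R n" using lev Rn by (intro mult_strict_right_mono) auto
          have "a * f \<tau> \<le> a * R n" using f_window(2)[OF r\<tau>] a by (intro mult_left_mono) auto
          moreover have "d * R n \<le> (a1 - a) * R n" using d(3) Rn by (intro mult_right_mono) auto
          ultimately show "X \<tau> \<omega> + d * R n \<le> a1 * R n" using \<tau>(3) by (simp add: left_diff_distrib)
        next
          fix v v' z assume v: "v \<in> {a / 2 * R n..R n}" "v' \<in> {a / 2 * R n..R n}" "z \<in> {a / 2 * R n..R n}" "v' < v"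
            "\<bar>z - v\<bar> \<le> 2 * (d * R n)" "\<bar>v' - v\<bar> \<le> 2 * (d * R n)"
          have "l * (2 * b / (1 + \<gamma>) * v powr (1 + \<gamma>) - 2 * b / (1 + \<gamma>) * v' powr (1 + \<gamma>)) \<le> 2 * (v - v') * (b * z powr \<gamma>)"
            by (rule potential_slope[OF a(1) _ Rn l(1) d(4)]) (use v d in auto)
          then show "l * (U v - U v') \<le> 2 * (v - v') * B z" using Bz[of z] v(3) unfolding U_def \<kappa>_def by simp
        next
          assume "r n < ?\<sigma>"
          then have s\<sigma>: "?\<sigma> = \<sigma>" "r n \<le> \<sigma>" by auto
          have "b2 * ((1 - d) * R n) \<le> b2 * f \<sigma>" using f_window(1)[OF s\<sigma>(2)] \<sigma>(2) b2 lev a by (intro mult_left_mono) auto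
          moreover have "(b2 * d) * R n \<le> (1 * d) * R n" using b2 d(1) Rn by (intro mult_right_mono) auto
          moreover have "3 * d * R n \<le> (b2 - b1) * R n" using d(2) Rn by (intro mult_right_mono) auto
          moreover have "b2 * ((1 - d) * R n) = b2 * R n - (b2 * d) * R n" by (simp add: algebra_simps)
          moreover have "(b2 - b1) * R n = b2 * R n - b1 * R n" by (simp add: algebra_simps)
          ultimately show "b1 * R n + 2 * (d * R n) \<le> X ?\<sigma> \<omega>" unfolding s\<sigma>(1) using \<sigma>(3) by linarith
        next
          show "A n \<le> l * (U (b1 * R n) - U (a1 * R n))" unfolding A_def by simp
          have gap: "a1 powr (1 + \<gamma>) \<le> b1 powr (1 + \<gamma>)" using lev a gamma by (intro powr_mono2) auto
          have "A n \<le> 1 * (\<kappa> * 1) * R n powr (1 + \<gamma>)" unfolding A_eq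
          proof (intro mult_right_mono mult_mono mult_left_mono)
            have "b1 powr (1 + \<gamma>) \<le> 1 powr (1 + \<gamma>)" using lev a gamma by (intro powr_mono2) auto
            moreover have "0 \<le> a1 powr (1 + \<gamma>)" by simp
            ultimately show "b1 powr (1 + \<gamma>) - a1 powr (1 + \<gamma>) \<le> 1" unfolding powr_one_eq_one by linarith
            have "0 \<le> b1 powr (1 + \<gamma>) - a1 powr (1 + \<gamma>)" using gap by simp
            then show "0 \<le> \<kappa> * (b1 powr (1 + \<gamma>) - a1 powr (1 + \<gamma>))" using \<kappa> by simp
          qed (use l \<kappa> gap in auto)
          also have "\<dots> = (m0\<^sup>2 * C / 4 - m0) * R n powr (1 + \<gamma>)" unfolding C(2) by simp
          also have "\<dots> = m0\<^sup>2 * C / 4 * ((R n powr \<gamma>)\<^sup>2 * R n powr (1 - \<gamma>)) - m0 * (R n powr \<gamma> * R n)"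
            unfolding RR(3,4)[OF n(1)] by (rule left_diff_distrib)
          also have "\<dots> = (m0 * R n powr \<gamma>)\<^sup>2 / 2 * (T n / 2) - m0 * R n powr \<gamma> * R n"
            unfolding T_def by (simp add: power_mult_distrib)
          also have "(m0 * R n powr \<gamma>)\<^sup>2 / 2 * (T n / 2) \<le> (m0 * R n powr \<gamma>)\<^sup>2 / 2 * (\<tau> - r n - h n)"
            using Hb(2) \<tau>n unfolding r_def by (intro mult_left_mono) auto
          finally show "A n \<le> (m0 * R n powr \<gamma>)\<^sup>2 / 2 * (\<tau> - r n - h n) - m0 * R n powr \<gamma> * R n" by simp
        qed
        then have "\<omega> \<in> Bad n" using elim unfolding Bad_def bad_window_def action_def by simp
        then show False using n2[OF n(2)] by blast
      qed
      then show "\<forall>\<^sub>F t in at_top. a * f t \<le> X t \<omega>" unfolding eventually_at_top_linorder by blast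
    qed
  qed
qed

end

section \<open>The lower limit\<close>

lemma Liminf_eq_from_levels:
  fixes g :: "real \<Rightarrow> real" and l u :: "nat \<Rightarrow> real"
  assumes "l \<longlonglongrightarrow> r" "u \<longlonglongrightarrow> r"
    and low: "\<And>k. \<forall>\<^sub>F t in at_top. l k \<le> g t" and high: "\<And>k. \<exists>\<^sub>F t in at_top. g t \<le> u k"
  shows "Liminf at_top (\<lambda>t. ereal (g t)) = ereal r"
proof (rule antisym)
  show "ereal r \<le> Liminf at_top (\<lambda>t. ereal (g t))"
  proof (rule LIMSEQ_le_const2)
    show "(\<lambda>k. ereal (l k)) \<longlonglongrightarrow> ereal r" using assms(1) by simp
    have "ereal (l k) \<le> Liminf at_top (\<lambda>t. ereal (g t))" for k
      by (rule Liminf_bounded) (use low[of k] in simp)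
    then show "\<exists>N. \<forall>n\<ge>N. ereal (l n) \<le> Liminf at_top (\<lambda>t. ereal (g t))" by blast
  qed
  show "Liminf at_top (\<lambda>t. ereal (g t)) \<le> ereal r"
  proof (rule LIMSEQ_le_const)
    show "(\<lambda>k. ereal (u k)) \<longlonglongrightarrow> ereal r" using assms(2) by simp
    have "Liminf at_top (\<lambda>t. ereal (g t)) \<le> ereal (u k)" for k
    proof (rule ccontr)
      assume "\<not> Liminf at_top (\<lambda>t. ereal (g t)) \<le> ereal (u k)"
      then have "\<forall>\<^sub>F t in at_top. ereal (u k) < ereal (g t)" by (intro less_LiminfD) simp
      then have "\<forall>\<^sub>F t in at_top. \<not> g t \<le> u k" by eventually_elim simp
      then show False using high[of k] unfolding frequently_def by blast
    qed
    then show "\<exists>N. \<forall>n\<ge>N. Liminf at_top (\<lambda>t. ereal (g t)) \<le> ereal (u n)" by blast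
  qed
qed

theorem theorem4:
  fixes f B :: "real \<Rightarrow> real" and \<gamma> b c s x :: real
    and M :: "'a measure" and F :: "real \<Rightarrow> 'a measure"
    and W L1 Lf X :: "real \<Rightarrow> 'a \<Rightarrow> real"
  assumes "mono_on {0..} f" and "C_k_on 3 f {0..}" and "f 0 > 1"
    and "B \<in> borel_measurable (restrict_space borel {1..})"
    and "locally_bounded_on {1..} B"
    and "-1 < \<gamma>" and "\<gamma> < 1" and "b > 0" and "c > 0"
    and "eventually (\<lambda>y. B y = b * y powr \<gamma>) at_top"
    and "eventually (\<lambda>t. f t = c * (ln t) powr (1 / (1 + \<gamma>))) at_top"
    and "2 * b * c powr (1 + \<gamma>) / (1 + \<gamma>) > 1"
    and "s \<ge> 0" and "x \<in> {1..f s}"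
    and "reflected_diffusion B f s x M F W L1 Lf X"
  shows "AE \<omega> in M. Liminf at_top (\<lambda>t. ereal (X t \<omega> / f t)) =
           ereal ((1 - (1 + \<gamma>) / (2 * b * c powr (1 + \<gamma>))) powr (1 / (1 + \<gamma>)))"
proof -
  have f_cont: "continuous_on {0..} f"
  proof -
    obtain D :: "nat \<Rightarrow> real \<Rightarrow> real" where D: "D 0 = f"
      "\<And>j x. j < 3 \<Longrightarrow> x \<in> {0..} \<Longrightarrow> (D j has_real_derivative D (Suc j) x) (at x within {0..})"
      using assms(2) unfolding C_k_on_def by blast
    have "(f has_real_derivative D (Suc 0) x) (at x within {0..})" if "x \<in> {0..}" for x
      using D(2)[of 0 x] that unfolding D(1) by simp
    then show ?thesis by (rule DERIV_continuous_on)
  qed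
  interpret reflected_bm M F W f B \<gamma> b c s x L1 Lf X
  proof
    show "filtered_prob_space M F" "brownian_motion M F W"
      using assms(15) unfolding reflected_diffusion_def by blast+
    show "AE \<omega> in M.
        continuous_on {s..} (\<lambda>t. X t \<omega>) \<and>
        (\<forall>t\<ge>s. X t \<omega> \<in> {1..f t}) \<and>
        boundary_local_time s (\<lambda>_. 1) (\<lambda>t. X t \<omega>) (\<lambda>t. L1 t \<omega>) \<and>
        boundary_local_time s f (\<lambda>t. X t \<omega>) (\<lambda>t. Lf t \<omega>) \<and>
        (\<forall>t\<ge>s. X t \<omega> =
           x + W t \<omega> - W s \<omega> + (LINT u:{s..t}|lborel. B (X u \<omega>)) + L1 t \<omega> - Lf t \<omega>)"
      using assms(15) unfolding reflected_diffusion_def by blast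
  qed (use assms f_cont in auto)
  define \<rho> where "\<rho> = (1 - 1 / Q) powr (1 / (1 + \<gamma>))"
  have Q1: "1 < Q" using assms(12) unfolding Q_def .
  have \<rho>: "0 < \<rho>" "\<rho> < 1" "\<rho> powr (1 + \<gamma>) = 1 - 1 / Q"
  proof -
    have "(1 - 1 / Q) powr (1 / (1 + \<gamma>)) < 1 powr (1 / (1 + \<gamma>))"
      using Q1 gamma by (intro powr_less_mono2) auto
    then show "\<rho> < 1" unfolding \<rho>_def by simp
    show "0 < \<rho>" "\<rho> powr (1 + \<gamma>) = 1 - 1 / Q" unfolding \<rho>_def using Q1 gamma by (auto simp: powr_powr)
  qed
  have sub: "Q * (1 - a powr (1 + \<gamma>)) < 1" if "\<rho> < a" for a
  proof -
    have "\<rho> powr (1 + \<gamma>) < a powr (1 + \<gamma>)" using that \<rho> gamma by (intro powr_less_mono2) auto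
    then have "Q * (1 - a powr (1 + \<gamma>)) < Q * (1 / Q)" using \<rho>(3) Q1 by (intro mult_strict_left_mono) auto
    then show ?thesis using Q1 by simp
  qed
  have super: "1 < Q * (1 - a powr (1 + \<gamma>))" if "0 < a" "a < \<rho>" for a
  proof -
    have "a powr (1 + \<gamma>) < \<rho> powr (1 + \<gamma>)" using that \<rho> gamma by (intro powr_less_mono2) auto
    then have "Q * (1 / Q) < Q * (1 - a powr (1 + \<gamma>))" using \<rho>(3) Q1 by (intro mult_strict_left_mono) auto
    then show ?thesis using Q1 by simp
  qed
  define l where "l k = \<rho> - \<rho> / (real k + 2)" for k :: nat
  define u where "u k = \<rho> + (1 - \<rho>) / (real k + 1)" for k :: nat
  define u' where "u' k = \<rho> + (1 - \<rho>) / (real k + 2)" for k :: nat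
  have lim: "l \<longlonglongrightarrow> \<rho>" "u \<longlonglongrightarrow> \<rho>" unfolding l_def u_def by real_asymp+
  have lk: "0 < l k" "l k < \<rho>" "l k < 1" for k
  proof -
    show "0 < l k" "l k < \<rho>" unfolding l_def using \<rho>(1) by (simp_all add: field_simps add_pos_nonneg)
    then show "l k < 1" using \<rho>(2) by simp
  qed
  have uk: "\<rho> < u' k" "u' k < u k" "u' k < 1" for k
  proof -
    have "(1 - \<rho>) / (real k + 2) < (1 - \<rho>) / (real k + 1)" "(1 - \<rho>) / (real k + 2) < (1 - \<rho>) / 1"
      using \<rho>(2) by (intro divide_strict_left_mono; simp)+
    moreover have "0 < (1 - \<rho>) / (real k + 2)" using \<rho>(2) by simp
    ultimately show "\<rho> < u' k" "u' k < u k" "u' k < 1" unfolding u_def u'_def by simp_all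
  qed
  have "AE \<omega> in M. \<forall>k. (\<exists>\<^sub>F t in at_top. X t \<omega> \<le> u k * f t) \<and> (\<forall>\<^sub>F t in at_top. l k * f t \<le> X t \<omega>)"
  proof (subst AE_all_countable, rule allI)
    fix k
    have "AE \<omega> in M. \<exists>\<^sub>F t in at_top. X t \<omega> \<le> u k * f t"
      using uk[of k] \<rho>(1) by (intro frequently_below_level[of "u' k"] sub) auto
    moreover have "AE \<omega> in M. (\<exists>\<^sub>F t in at_top. f t \<le> X t \<omega>) \<longrightarrow> (\<forall>\<^sub>F t in at_top. l k * f t \<le> X t \<omega>)"
      using lk[of k] by (intro eventually_above_level super) auto
    ultimately show "AE \<omega> in M. (\<exists>\<^sub>F t in at_top. X t \<omega> \<le> u k * f t) \<and> (\<forall>\<^sub>F t in at_top. l k * f t \<le> X t \<omega>)"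
      using frequently_at_boundary by eventually_elim blast
  qed
  then have "AE \<omega> in M. Liminf at_top (\<lambda>t. ereal (X t \<omega> / f t)) = ereal \<rho>"
  proof eventually_elim
    case (elim \<omega>)
    have fpos: "\<forall>\<^sub>F t in at_top. 0 < f t" using f_at_top unfolding filterlim_at_top_dense by blast
    show ?case
    proof (rule Liminf_eq_from_levels[OF lim])
      fix k
      have "\<forall>\<^sub>F t in at_top. l k * f t \<le> X t \<omega>" using elim by blast
      with fpos show "\<forall>\<^sub>F t in at_top. l k \<le> X t \<omega> / f t" by eventually_elim (simp add: pos_le_divide_eq)
      have "\<exists>\<^sub>F t in at_top. X t \<omega> \<le> u k * f t" using elim by blast
      then have "\<exists>\<^sub>F t in at_top. X t \<omega> \<le> u k * f t \<and> 0 < f t" using fpos by (rule frequently_eventually_frequently)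
      then show "\<exists>\<^sub>F t in at_top. X t \<omega> / f t \<le> u k"
        by (rule frequently_elim1) (simp add: pos_divide_le_eq)
    qed
  qed
  moreover have "\<rho> = (1 - (1 + \<gamma>) / (2 * b * c powr (1 + \<gamma>))) powr (1 / (1 + \<gamma>))"
    unfolding \<rho>_def Q_def by simp
  ultimately show ?thesis by simp
qed

end
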